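(* Let $m:(0,\infty)\to(0,\infty)$ be a positive continuous function and let the observation operator $Q\in\mathcal{L}(H_{1/2},Y)$ be $m(\lambda)$-elliptic. Then there are $C,\lambda_0>0$ such that for all $\lambda\in\mathbb{R}$ with $|\lambda|\ge\lambda_0$, the inverse $(\mathcal{A}+i\lambda)^{-1}$ exists as a bounded operator on $\mathcal{H}=H_{1/2}\times H$ and $$\|(\mathcal{A}+i\lambda)^{-1}\|_{\mathcal{L}(\mathcal{H})}\le C\max\left\{\frac{1}{m(|\lambda|)},1\right\}.$$
   Context: Setting. $H=H_0$ is an infinite-dimensional complex Hilbert space, $P:H_1\to H$ is a nonnegative self-adjoint operator with compact resolvent and dense domain $H_1\subset H$. Write $Pu=\int_0^\infty\rho^2\,dE_\rho(u)$ and $f(P)u=\int_0^\infty f(\rho^2)\,dE_\rho(u)$ for its spectral resolution and Borel functional calculus. For $s\in\mathbb{R}$ set $\Lambda^s=(1+P)^s$, i.e. $\Lambda^su=\int_0^\infty(1+\rho^2)^s\,dE_\rho(u)$, and $H_s=\Lambda^{-s}(H)$ with norm $\|\Lambda^s\cdot\|_H$; for $s>0$, $H_{-s}$ is identified with the dual of $H_s$ with respect to the pivot space $H$. Thus $P$ extends to a bounded operator $H_{1/2}\to H_{-1/2}$. $Y$ is a Hilbert space (the observation space), $Q\in\mathcal{L}(H_{1/2},Y)$ and $Q^*\in\mathcal{L}(Y,H_{-1/2})$ is its adjoint, so $Q^*Q\in\mathcal{L}(H_{1/2},H_{-1/2})$ (not necessarily bounded on $H$). The damped wave generator is $\mathcal{A}=\begin{pmatrix}0&1\\-P&-Q^*Q\end{pmatrix}$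 with domain $\{(u,v)\in H_{1/2}\times H_{1/2}:\ Pu+Q^*Qv\in H\}$, on $\mathcal{H}=H_{1/2}\times H$; it generates a strongly continuous semigroup on $\mathcal{H}$. Definition ($m$-ellipticity). Let $m$ be a positive continuous function on $(0,\infty)$. $Q:H_{1/2}\to Y$ is $m(\lambda)$-elliptic if for some $\chi\in C^0([0,\infty))$ with $\chi(1)>0$ there exist $C,\lambda_0,N>0$ and a function $e(\lambda)\ge 0$ with $e(\lambda)=o(\min\{m(\lambda)\lambda^{4N},\lambda\})$ as $\lambda\to\infty$ such that $$m(\lambda)\|\chi(\lambda^{-2}P)u\|_H^2\le C\|Qu\|_Y^2+e(\lambda)\|\Lambda^{-N}u\|_H^2$$ for all $u\in H_{1/2}$ and all real $\lambda\ge\lambda_0$. *)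

theory Defs
  imports "HOL-Analysis.Analysis" "HOL-Library.Landau_Symbols"
begin

section \<open>Complex Hilbert spaces\<close>

class complex_vector = real_vector +
  fixes scaleC :: "complex \<Rightarrow> 'a \<Rightarrow> 'a"  (infixr "*\<^sub>C" 75)
  assumes scaleC_add_right: "c *\<^sub>C (x + y) = c *\<^sub>C x + c *\<^sub>C y"
    and scaleC_add_left: "(c + d) *\<^sub>C x = c *\<^sub>C x + d *\<^sub>C x"
    and scaleC_scaleC: "c *\<^sub>C d *\<^sub>C x = (c * d) *\<^sub>C x"
    and scaleR_scaleC: "r *\<^sub>R x = complex_of_real r *\<^sub>C x"

text \<open>The inner product is linear in the first and antilinear in the second argument. Its
  positive definiteness follows from \<open>norm_eq_sqrt_cinner\<close> and the norm axioms.\<close>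

class complex_inner = complex_vector + real_normed_vector +
  fixes cinner :: "'a \<Rightarrow> 'a \<Rightarrow> complex"
  assumes cinner_add_left: "cinner (x + y) z = cinner x z + cinner y z"
    and cinner_scaleC_left: "cinner (c *\<^sub>C x) y = c * cinner x y"
    and cinner_commute: "cinner x y = cnj (cinner y x)"
    and norm_eq_sqrt_cinner: "norm x = sqrt (Re (cinner x x))"

class complex_hilbert = complex_inner + complete_space

instantiation prod :: (complex_vector, complex_vector) complex_vector
begin

definition scaleC_prod_def: "c *\<^sub>C p = (c *\<^sub>C fst p, c *\<^sub>C snd p)"

instance
  by standard
    (simp_all add: scaleC_prod_def scaleR_prod_def scaleC_add_right scaleC_add_left
      scaleC_scaleC scaleR_scaleC)

end

definition csubspace :: "'a::complex_vector set \<Rightarrow> bool" where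
  "csubspace = module.subspace scaleC"

definition infinite_dimensional :: "'a::complex_vector itself \<Rightarrow> bool" where
  "infinite_dimensional _ \<longleftrightarrow> \<not> (\<exists>B::'a set. finite B \<and> module.span scaleC B = UNIV)"


section \<open>Operators\<close>

text \<open>An operator is a function together with an explicit domain. Where a space carries a norm
  different from the one of the ambient type, this norm is passed as an argument.\<close>

definition clinear_on :: "'a::complex_vector set \<Rightarrow> ('a \<Rightarrow> 'b::complex_vector) \<Rightarrow> bool" where
  "clinear_on D T \<longleftrightarrow> csubspace D \<and> (\<forall>x\<in>D. \<forall>y\<in>D. T (x + y) = T x + T y)
     \<and> (\<forall>c. \<forall>x\<in>D. T (c *\<^sub>C x) = c *\<^sub>C T x)"

definition bounded_operator ::
  "'a::complex_vector set \<Rightarrow> ('a \<Rightarrow> real) \<Rightarrow> ('b::complex_vector \<Rightarrow> real) \<Rightarrow> ('a \<Rightarrow> 'b) \<Rightarrow> bool" where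
  "bounded_operator X nX nY T \<longleftrightarrow> clinear_on X T \<and> (\<exists>K. \<forall>x\<in>X. nY (T x) \<le> K * nX x)"

definition operator_norm :: "'a set \<Rightarrow> ('a \<Rightarrow> real) \<Rightarrow> ('b \<Rightarrow> real) \<Rightarrow> ('a \<Rightarrow> 'b) \<Rightarrow> real" where
  "operator_norm X nX nY T = Sup {nY (T x) | x. x \<in> X \<and> nX x \<le> 1}"

definition inverse_operator :: "'a set \<Rightarrow> 'a set \<Rightarrow> ('a \<Rightarrow> 'a) \<Rightarrow> ('a \<Rightarrow> 'a) \<Rightarrow> bool" where
  "inverse_operator X D T R \<longleftrightarrow>
     (\<forall>x\<in>X. R x \<in> D \<and> T (R x) = x) \<and> (\<forall>u\<in>D. T u \<in> X \<and> R (T u) = u)"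

text \<open>Equality of the graphs of an operator and of its adjoint.\<close>

definition self_adjoint :: "'h::complex_hilbert set \<Rightarrow> ('h \<Rightarrow> 'h) \<Rightarrow> bool" where
  "self_adjoint D P \<longleftrightarrow> clinear_on D P \<and> closure D = UNIV \<and>
     {(v, w). \<forall>u\<in>D. cinner (P u) v = cinner u w} = {(u, P u) | u. u \<in> D}"

definition nonneg_operator :: "'h::complex_hilbert set \<Rightarrow> ('h \<Rightarrow> 'h) \<Rightarrow> bool" where
  "nonneg_operator D P \<longleftrightarrow> (\<forall>u\<in>D. cinner (P u) u \<in> \<real> \<and> 0 \<le> Re (cinner (P u) u))"

definition compact_resolvent :: "'h::complex_hilbert set \<Rightarrow> ('h \<Rightarrow> 'h) \<Rightarrow> bool" where
  "compact_resolvent D P \<longleftrightarrow>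
     (\<exists>z R. inverse_operator UNIV D (\<lambda>u. P u - z *\<^sub>C u) R \<and> bounded_operator UNIV norm norm R
        \<and> compact (closure (R ` cball 0 1)))"


section \<open>Spectral resolution and functional calculus\<close>

definition projection_valued_measure :: "(real set \<Rightarrow> 'h::complex_hilbert \<Rightarrow> 'h) \<Rightarrow> bool" where
  "projection_valued_measure E \<longleftrightarrow>
     (\<forall>B\<in>sets borel. clinear_on UNIV (E B) \<and> (\<forall>u. E B (E B u) = E B u)
        \<and> (\<forall>u v. cinner (E B u) v = cinner u (E B v)))
     \<and> (\<forall>u. E UNIV u = u)
     \<and> (\<forall>B\<in>sets borel. \<forall>B'\<in>sets borel. \<forall>u. E (B \<inter> B') u = E B (E B' u))
     \<and> (\<forall>F u. range F \<subseteq> sets borel \<longrightarrow> disjoint_family F \<longrightarrow>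
          (\<lambda>i::nat. E (F i) u) sums E (\<Union>i. F i) u)"

definition spectral_measure :: "(real set \<Rightarrow> 'h::complex_hilbert \<Rightarrow> 'h) \<Rightarrow> 'h \<Rightarrow> real measure" where
  "spectral_measure E u = measure_of UNIV (sets borel) (\<lambda>B. ennreal ((norm (E B u))\<^sup>2))"

text \<open>\<open>w = \<integral> g(\<rho>) dE\<^sub>\<rho>(u)\<close>, as a limit of integrals of simple functions converging to \<open>g\<close> in
  \<open>L\<^sup>2(\<parallel>dE\<^sub>\<rho>(u)\<parallel>\<^sup>2)\<close>. Such a \<open>w\<close> is unique, and it exists iff \<open>\<integral> |g|\<^sup>2 \<parallel>dE\<^sub>\<rho>(u)\<parallel>\<^sup>2 < \<infinity>\<close>.\<close>

definition has_spectral_integral ::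
  "(real set \<Rightarrow> 'h::complex_hilbert \<Rightarrow> 'h) \<Rightarrow> (real \<Rightarrow> complex) \<Rightarrow> 'h \<Rightarrow> 'h \<Rightarrow> bool" where
  "has_spectral_integral E g u w \<longleftrightarrow> g \<in> borel_measurable borel \<and>
     (\<exists>s::nat \<Rightarrow> real \<Rightarrow> complex. (\<forall>n. simple_function borel (s n))
        \<and> (\<lambda>n. \<integral>\<^sup>+ \<rho>. ennreal ((cmod (s n \<rho> - g \<rho>))\<^sup>2) \<partial>spectral_measure E u) \<longlonglongrightarrow> 0
        \<and> (\<lambda>n. \<Sum>y\<in>range (s n). y *\<^sub>C E (s n -` {y}) u) \<longlonglongrightarrow> w)"

text \<open>Domain and values of \<open>f(P) = \<integral> f(\<rho>\<^sup>2) dE\<^sub>\<rho>\<close>.\<close>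

definition fcalc_dom :: "(real set \<Rightarrow> 'h::complex_hilbert \<Rightarrow> 'h) \<Rightarrow> (real \<Rightarrow> complex) \<Rightarrow> 'h set" where
  "fcalc_dom E f = {u. \<exists>w. has_spectral_integral E (\<lambda>\<rho>. f (\<rho>\<^sup>2)) u w}"

definition fcalc :: "(real set \<Rightarrow> 'h::complex_hilbert \<Rightarrow> 'h) \<Rightarrow> (real \<Rightarrow> complex) \<Rightarrow> 'h \<Rightarrow> 'h" where
  "fcalc E f u = (THE w. has_spectral_integral E (\<lambda>\<rho>. f (\<rho>\<^sup>2)) u w)"

text \<open>\<open>Pu = \<integral>\<^sub>0\<^sup>\<infinity> \<rho>\<^sup>2 dE\<^sub>\<rho>(u)\<close>, including equality of the domains.\<close>

definition spectral_resolution ::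
  "'h::complex_hilbert set \<Rightarrow> ('h \<Rightarrow> 'h) \<Rightarrow> (real set \<Rightarrow> 'h \<Rightarrow> 'h) \<Rightarrow> bool" where
  "spectral_resolution D P E \<longleftrightarrow> projection_valued_measure E \<and> (\<forall>u. E {0..} u = u)
     \<and> D = fcalc_dom E complex_of_real \<and> (\<forall>u\<in>D. P u = fcalc E complex_of_real u)"


section \<open>The scale of spaces\<close>

definition Lam :: "(real set \<Rightarrow> 'h::complex_hilbert \<Rightarrow> 'h) \<Rightarrow> real \<Rightarrow> 'h \<Rightarrow> 'h" where
  "Lam E s = fcalc E (\<lambda>x. complex_of_real ((1 + x) powr s))"

text \<open>\<open>H\<^sub>s\<close> as a subspace of \<open>H\<close>; only meaningful for \<open>s \<ge> 0\<close>.\<close>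

definition Hs :: "(real set \<Rightarrow> 'h::complex_hilbert \<Rightarrow> 'h) \<Rightarrow> real \<Rightarrow> 'h set" where
  "Hs E s = range (Lam E (- s))"

definition Hs_norm :: "(real set \<Rightarrow> 'h::complex_hilbert \<Rightarrow> 'h) \<Rightarrow> real \<Rightarrow> 'h \<Rightarrow> real" where
  "Hs_norm E s u = norm (Lam E s u)"

text \<open>Elements of \<open>H\<^bsub>-1/2\<^esub>\<close> are antilinear functionals on \<open>H\<^bsub>1/2\<^esub>\<close>; functions representing them are
  only relevant on \<open>H\<^bsub>1/2\<^esub>\<close>. An element \<open>h\<close> of the pivot space \<open>H\<close> is identified with
  \<open>w \<mapsto> \<langle>h, w\<rangle>\<close>.\<close>

definition represented_by ::
  "(real set \<Rightarrow> 'h::complex_hilbert \<Rightarrow> 'h) \<Rightarrow> ('h \<Rightarrow> complex) \<Rightarrow> 'h \<Rightarrow> bool" where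
  "represented_by E l h \<longleftrightarrow> (\<forall>w\<in>Hs E (1/2). l w = cinner h w)"

text \<open>The bounded extension \<open>P : H\<^bsub>1/2\<^esub> \<rightarrow> H\<^bsub>-1/2\<^esub>\<close>: for \<open>u \<in> H\<^sub>1\<close> and \<open>w \<in> H\<^bsub>1/2\<^esub>\<close>,
  \<open>\<langle>Pu, w\<rangle> = \<langle>P\<^bsup>1/2\<^esup>u, P\<^bsup>1/2\<^esup>w\<rangle>\<close>, and the right-hand side is continuous in \<open>u \<in> H\<^bsub>1/2\<^esub>\<close>.\<close>

definition P_ext :: "(real set \<Rightarrow> 'h::complex_hilbert \<Rightarrow> 'h) \<Rightarrow> 'h \<Rightarrow> 'h \<Rightarrow> complex" where
  "P_ext E u = (\<lambda>w. cinner (fcalc E (\<lambda>x. complex_of_real (sqrt x)) u)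
                            (fcalc E (\<lambda>x. complex_of_real (sqrt x)) w))"

text \<open>\<open>Q\<^sup>* : Y \<rightarrow> H\<^bsub>-1/2\<^esub>\<close>.\<close>

definition adj_ext :: "('h::complex_hilbert \<Rightarrow> 'y::complex_hilbert) \<Rightarrow> 'y \<Rightarrow> 'h \<Rightarrow> complex" where
  "adj_ext Q y = (\<lambda>w. cinner y (Q w))"


section \<open>The damped wave generator\<close>

definition energy_space :: "(real set \<Rightarrow> 'h::complex_hilbert \<Rightarrow> 'h) \<Rightarrow> ('h \<times> 'h) set" where
  "energy_space E = Hs E (1/2) \<times> UNIV"

definition energy_norm :: "(real set \<Rightarrow> 'h::complex_hilbert \<Rightarrow> 'h) \<Rightarrow> 'h \<times> 'h \<Rightarrow> real" where
  "energy_norm E p = sqrt ((Hs_norm E (1/2) (fst p))\<^sup>2 + (norm (snd p))\<^sup>2)"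

definition damped_dom ::
  "(real set \<Rightarrow> 'h::complex_hilbert \<Rightarrow> 'h) \<Rightarrow> ('h \<Rightarrow> 'y::complex_hilbert) \<Rightarrow> ('h \<times> 'h) set" where
  "damped_dom E Q = {(u, v). u \<in> Hs E (1/2) \<and> v \<in> Hs E (1/2)
     \<and> (\<exists>h. represented_by E (\<lambda>w. P_ext E u w + adj_ext Q (Q v) w) h)}"

definition damped_gen ::
  "(real set \<Rightarrow> 'h::complex_hilbert \<Rightarrow> 'h) \<Rightarrow> ('h \<Rightarrow> 'y::complex_hilbert) \<Rightarrow> 'h \<times> 'h \<Rightarrow> 'h \<times> 'h" where
  "damped_gen E Q = (\<lambda>(u, v).
     (v, - (THE h. represented_by E (\<lambda>w. P_ext E u w + adj_ext Q (Q v) w) h)))"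


section \<open>Ellipticity\<close>

text \<open>As \<open>\<psi>\<close> may be unbounded, finiteness of \<open>\<parallel>\<psi>(\<tau>\<^sup>-\<^sup>2P)u\<parallel>\<close> is part of the inequality and is
  stated through the domain of \<open>\<psi>(\<tau>\<^sup>-\<^sup>2P)\<close>.\<close>

definition m_elliptic ::
  "(real set \<Rightarrow> 'h::complex_hilbert \<Rightarrow> 'h) \<Rightarrow> ('h \<Rightarrow> 'y::complex_hilbert) \<Rightarrow> (real \<Rightarrow> real) \<Rightarrow> bool" where
  "m_elliptic E Q m \<longleftrightarrow>
     (\<exists>(\<psi>::real \<Rightarrow> real) C \<tau>0 N (e::real \<Rightarrow> real).
        continuous_on {0..} \<psi> \<and> 0 < \<psi> 1 \<and> 0 < C \<and> 0 < \<tau>0 \<and> 0 < N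
        \<and> (\<forall>\<tau>\<ge>\<tau>0. 0 \<le> e \<tau>)
        \<and> e \<in> o[at_top](\<lambda>\<tau>. min (m \<tau> * \<tau> powr (4 * N)) \<tau>)
        \<and> (\<forall>u\<in>Hs E (1/2). \<forall>\<tau>\<ge>\<tau>0.
             u \<in> fcalc_dom E (\<lambda>x. complex_of_real (\<psi> (x / \<tau>\<^sup>2)))
             \<and> m \<tau> * (norm (fcalc E (\<lambda>x. complex_of_real (\<psi> (x / \<tau>\<^sup>2))) u))\<^sup>2
                 \<le> C * (norm (Q u))\<^sup>2 + e \<tau> * (norm (Lam E (- N) u))\<^sup>2))"

end

theory Submission
  imports Defs
begin

text \<open>Put \<open>S = (1 + P)\<^bsup>-1/2\<^esup>\<close>, a bijection from \<open>H\<close> onto \<open>H\<^bsub>1/2\<^esub>\<close>, and \<open>G = QS\<close>, which is bounded on \<open>H\<close>. For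
  \<open>u = Sx\<close>, \<open>v = Sy\<close>, solving \<open>(A + i\<tau>)(u, v) = (f, g)\<close> amounts to inverting the bounded operator
  \<open>B\<^sub>\<tau> = 1 - (1 + \<tau>\<^sup>2)S\<^sup>2 - i\<tau>G\<^sup>*G\<close> on \<open>H\<close>, whose adjoint is \<open>B\<^bsub>-\<tau>\<^esub>\<close>. An a priori estimate for both signs of
  \<open>\<tau>\<close> therefore gives bijectivity as well as the resolvent bound; no Fredholm theory is needed.

  The damping identity bounds \<open>\<parallel>Qv\<parallel>\<^sup>2\<close> by \<open>\<parallel>(f, g)\<parallel> \<parallel>(u, v)\<parallel>\<close>. Away from \<open>P \<approx> \<tau>\<^sup>2\<close> the equation
  \<open>(P - \<tau>\<^sup>2)v = Pf + i\<tau>Q\<^sup>*Qv + i\<tau>g\<close> is elliptic, and testing it with \<open>(P - \<tau>\<^sup>2)\<^sup>-\<^sup>1(1 + P)\<^bsup>-2s\<^esup>v\<close>, cut off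
  near \<open>\<tau>\<^sup>2\<close>, bounds \<open>\<Lambda>\<^bsup>-s\<^esup>v\<close> there with a gain of \<open>|\<tau>|\<^bsup>-min(1, 2s)\<^esup>\<close> in front of \<open>\<parallel>Qv\<parallel>\<close>. Near
  \<open>\<tau>\<^sup>2\<close>, \<open>m\<close>-ellipticity applies: the part of its error term near \<open>\<tau>\<^sup>2\<close> is absorbed because
  \<open>e = o(m \<tau>\<^bsup>4N\<^esup>)\<close>, the part away from \<open>\<tau>\<^sup>2\<close> is controlled by the gain for \<open>s = N\<close>.\<close>


section \<open>Complex Hilbert spaces\<close>

text \<open>The obstacle is that the damping is only form-bounded: in the equation for v it lies in
  \<open>H_{-1/2}\<close>, so testing it costs half a power of 1 + P, and the factor i\<tau> costs a
  power of |\<tau>|. Off \<tau>^2 the symbol |x - \<tau>^2| is comparable to x + \<tau>^2, so (1 +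
  x)^(1/2 - s) / |x - \<tau>^2| is at most of order |\<tau>|^(-1 - min(1, 2s)); after the loss of
  |\<tau>| this is the stated gain. Its square has to beat e. For 2N < 1 the squared gain is
  |\<tau>|^(-4N), and e = o(m \<tau>^(4N)) leaves at most m; otherwise it is \<tau>^(-2), and e =
  o(\<tau>) leaves at most 1. This is the origin of the minimum in the ellipticity condition. Both 1
  and m are at most m M for M = max(1/m, 1), so division by m charges every error to M. The estimate
  for v carries M in front of the squared data and of ||Qv||^2. As the damping identity bounds
  ||Qv||^2 by data times solution, solving the resulting quadratic inequality gives a bound linear
  in M.\<close>

lemma module_scaleC: "module (scaleC :: complex \<Rightarrow> 'a::complex_vector \<Rightarrow> 'a)"
proof
  \<comment> \<open>The unit law is not an axiom of \<open>complex_vector\<close>; it is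
    \<open>scaleR_scaleC\<close> at the real number 1.\<close>
  show "1 *\<^sub>C x = x" for x :: 'a
    using scaleR_scaleC[of 1 x] by simp
qed (simp_all add: scaleC_add_right scaleC_add_left scaleC_scaleC)

lemma scaleC_one [simp]: "1 *\<^sub>C (x::'a::complex_vector) = x"
  and scaleC_zero_left [simp]: "0 *\<^sub>C (x::'a::complex_vector) = 0"
  and scaleC_zero_right [simp]: "c *\<^sub>C (0::'a::complex_vector) = 0"
  and scaleC_minus_left [simp]: "(- c) *\<^sub>C (x::'a::complex_vector) = - (c *\<^sub>C x)"
  and scaleC_minus_right [simp]: "c *\<^sub>C (- (x::'a::complex_vector)) = - (c *\<^sub>C x)"
  and scaleC_diff_right: "c *\<^sub>C ((x::'a::complex_vector) - y) = c *\<^sub>C x - c *\<^sub>C y"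
  and scaleC_sum_right: "c *\<^sub>C (\<Sum>i\<in>I. f i) = (\<Sum>i\<in>I. c *\<^sub>C (f i :: 'a))"
  using module.scale_one[OF module_scaleC] module.scale_zero_left[OF module_scaleC]
    module.scale_zero_right[OF module_scaleC] module.scale_minus_left[OF module_scaleC]
    module.scale_minus_right[OF module_scaleC] module.scale_right_diff_distrib[OF module_scaleC]
    module.scale_sum_right[OF module_scaleC]
  by metis+

lemma csubspace_iff:
  "csubspace S \<longleftrightarrow> 0 \<in> S \<and> (\<forall>x\<in>S. \<forall>y\<in>S. x + y \<in> S) \<and> (\<forall>c. \<forall>x\<in>S. c *\<^sub>C x \<in> S)"
  unfolding csubspace_def module.subspace_def[OF module_scaleC] ..

lemma csubspace_UNIV [simp]: "csubspace UNIV"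
  by (simp add: csubspace_iff)

lemma clinear_on_UNIV_iff:
  "clinear_on UNIV T \<longleftrightarrow> (\<forall>x y. T (x + y) = T x + T y) \<and> (\<forall>c x. T (c *\<^sub>C x) = c *\<^sub>C T x)"
  by (simp add: clinear_on_def)

lemma clinear_on_UNIV_diff: "clinear_on UNIV T \<Longrightarrow> T (x - y) = T x - T y"
  unfolding clinear_on_UNIV_iff by (metis add_diff_cancel diff_add_cancel)

lemma clinear_on_UNIV_zero: "clinear_on UNIV T \<Longrightarrow> T 0 = 0"
  using clinear_on_UNIV_diff[of T 0 0] by simp

lemma clinear_on_UNIV_sum: "clinear_on UNIV T \<Longrightarrow> T (\<Sum>i\<in>I. f i) = (\<Sum>i\<in>I. T (f i))"
  by (induction I rule: infinite_finite_induct)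
    (simp_all add: clinear_on_UNIV_zero, simp add: clinear_on_UNIV_iff)

lemma cinner_zero_left [simp]: "cinner 0 x = 0"
  using cinner_add_left[of 0 0 x] by simp

lemma cinner_add_right: "cinner x (y + z) = cinner x y + cinner x z"
  by (metis cinner_add_left cinner_commute complex_cnj_add)

lemma cinner_zero_right [simp]: "cinner x 0 = 0"
  using cinner_add_right[of x 0 0] by simp

lemma cinner_minus_left [simp]: "cinner (- x) y = - cinner x y"
  using cinner_add_left[of x "- x" y] by (simp add: add_eq_0_iff)

lemma cinner_minus_right [simp]: "cinner x (- y) = - cinner x y"
  by (metis cinner_minus_left cinner_commute complex_cnj_minus)

lemma cinner_diff_left: "cinner (x - y) z = cinner x z - cinner y z"
  using cinner_add_left[of x "- y" z] by simp

lemma cinner_diff_right: "cinner x (y - z) = cinner x y - cinner x z"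
  using cinner_add_right[of x y "- z"] by simp

lemma cinner_scaleC_right: "cinner x (c *\<^sub>C y) = cnj c * cinner x y"
  by (metis cinner_scaleC_left cinner_commute complex_cnj_mult)

lemma cinner_scaleR_left: "cinner (r *\<^sub>R x) y = of_real r * cinner x y"
  by (simp add: scaleR_scaleC cinner_scaleC_left)

lemma cinner_scaleR_right: "cinner x (r *\<^sub>R y) = of_real r * cinner x y"
  by (simp add: scaleR_scaleC cinner_scaleC_right)

lemma cinner_self: "cinner x x = of_real ((norm x)\<^sup>2)"
proof -
  have "Im (cinner x x) = 0"
    by (metis cinner_commute cnj.simps(2) equal_neg_zero)
  \<comment> \<open>Real \<open>sqrt\<close> is odd, hence negative on negative arguments. Its value
    here is a norm, so the argument is nonnegative and squaring is legitimate.\<close>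
  moreover have "0 \<le> Re (cinner x x)"
    using norm_eq_sqrt_cinner[of x] norm_ge_zero[of x] real_sqrt_ge_0_iff by metis
  then have "(norm x)\<^sup>2 = Re (cinner x x)"
    by (simp add: norm_eq_sqrt_cinner)
  ultimately show ?thesis
    by (simp add: complex_eq_iff)
qed

lemma power2_norm_eq_cinner: "(norm x)\<^sup>2 = Re (cinner x x)"
  by (simp add: cinner_self)

lemma cinner_sum_left: "cinner (\<Sum>i\<in>I. f i) y = (\<Sum>i\<in>I. cinner (f i) y)"
  by (induction I rule: infinite_finite_induct) (simp_all add: cinner_add_left)

lemma cinner_sum_right: "cinner y (\<Sum>i\<in>I. f i) = (\<Sum>i\<in>I. cinner y (f i))"
  by (induction I rule: infinite_finite_induct) (simp_all add: cinner_add_right)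

lemma norm_scaleC: "norm (c *\<^sub>C (x::'a::complex_inner)) = cmod c * norm x"
proof -
  have "(norm (c *\<^sub>C x))\<^sup>2 = Re ((c * cnj c) * cinner x x)"
    by (simp only: power2_norm_eq_cinner cinner_scaleC_left cinner_scaleC_right mult_ac)
  also have "\<dots> = (cmod c * norm x)\<^sup>2"
    by (simp add: cinner_self complex_norm_square[symmetric] power_mult_distrib flip: of_real_power of_real_mult)
  finally show ?thesis
    by (simp add: power2_eq_iff_nonneg)
qed

lemma norm_add_cinner: "(norm (x + y))\<^sup>2 = (norm x)\<^sup>2 + 2 * Re (cinner x y) + (norm y)\<^sup>2"
proof -
  have "Re (cinner y x) = Re (cinner x y)"
    by (subst cinner_commute) simp
  then show ?thesis
    by (simp add: power2_norm_eq_cinner cinner_add_left cinner_add_right)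
qed

lemma Re_cinner_le_norm: "Re (cinner x y) \<le> norm x * norm y"
proof (cases "x = 0 \<or> y = 0")
  case False
  then have pos: "0 < norm x" "0 < norm y"
    by simp_all
  \<comment> \<open>For nonzero x and y this vector vanishes exactly in the case of equality; its
    squared norm is a positive multiple of the defect in the inequality.\<close>
  define z where "z = norm y *\<^sub>R x + - (norm x *\<^sub>R y)"
  have "(norm z)\<^sup>2 = 2 * (norm x * norm y) * (norm x * norm y - Re (cinner x y))"
    unfolding z_def norm_add_cinner
    by (simp add: cinner_scaleR_left cinner_scaleR_right power2_eq_square algebra_simps)
  then have "0 \<le> 2 * (norm x * norm y) * (norm x * norm y - Re (cinner x y))"
    by (metis zero_le_power2)
  then show ?thesis
    using pos mult_pos_pos[OF pos] by (simp only: zero_le_mult_iff) auto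
qed auto

lemma norm_cinner_le: "cmod (cinner x y) \<le> norm x * norm y"
proof (cases "cinner x y = 0")
  case False
  \<comment> \<open>A unimodular factor that makes the inner product real and nonnegative, so that
    the bound for real parts applies.\<close>
  define c where "c = cnj (cinner x y) / cmod (cinner x y)"
  have "cmod c = 1"
    using False by (simp add: c_def norm_divide)
  have "Re (cinner (c *\<^sub>C x) y) = cmod (cinner x y)"
    using False by (simp add: c_def cinner_scaleC_left complex_norm_square[symmetric]
        mult.commute power2_eq_square flip: of_real_mult)
  then show ?thesis
    using Re_cinner_le_norm[of "c *\<^sub>C x" y] \<open>cmod c = 1\<close> by (simp add: norm_scaleC)
qed simp

lemma eq_if_cinner_eq: "(\<And>z. cinner x z = cinner y z) \<Longrightarrow> x = y"
  using cinner_self[of "x - y"] by (simp add: cinner_diff_left)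

lemma eq_if_cinner_eq_right: "(\<And>z. cinner z x = cinner z y) \<Longrightarrow> x = y"
  using cinner_self[of "x - y"] by (simp add: cinner_diff_right)

lemma bounded_bilinear_cinner: "bounded_bilinear (cinner :: 'a::complex_inner \<Rightarrow> 'a \<Rightarrow> complex)"
proof
  show "\<exists>K. \<forall>a b::'a. cmod (cinner a b) \<le> norm a * norm b * K"
    by (intro exI[of _ 1]) (simp add: norm_cinner_le)
qed (simp_all add: cinner_add_left cinner_add_right cinner_scaleR_left cinner_scaleR_right
    scaleR_conv_of_real)

lemmas tendsto_cinner [tendsto_intros] = bounded_bilinear.tendsto[OF bounded_bilinear_cinner]

lemma tendsto_scaleC [tendsto_intros]:
  fixes f :: "'b \<Rightarrow> 'a::complex_inner"
  assumes "(f \<longlongrightarrow> l) F"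
  shows "((\<lambda>x. c *\<^sub>C f x) \<longlongrightarrow> c *\<^sub>C l) F"
proof -
  have "bounded_linear (\<lambda>x::'a. c *\<^sub>C x)"
    by (rule bounded_linear_intro[of _ "cmod c"])
      (simp_all add: scaleC_add_right scaleR_scaleC scaleC_scaleC mult.commute norm_scaleC)
  then show ?thesis
    using assms by (rule bounded_linear.tendsto)
qed

lemma clinear_bounded_tendsto:
  fixes T :: "'a::complex_inner \<Rightarrow> 'b::complex_inner"
  assumes "clinear_on UNIV T" and "\<And>x. norm (T x) \<le> K * norm x" and "(f \<longlongrightarrow> l) F"
  shows "((\<lambda>x. T (f x)) \<longlongrightarrow> T l) F"
proof -
  have "bounded_linear T"
    using assms(1,2)
    by (intro bounded_linear_intro[of _ K]) (simp_all add: clinear_on_UNIV_iff scaleR_scaleC mult.commute)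
  then show ?thesis
    using assms(3) by (rule bounded_linear.tendsto)
qed

section \<open>Variational problems: Lax-Milgram, adjoints, surjectivity\<close>

text \<open>First-order condition at a minimiser: the quadratic is the change of a functional along
  a line, and its linear coefficient must vanish.\<close>

lemma quadratic_nonneg_imp_zero:
  fixes a b :: real
  assumes "\<And>t. 0 \<le> 2 * t * a + t\<^sup>2 * b"
  shows "a = 0"
proof (rule ccontr)
  assume "a \<noteq> 0"
  \<comment> \<open>The critical point -a / b of the quadratic, with b replaced by 1 + |b| so that
    it exists for every b.\<close>
  define t where "t = - a / (1 + \<bar>b\<bar>)"
  have "t\<^sup>2 * b \<le> t\<^sup>2 * (1 + \<bar>b\<bar>)"
    by (intro mult_left_mono) auto
  also have "\<dots> = - t * a"
    by (simp add: t_def power2_eq_square)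
  finally have "0 \<le> t * a"
    using assms[of t] by linarith
  moreover have "t * a = - (a\<^sup>2 / (1 + \<bar>b\<bar>))"
    by (simp add: t_def power2_eq_square)
  moreover have "0 < a\<^sup>2 / (1 + \<bar>b\<bar>)"
    using \<open>a \<noteq> 0\<close> by (intro divide_pos_pos) auto
  ultimately show False
    by linarith
qed

text \<open>\<open>w\<close> minimises \<open>z \<mapsto> \<parallel>Tz\<parallel>\<^sup>2 - 2 Re l(z)\<close>; by the parallelogram law a minimising sequence
  is Cauchy.\<close>

lemma lax_milgram_square:
  fixes T :: "'a::complex_hilbert \<Rightarrow> 'b::complex_inner" and l :: "'a \<Rightarrow> complex"
  assumes T: "clinear_on UNIV T" and bdd: "\<And>z. norm (T z) \<le> K * norm z"
    and below: "\<And>z. c * norm z \<le> norm (T z)" and "0 < c"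
    and l_add: "\<And>x y. l (x + y) = l x + l y" and l_scale: "\<And>a x. l (a *\<^sub>C x) = a * l x"
    and l_bdd: "\<And>z. cmod (l z) \<le> L * norm z"
  obtains w where "\<And>z. cinner (T z) (T w) = l z"
proof -
  have T_add: "T (x + y) = T x + T y" and T_scale: "T (a *\<^sub>C x) = a *\<^sub>C T x" for x y a
    using T by (simp_all add: clinear_on_UNIV_iff)
  have T_scaleR: "T (r *\<^sub>R x) = r *\<^sub>R T x" for r x
    by (simp add: scaleR_scaleC T_scale)
  have l_scaleR: "l (r *\<^sub>R x) = r *\<^sub>R l x" for r x
    by (simp add: scaleR_scaleC l_scale scaleR_conv_of_real)
  define J where "J z = (norm (T z))\<^sup>2 - 2 * Re (l z)" for z
  define d where "d = (INF z. J z)"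
  \<comment> \<open>By coercivity J dominates a quadratic polynomial in \<open>c * norm z\<close>;
    completing the square gives its minimum.\<close>
  have J_lower: "- (L\<^sup>2 / c\<^sup>2) \<le> J z" for z
  proof -
    have "(c * norm z)\<^sup>2 \<le> (norm (T z))\<^sup>2"
      using below[of z] \<open>0 < c\<close> by (intro power_mono) auto
    moreover have "Re (l z) \<le> L * norm z"
      using complex_Re_le_cmod[of "l z"] l_bdd[of z] by linarith
    moreover have "(c * norm z)\<^sup>2 - 2 * (L * norm z) = (c * norm z - L / c)\<^sup>2 - L\<^sup>2 / c\<^sup>2"
      using \<open>0 < c\<close> by (simp add: power2_diff power_divide)
    ultimately show ?thesis
      unfolding J_def using zero_le_power2[of "c * norm z - L / c"] by linarith
  qed
  then have bdd_J: "bdd_below (range J)"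
    by (intro bdd_belowI[of _ "- (L\<^sup>2 / c\<^sup>2)"]) auto
  have d_le: "d \<le> J z" for z
    unfolding d_def using bdd_J by (rule cINF_lower) simp
  have "\<exists>z. J z < d + 1 / real (Suc n)" for n
  proof -
    have "d < d + 1 / real (Suc n)"
      by simp
    then show ?thesis
      unfolding d_def using cINF_less_iff[OF UNIV_not_empty bdd_J] by blast
  qed
  then obtain zs where zs: "\<And>n. J (zs n) < d + 1 / real (Suc n)"
    by metis
  have mid: "(norm (T (x - y)))\<^sup>2 = 2 * J x + 2 * J y - 4 * J ((1/2) *\<^sub>R (x + y))" for x y
  proof -
    have "(norm (T x - T y))\<^sup>2 = 2 * (norm (T x))\<^sup>2 + 2 * (norm (T y))\<^sup>2 - (norm (T x + T y))\<^sup>2"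
      using norm_add_cinner[of "T x" "T y"] norm_add_cinner[of "T x" "- T y"] by simp
    moreover have "(norm ((1/2) *\<^sub>R (T x + T y)))\<^sup>2 = (norm (T x + T y))\<^sup>2 / 4"
      by (simp only: norm_scaleR power_mult_distrib) (simp add: power_divide)
    ultimately show ?thesis
      unfolding J_def T_scaleR T_add l_scaleR l_add clinear_on_UNIV_diff[OF T]
      by (simp add: power_divide field_simps)
  qed
  have cauchy: "Cauchy zs"
  proof (rule metric_CauchyI)
    fix e :: real
    assume "0 < e"
    \<comment> \<open>If two values of J are within \<eta> of the infimum d, then \<open>mid\<close>
      bounds the squared norm of the difference of the images by 4\<eta>; hence the quarter.\<close>
    then have "0 < (c * e)\<^sup>2 / 4"
      using \<open>0 < c\<close> by simp
    then obtain n0 where "1 / real (Suc n0) < (c * e)\<^sup>2 / 4"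
      using nat_approx_posE by metis
    then have small: "1 / real (Suc n) < (c * e)\<^sup>2 / 4" if "n \<ge> n0" for n
      using that by (smt (verit) frac_le of_nat_0_less_iff of_nat_mono zero_less_Suc Suc_le_mono)
    have "dist (zs p) (zs q) < e" if "p \<ge> n0" "q \<ge> n0" for p q
    proof -
      have "(norm (T (zs p - zs q)))\<^sup>2 < (c * e)\<^sup>2"
        using mid[of "zs p" "zs q"] zs[of p] zs[of q] small[OF that(1)] small[OF that(2)]
          d_le[of "(1/2) *\<^sub>R (zs p + zs q)"] by linarith
      then have "norm (T (zs p - zs q)) < c * e"
        using \<open>0 < c\<close> \<open>0 < e\<close> by (auto intro: power_less_imp_less_base)
      with below[of "zs p - zs q"] have "c * norm (zs p - zs q) < c * e"
        by linarith
      then show ?thesis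
        using \<open>0 < c\<close> by (simp add: dist_norm)
    qed
    then show "\<exists>M. \<forall>m\<ge>M. \<forall>n\<ge>M. dist (zs m) (zs n) < e"
      by blast
  qed
  then obtain w where w: "zs \<longlonglongrightarrow> w"
    using Cauchy_convergent_iff convergent_def by blast
  have "bounded_linear l"
    using l_bdd by (intro bounded_linear_intro[of _ L]) (simp_all add: l_add l_scaleR mult.commute)
  then have "(\<lambda>n. J (zs n)) \<longlonglongrightarrow> J w"
    unfolding J_def using w clinear_bounded_tendsto[OF T bdd w]
    by (intro tendsto_intros bounded_linear.tendsto[of l])
  moreover have "(\<lambda>n. d + 1 / real (Suc n)) \<longlonglongrightarrow> d + 0"
    using LIMSEQ_inverse_real_of_nat by (intro tendsto_intros) (simp add: inverse_eq_divide)
  ultimately have "J w \<le> d"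
    using LIMSEQ_le zs less_imp_le by (metis (no_types, lifting) add.right_neutral)
  have re: "Re (cinner (T z) (T w)) = Re (l z)" for z
  proof -
    have "0 \<le> 2 * t * (Re (cinner (T z) (T w)) - Re (l z)) + t\<^sup>2 * (norm (T z))\<^sup>2" for t
    proof -
      have "J (t *\<^sub>R z + w) = J w + 2 * t * (Re (cinner (T z) (T w)) - Re (l z)) + t\<^sup>2 * (norm (T z))\<^sup>2"
        unfolding J_def T_add l_add norm_add_cinner T_scaleR l_scaleR
        by (simp add: cinner_scaleR_left power_mult_distrib algebra_simps)
      then show ?thesis
        using \<open>J w \<le> d\<close> d_le[of "t *\<^sub>R z + w"] by linarith
    qed
    then show ?thesis
      using quadratic_nonneg_imp_zero by fastforce
  qed
  have "cinner (T z) (T w) = l z" for z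
    \<comment> \<open>The real part of the identity at i z is minus its imaginary part at z.\<close>
    using re[of z] re[of "\<i> *\<^sub>C z"]
    by (simp add: T_scale l_scale cinner_scaleC_left complex_eq_iff)
  then show thesis
    by (rule that)
qed

text \<open>With T the identity, \<open>lax_milgram_square\<close> is the Riesz representation
  theorem; for each y it is applied to the linear functional x -> <G x, y>.\<close>

lemma riesz_adjoint:
  fixes G :: "'a::complex_hilbert \<Rightarrow> 'b::complex_inner"
  assumes "clinear_on UNIV G" and "\<And>x. norm (G x) \<le> K * norm x"
  obtains G' where "\<And>x y. cinner (G x) y = cinner x (G' y)"
proof -
  have "\<exists>w. \<forall>x. cinner (G x) y = cinner x w" for y
  proof -
    have "cmod (cinner (G x) y) \<le> (K * norm y) * norm x" for x
      using norm_cinner_le[of "G x" y] mult_right_mono[OF assms(2)[of x], of "norm y"]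
      by (simp add: mult.commute mult.left_commute)
    then obtain w where "\<And>x. cinner (id x) (id w) = cinner (G x) y"
      using lax_milgram_square[of "id :: 'a \<Rightarrow> 'a" 1 1 "\<lambda>x. cinner (G x) y" "K * norm y"] assms(1)
      by (auto simp: clinear_on_UNIV_iff cinner_add_left cinner_scaleC_left)
    then show ?thesis
      by (metis id_apply)
  qed
  then show thesis
    using that by metis
qed

text \<open>Surjectivity comes from the coercivity of \<open>B B\<^sup>*\<close>.\<close>

lemma surj_if_adjoint_bounded_below:
  fixes B B' :: "'a::complex_hilbert \<Rightarrow> 'a"
  assumes "clinear_on UNIV B'" and bdd: "\<And>x. norm (B' x) \<le> K * norm x"
    and adj: "\<And>x y. cinner (B' x) y = cinner x (B y)"
    and "0 < c" and below: "\<And>x. c * norm x \<le> norm (B' x)"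
  shows "surj B"
proof (rule surjI)
  fix f
  have "\<exists>w. \<forall>z. cinner (B' z) (B' w) = cinner z f"
  proof -
    have "cmod (cinner z f) \<le> norm f * norm z" for z
      using norm_cinner_le[of z f] by (simp add: mult.commute)
    then show ?thesis
      using lax_milgram_square[OF assms(1) bdd below \<open>0 < c\<close>, of "\<lambda>z. cinner z f" "norm f"]
      by (metis cinner_add_left cinner_scaleC_left)
  qed
  \<comment> \<open>Moving \<open>B'\<close> off z shows that \<open>B' w\<close> is a preimage of
    f.\<close>
  then have "\<exists>w. \<forall>z. cinner z (B (B' w)) = cinner z f"
    by (simp add: adj)
  then have "\<exists>w. B (B' w) = f"
    using eq_if_cinner_eq_right by blast
  then show "B (B' (SOME w. B (B' w) = f)) = f"
    by (rule someI_ex)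
qed


section \<open>Spectral integrals\<close>

locale pvm =
  fixes E :: "real set \<Rightarrow> 'h::complex_hilbert \<Rightarrow> 'h"
  assumes pvm: "projection_valued_measure E"
begin

lemma E_linear: "B \<in> sets borel \<Longrightarrow> clinear_on UNIV (E B)"
  and E_idem: "B \<in> sets borel \<Longrightarrow> E B (E B u) = E B u"
  and E_sym: "B \<in> sets borel \<Longrightarrow> cinner (E B u) v = cinner u (E B v)"
  and E_UNIV: "E UNIV u = u"
  and E_Int: "A \<in> sets borel \<Longrightarrow> B \<in> sets borel \<Longrightarrow> E (A \<inter> B) u = E A (E B u)"
  and E_sums: "range F \<subseteq> sets borel \<Longrightarrow> disjoint_family F \<Longrightarrow>
    (\<lambda>i::nat. E (F i) u) sums E (\<Union>i. F i) u"
  using pvm unfolding projection_valued_measure_def by blast+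

text \<open>Countable additivity for the constant empty family makes a constant series converge, so
  its terms are 0.\<close>

lemma E_empty [simp]: "E {} u = 0"
proof -
  have "(\<lambda>i::nat. E {} u) sums E (\<Union>i::nat. {}) u"
    by (rule E_sums) (auto simp: disjoint_family_on_def)
  then have "(\<lambda>i::nat. E {} u) \<longlonglongrightarrow> 0"
    using sums_summable summable_LIMSEQ_zero by blast
  then show ?thesis
    by (simp add: LIMSEQ_const_iff)
qed

lemma E_Un:
  assumes "A \<in> sets borel" "B \<in> sets borel" "A \<inter> B = {}"
  shows "E (A \<union> B) u = E A u + E B u"
proof -
  have "(\<lambda>i. E (binaryset A B i) u) sums E (\<Union>i. binaryset A B i) u"
    using assms by (intro E_sums) (auto simp: disjoint_family_on_def binaryset_def)
  moreover have "(\<lambda>i. E (binaryset A B i) u) sums (E A u + E B u)"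
    by (rule binaryset_sums) simp
  ultimately show ?thesis
    by (simp add: UN_binaryset_eq sums_unique2)
qed

lemma E_UN:
  assumes "finite C" "\<And>c. c \<in> C \<Longrightarrow> A c \<in> sets borel" "disjoint_family_on A C"
  shows "E (\<Union>c\<in>C. A c) u = (\<Sum>c\<in>C. E (A c) u)"
  using assms
proof (induction C)
  case (insert c C)
  then have "A c \<inter> (\<Union>c\<in>C. A c) = {}"
    by (fastforce simp: disjoint_family_on_def)
  moreover have "(\<Union>c\<in>C. A c) \<in> sets borel"
    using insert by (intro sets.finite_UN) auto
  ultimately show ?case
    using insert by (simp add: E_Un disjoint_family_on_def)
qed simp

text \<open>Makes the squared norm linear in \<open>E B u\<close>, so that the strongly convergent
  sums of E become sums of numbers; this is why the spectral measure is countably additive.\<close>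

lemma norm_E: "B \<in> sets borel \<Longrightarrow> (norm (E B u))\<^sup>2 = Re (cinner (E B u) u)"
  by (metis E_idem E_sym power2_norm_eq_cinner)

lemma sets_spectral_measure [measurable_cong, simp]: "sets (spectral_measure E u) = sets borel"
  unfolding spectral_measure_def using sets.sigma_sets_eq[of "borel :: real measure"] by simp

lemma space_spectral_measure [simp]: "space (spectral_measure E u) = UNIV"
  unfolding spectral_measure_def by (simp add: space_measure_of_conv)

lemma emeasure_spectral_measure:
  assumes "B \<in> sets borel"
  shows "emeasure (spectral_measure E u) B = ennreal ((norm (E B u))\<^sup>2)"
  unfolding spectral_measure_def
proof (rule emeasure_measure_of_sigma)
  show "sigma_algebra UNIV (sets (borel :: real measure))"
    using sets.sigma_algebra_axioms[of "borel :: real measure"] by simp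
  show "positive (sets borel) (\<lambda>B. ennreal ((norm (E B u))\<^sup>2))"
    by (simp add: positive_def)
  show "countably_additive (sets borel) (\<lambda>B. ennreal ((norm (E B u))\<^sup>2))"
    unfolding countably_additive_def
  proof safe
    fix F :: "nat \<Rightarrow> real set"
    assume F: "range F \<subseteq> sets borel" "disjoint_family F"
    have "bounded_linear (\<lambda>x. Re (cinner x u))"
      using bounded_linear_compose[OF bounded_linear_Re
          bounded_bilinear.bounded_linear_left[OF bounded_bilinear_cinner]] .
    from bounded_linear.sums[OF this E_sums[OF F]]
    have "(\<lambda>i. (norm (E (F i) u))\<^sup>2) sums (norm (E (\<Union>i. F i) u))\<^sup>2"
      using F by (simp add: norm_E sets.countable_UN image_subset_iff)
    then show "(\<Sum>i. ennreal ((norm (E (F i) u))\<^sup>2)) = ennreal ((norm (E (\<Union> (range F)) u))\<^sup>2)"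
      by (intro suminf_ennreal_eq) auto
  qed
qed (use assms in auto)

section \<open>Integrals of simple functions\<close>

definition simple_int :: "(real \<Rightarrow> complex) \<Rightarrow> 'h \<Rightarrow> 'h" where
  "simple_int s u = (\<Sum>y\<in>range s. y *\<^sub>C E (s -` {y}) u)"

text \<open>The squared L2 seminorm for the spectral measure of u. It takes values in
  \<open>ennreal\<close>, so that infinity can express that u lies outside the domain of the
  integral of g.\<close>

definition nn2 :: "(real \<Rightarrow> complex) \<Rightarrow> 'h \<Rightarrow> ennreal" where
  "nn2 g u = (\<integral>\<^sup>+ \<rho>. ennreal ((cmod (g \<rho>))\<^sup>2) \<partial>spectral_measure E u)"

lemma has_spectral_integral_iff:
  "has_spectral_integral E g u w \<longleftrightarrow> g \<in> borel_measurable borel \<and>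
    (\<exists>s. (\<forall>n. simple_function borel (s n)) \<and> (\<lambda>n. nn2 (\<lambda>\<rho>. s n \<rho> - g \<rho>) u) \<longlonglongrightarrow> 0
      \<and> (\<lambda>n. simple_int (s n) u) \<longlonglongrightarrow> w)"
  unfolding has_spectral_integral_def simple_int_def nn2_def ..

lemma simple_function_vimage:
  "simple_function (borel :: real measure) p \<Longrightarrow> p -` A \<in> sets borel"
  using simple_functionD(2)[of borel p A] by simp

lemma simple_function_range: "simple_function (borel :: real measure) p \<Longrightarrow> finite (range p)"
  using simple_functionD(1)[of borel p] by simp

text \<open>The level sets of p refine those of f o p, so the integral may be computed on the finer
  partition. With the pair p = (s, t) this puts two simple functions on a common partition.\<close>

lemma simple_int_compose:
  assumes p: "simple_function borel p"
  shows "simple_int (\<lambda>\<rho>. f (p \<rho>)) u = (\<Sum>c\<in>range p. f c *\<^sub>C E (p -` {c}) u)"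
proof -
  have "E ((\<lambda>\<rho>. f (p \<rho>)) -` {y}) u = (\<Sum>c\<in>{c \<in> range p. f c = y}. E (p -` {c}) u)" for y
  proof -
    have "(\<lambda>\<rho>. f (p \<rho>)) -` {y} = (\<Union>c\<in>{c \<in> range p. f c = y}. p -` {c})"
      by auto
    then show ?thesis
      using p by (simp only:, intro E_UN)
        (auto simp: simple_function_vimage simple_function_range disjoint_family_on_def)
  qed
  then have "simple_int (\<lambda>\<rho>. f (p \<rho>)) u
      = (\<Sum>y\<in>f ` range p. \<Sum>c\<in>{c \<in> range p. f c = y}. f c *\<^sub>C E (p -` {c}) u)"
    by (simp add: simple_int_def scaleC_sum_right image_image)
  also have "\<dots> = (\<Sum>c\<in>range p. f c *\<^sub>C E (p -` {c}) u)"
    by (rule sum.image_gen[symmetric]) (simp add: simple_function_range[OF p])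
  finally show ?thesis .
qed

lemma simple_int_add:
  assumes "simple_function borel s" "simple_function borel t"
  shows "simple_int (\<lambda>\<rho>. s \<rho> + t \<rho>) u = simple_int s u + simple_int t u"
proof -
  have p: "simple_function borel (\<lambda>\<rho>. (s \<rho>, t \<rho>))"
    using assms by simp
  show ?thesis
    using simple_int_compose[OF p, of "\<lambda>c. fst c + snd c" u] simple_int_compose[OF p, of fst u]
      simple_int_compose[OF p, of snd u]
    by (simp add: scaleC_add_left sum.distrib)
qed

lemma simple_int_uminus:
  assumes "simple_function borel s"
  shows "simple_int (\<lambda>\<rho>. - s \<rho>) u = - simple_int s u"
  using simple_int_compose[OF assms, of uminus u] by (simp add: sum_negf simple_int_def)

lemma simple_int_diff:
  assumes "simple_function borel s" "simple_function borel t"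
  shows "simple_int (\<lambda>\<rho>. s \<rho> - t \<rho>) u = simple_int s u - simple_int t u"
proof -
  have "simple_function borel (\<lambda>\<rho>. - t \<rho>)"
    using simple_function_compose1[OF assms(2), of uminus] .
  then show ?thesis
    using simple_int_add[OF assms(1), of "\<lambda>\<rho>. - t \<rho>"] by (simp add: simple_int_uminus[OF assms(2)])
qed

lemma simple_int_linear: "simple_function borel s \<Longrightarrow> clinear_on UNIV (simple_int s)"
  using E_linear[OF simple_function_vimage, of s]
  by (simp add: clinear_on_UNIV_iff simple_int_def scaleC_add_right sum.distrib scaleC_sum_right
      scaleC_scaleC mult.commute)

text \<open>By \<open>E_Int\<close> the composition is a sum over pairs of level sets; a pair of
  values that is never attained contributes \<open>E {}\<close>, which is 0.\<close>

lemma simple_int_mult: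
  assumes s: "simple_function borel s" and t: "simple_function borel t"
  shows "simple_int t (simple_int s u) = simple_int (\<lambda>\<rho>. t \<rho> * s \<rho>) u"
proof -
  let ?p = "\<lambda>\<rho>. (t \<rho>, s \<rho>)"
  have p: "simple_function borel ?p"
    using assms by simp
  have lin: "clinear_on UNIV (E (t -` {y}))" for y
    using E_linear simple_function_vimage[OF t] by blast
  have "simple_int t (simple_int s u)
      = (\<Sum>y\<in>range t. \<Sum>z\<in>range s. (y * z) *\<^sub>C E (t -` {y} \<inter> s -` {z}) u)"
    using lin by (simp add: simple_int_def scaleC_sum_right E_Int simple_function_vimage[OF t]
        simple_function_vimage[OF s] clinear_on_UNIV_sum[OF lin] flip: scaleC_scaleC)
      (simp add: clinear_on_UNIV_iff)
  also have "\<dots> = (\<Sum>c\<in>range t \<times> range s. (fst c * snd c) *\<^sub>C E (?p -` {c}) u)"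
  proof -
    have "?p -` {c} = t -` {fst c} \<inter> s -` {snd c}" for c
      by (cases c) auto
    then show ?thesis
      by (simp add: sum.cartesian_product split_def)
  qed
  also have "\<dots> = (\<Sum>c\<in>range ?p. (fst c * snd c) *\<^sub>C E (?p -` {c}) u)"
  proof (rule sum.mono_neutral_right)
    show "\<forall>c\<in>range t \<times> range s - range ?p. (fst c * snd c) *\<^sub>C E (?p -` {c}) u = 0"
    proof
      fix c
      assume "c \<in> range t \<times> range s - range ?p"
      then have "?p -` {c} = {}"
        by blast
      then show "(fst c * snd c) *\<^sub>C E (?p -` {c}) u = 0"
        by (metis E_empty scaleC_zero_right)
    qed
  qed (use assms simple_function_range in auto)
  also have "\<dots> = simple_int (\<lambda>\<rho>. t \<rho> * s \<rho>) u"
    using simple_int_compose[OF p, of "\<lambda>c. fst c * snd c" u] by simp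
  finally show ?thesis .
qed

lemma simple_int_adjoint:
  assumes s: "simple_function borel s"
  shows "cinner (simple_int s u) v = cinner u (simple_int (\<lambda>\<rho>. cnj (s \<rho>)) v)"
  using s by (simp add: simple_int_compose simple_int_def[of s] cinner_sum_left cinner_sum_right
      cinner_scaleC_left cinner_scaleC_right E_sym simple_function_vimage)

text \<open>The isometry behind all later limits: moving the integral of s to the other side of the
  inner product conjugates it, and multiplicativity leaves the integral of |s|^2.\<close>

lemma nn2_simple:
  assumes s: "simple_function borel s"
  shows "nn2 s u = ennreal ((norm (simple_int s u))\<^sup>2)"
proof -
  note vm = simple_function_vimage[OF s] and fin = simple_function_range[OF s]
  have "nn2 s u = (\<integral>\<^sup>+ \<rho>. (\<Sum>y\<in>range s. ennreal ((cmod y)\<^sup>2) * indicator (s -` {y}) \<rho>) \<partial>spectral_measure E u)"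
    unfolding nn2_def
  proof (rule nn_integral_cong)
    fix \<rho>
    have "(\<Sum>y\<in>range s. ennreal ((cmod y)\<^sup>2) * indicator (s -` {y}) \<rho>)
        = (\<Sum>y\<in>range s. if s \<rho> = y then ennreal ((cmod y)\<^sup>2) else 0)"
      by (intro sum.cong) (auto simp: indicator_def)
    then show "ennreal ((cmod (s \<rho>))\<^sup>2) = (\<Sum>y\<in>range s. ennreal ((cmod y)\<^sup>2) * indicator (s -` {y}) \<rho>)"
      using fin by simp
  qed
  also have "\<dots> = (\<Sum>y\<in>range s. ennreal ((cmod y)\<^sup>2) * ennreal ((norm (E (s -` {y}) u))\<^sup>2))"
    using vm by (subst nn_integral_sum)
      (auto simp: nn_integral_cmult_indicator emeasure_spectral_measure)
  also have "\<dots> = ennreal (\<Sum>y\<in>range s. (cmod y)\<^sup>2 * (norm (E (s -` {y}) u))\<^sup>2)"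
    by (simp add: sum_ennreal flip: ennreal_mult')
  also have "(\<Sum>y\<in>range s. (cmod y)\<^sup>2 * (norm (E (s -` {y}) u))\<^sup>2) = (norm (simple_int s u))\<^sup>2"
  proof -
    have "(norm (simple_int s u))\<^sup>2 = Re (cinner u (simple_int (\<lambda>\<rho>. cnj (s \<rho>)) (simple_int s u)))"
      unfolding power2_norm_eq_cinner by (subst simple_int_adjoint[OF s]) simp
    also have "simple_int (\<lambda>\<rho>. cnj (s \<rho>)) (simple_int s u) = simple_int (\<lambda>\<rho>. cnj (s \<rho>) * s \<rho>) u"
      using simple_int_mult[OF s] simple_function_compose1[OF s, of cnj] by simp
    also have "\<dots> = (\<Sum>y\<in>range s. of_real ((cmod y)\<^sup>2) *\<^sub>C E (s -` {y}) u)"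
      using simple_int_compose[OF s, of "\<lambda>y. cnj y * y"]
      by (simp only: complex_norm_square mult.commute[of "cnj _"])
    also have "Re (cinner u \<dots>) = (\<Sum>y\<in>range s. (cmod y)\<^sup>2 * (norm (E (s -` {y}) u))\<^sup>2)"
      using vm by (simp add: cinner_sum_right cinner_scaleC_right norm_E E_sym flip: of_real_power)
    finally show ?thesis ..
  qed
  finally show ?thesis .
qed

section \<open>From simple functions to general integrands\<close>

lemma nn2_minus_commute: "nn2 (\<lambda>\<rho>. f \<rho> - g \<rho>) u = nn2 (\<lambda>\<rho>. g \<rho> - f \<rho>) u"
  by (simp add: nn2_def norm_minus_commute)

lemma nn2_mono: "(\<And>\<rho>. cmod (f \<rho>) \<le> cmod (g \<rho>)) \<Longrightarrow> nn2 f u \<le> nn2 g u"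
  unfolding nn2_def by (intro nn_integral_mono ennreal_leI power_mono) auto

lemma nn2_cmult:
  assumes "g \<in> borel_measurable borel"
  shows "nn2 (\<lambda>\<rho>. c * g \<rho>) u = ennreal ((cmod c)\<^sup>2) * nn2 g u"
  unfolding nn2_def using assms
  by (subst nn_integral_cmult[symmetric]) (simp_all add: norm_mult power_mult_distrib ennreal_mult)

lemma nn2_const: "nn2 (\<lambda>\<rho>. c) u = ennreal ((cmod c)\<^sup>2 * (norm u)\<^sup>2)"
  unfolding nn2_def
  by (simp add: emeasure_spectral_measure[of UNIV, simplified] E_UNIV ennreal_mult)

lemma nn2_bounded:
  assumes "\<And>\<rho>. cmod (g \<rho>) \<le> K"
  shows "nn2 g u < \<infinity>"
proof -
  have "nn2 g u \<le> nn2 (\<lambda>\<rho>. of_real K) u"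
    using assms abs_ge_self order_trans by (intro nn2_mono) (fastforce simp: norm_of_real)
  also have "\<dots> < \<infinity>"
    unfolding nn2_const by simp
  finally show ?thesis .
qed

text \<open>A substitute for the triangle inequality that avoids square roots in
  \<open>ennreal\<close>; the factor 2 is harmless for null sequences.\<close>

lemma nn2_add_le:
  assumes [measurable]: "f \<in> borel_measurable borel" "g \<in> borel_measurable borel"
  shows "nn2 (\<lambda>\<rho>. f \<rho> + g \<rho>) u \<le> 2 * nn2 f u + 2 * nn2 g u"
proof -
  have "(cmod (a + b))\<^sup>2 \<le> 2 * (cmod a)\<^sup>2 + 2 * (cmod b)\<^sup>2" for a b
  proof -
    have "(cmod (a + b))\<^sup>2 \<le> (cmod a + cmod b)\<^sup>2"
      by (intro power_mono norm_triangle_ineq) simp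
    also have "\<dots> \<le> 2 * (cmod a)\<^sup>2 + 2 * (cmod b)\<^sup>2"
      using sum_squares_bound[of "cmod a" "cmod b"] by (simp add: power2_sum)
    finally show ?thesis .
  qed
  then have "nn2 (\<lambda>\<rho>. f \<rho> + g \<rho>) u
      \<le> (\<integral>\<^sup>+ \<rho>. 2 * ennreal ((cmod (f \<rho>))\<^sup>2) + 2 * ennreal ((cmod (g \<rho>))\<^sup>2) \<partial>spectral_measure E u)"
    unfolding nn2_def
    by (intro nn_integral_mono) (simp add: ennreal_leI flip: ennreal_plus ennreal_mult' ennreal_numeral)
  also have "\<dots> = 2 * nn2 f u + 2 * nn2 g u"
    unfolding nn2_def by (simp add: nn_integral_add nn_integral_cmult)
  finally show ?thesis .
qed

lemma nn2_diff_le: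
  assumes [measurable]: "f \<in> borel_measurable borel" "g \<in> borel_measurable borel" "h \<in> borel_measurable borel"
  shows "nn2 (\<lambda>\<rho>. f \<rho> - h \<rho>) u \<le> 2 * nn2 (\<lambda>\<rho>. f \<rho> - g \<rho>) u + 2 * nn2 (\<lambda>\<rho>. h \<rho> - g \<rho>) u"
  using nn2_add_le[of "\<lambda>\<rho>. f \<rho> - g \<rho>" "\<lambda>\<rho>. g \<rho> - h \<rho>" u] nn2_minus_commute[of g h u] by simp

lemma nn2_squeeze:
  assumes "\<And>n. a n \<le> 2 * b n + 2 * c n" "b \<longlonglongrightarrow> (0::ennreal)" "c \<longlonglongrightarrow> 0"
  shows "a \<longlonglongrightarrow> 0"
proof (rule tendsto_sandwich[of "\<lambda>_. 0" a _ "\<lambda>n. 2 * b n + 2 * c n"])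
  have "(\<lambda>n. 2 * b n + 2 * c n) \<longlonglongrightarrow> 2 * 0 + 2 * 0"
    using assms(2,3) by (intro tendsto_add ennreal_tendsto_cmult) auto
  then show "(\<lambda>n. 2 * b n + 2 * c n) \<longlonglongrightarrow> 0"
    by simp
qed (use assms(1) in auto)

lemma has_spectral_integral_measurable:
  "has_spectral_integral E g u w \<Longrightarrow> g \<in> borel_measurable borel"
  by (simp add: has_spectral_integral_iff)

lemma has_spectral_integral_add:
  assumes "has_spectral_integral E g u w" "has_spectral_integral E h u z"
  shows "has_spectral_integral E (\<lambda>\<rho>. g \<rho> + h \<rho>) u (w + z)"
proof -
  from assms obtain s t where
    g [measurable]: "g \<in> borel_measurable borel" and h [measurable]: "h \<in> borel_measurable borel"
    and s: "\<And>n. simple_function borel (s n)" "(\<lambda>n. nn2 (\<lambda>\<rho>. s n \<rho> - g \<rho>) u) \<longlonglongrightarrow> 0"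
      "(\<lambda>n. simple_int (s n) u) \<longlonglongrightarrow> w"
    and t: "\<And>n. simple_function borel (t n)" "(\<lambda>n. nn2 (\<lambda>\<rho>. t n \<rho> - h \<rho>) u) \<longlonglongrightarrow> 0"
      "(\<lambda>n. simple_int (t n) u) \<longlonglongrightarrow> z"
    unfolding has_spectral_integral_iff by blast
  note [measurable] = borel_measurable_simple_function[OF s(1)] borel_measurable_simple_function[OF t(1)]
  have "(\<lambda>n. nn2 (\<lambda>\<rho>. (s n \<rho> + t n \<rho>) - (g \<rho> + h \<rho>)) u) \<longlonglongrightarrow> 0"
  proof (rule nn2_squeeze[OF _ s(2) t(2)])
    show "nn2 (\<lambda>\<rho>. (s n \<rho> + t n \<rho>) - (g \<rho> + h \<rho>)) u
        \<le> 2 * nn2 (\<lambda>\<rho>. s n \<rho> - g \<rho>) u + 2 * nn2 (\<lambda>\<rho>. t n \<rho> - h \<rho>) u" for n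
      using nn2_add_le[of "\<lambda>\<rho>. s n \<rho> - g \<rho>" "\<lambda>\<rho>. t n \<rho> - h \<rho>" u]
      by (simp add: algebra_simps)
  qed
  moreover have "(\<lambda>n. simple_int (\<lambda>\<rho>. s n \<rho> + t n \<rho>) u) \<longlonglongrightarrow> w + z"
    using tendsto_add[OF s(3) t(3)] by (simp add: simple_int_add s t)
  ultimately show ?thesis
    unfolding has_spectral_integral_iff using s(1) t(1)
    by (intro conjI exI[of _ "\<lambda>n \<rho>. s n \<rho> + t n \<rho>"]) auto
qed

lemma simple_int_bounded:
  assumes t: "simple_function borel t"
  obtains K where "\<And>\<rho>. cmod (t \<rho>) \<le> K" "\<And>u. norm (simple_int t u) \<le> K * norm u"
proof -
  define K where "K = Max (cmod ` range t)"
  have K: "cmod (t \<rho>) \<le> K" for \<rho>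
    unfolding K_def using simple_function_range[OF t] by (intro Max_ge) auto
  then have "0 \<le> K"
    using norm_ge_zero order_trans by blast
  have "norm (simple_int t u) \<le> K * norm u" for u
  proof -
    have "nn2 t u \<le> nn2 (\<lambda>\<rho>. of_real K) u"
      using K \<open>0 \<le> K\<close> by (intro nn2_mono) simp
    then have "(norm (simple_int t u))\<^sup>2 \<le> (K * norm u)\<^sup>2"
      by (simp add: nn2_simple[OF t] nn2_const power_mult_distrib)
    then show ?thesis
      using \<open>0 \<le> K\<close> by (simp add: power2_le_iff_abs_le)
  qed
  with K show thesis
    by (rule that)
qed

text \<open>The product rule for a simple outer factor t. It needs only that t is bounded, and it
  already yields scalar multiples (t constant) and spectral projections (t an indicator).\<close>

lemma has_spectral_integral_simple_mult:
  assumes t: "simple_function borel t" and g: "has_spectral_integral E g u w"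
  shows "has_spectral_integral E (\<lambda>\<rho>. t \<rho> * g \<rho>) u (simple_int t w)"
proof -
  from g obtain s where
    g [measurable]: "g \<in> borel_measurable borel"
    and s: "\<And>n. simple_function borel (s n)" "(\<lambda>n. nn2 (\<lambda>\<rho>. s n \<rho> - g \<rho>) u) \<longlonglongrightarrow> 0"
      "(\<lambda>n. simple_int (s n) u) \<longlonglongrightarrow> w"
    unfolding has_spectral_integral_iff by blast
  note [measurable] = borel_measurable_simple_function[OF s(1)] borel_measurable_simple_function[OF t(1)]
  obtain K where K: "\<And>\<rho>. cmod (t \<rho>) \<le> K" "\<And>u. norm (simple_int t u) \<le> K * norm u"
    using simple_int_bounded[OF t] by blast
  have "(\<lambda>n. nn2 (\<lambda>\<rho>. t \<rho> * s n \<rho> - t \<rho> * g \<rho>) u) \<longlonglongrightarrow> 0"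
  proof (rule tendsto_sandwich[of "\<lambda>_. 0" _ _ "\<lambda>n. ennreal (K\<^sup>2) * nn2 (\<lambda>\<rho>. s n \<rho> - g \<rho>) u"])
    have "nn2 (\<lambda>\<rho>. t \<rho> * s n \<rho> - t \<rho> * g \<rho>) u \<le> nn2 (\<lambda>\<rho>. of_real K * (s n \<rho> - g \<rho>)) u" for n
    proof (rule nn2_mono)
      fix \<rho>
      have "cmod (t \<rho> * (s n \<rho> - g \<rho>)) \<le> K * cmod (s n \<rho> - g \<rho>)"
        unfolding norm_mult by (intro mult_right_mono K) simp
      also have "\<dots> \<le> \<bar>K\<bar> * cmod (s n \<rho> - g \<rho>)"
        by (intro mult_right_mono) auto
      finally show "cmod (t \<rho> * s n \<rho> - t \<rho> * g \<rho>) \<le> cmod (of_real K * (s n \<rho> - g \<rho>))"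
        by (simp add: norm_mult flip: right_diff_distrib)
    qed
    also have "nn2 (\<lambda>\<rho>. of_real K * (s n \<rho> - g \<rho>)) u = ennreal (K\<^sup>2) * nn2 (\<lambda>\<rho>. s n \<rho> - g \<rho>) u" for n
      by (subst nn2_cmult) auto
    finally show "\<forall>\<^sub>F n in sequentially. nn2 (\<lambda>\<rho>. t \<rho> * s n \<rho> - t \<rho> * g \<rho>) u
        \<le> ennreal (K\<^sup>2) * nn2 (\<lambda>\<rho>. s n \<rho> - g \<rho>) u"
      by simp
    show "(\<lambda>n. ennreal (K\<^sup>2) * nn2 (\<lambda>\<rho>. s n \<rho> - g \<rho>) u) \<longlonglongrightarrow> 0"
      using ennreal_tendsto_cmult[OF _ s(2), of "ennreal (K\<^sup>2)"] by simp
  qed auto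
  moreover have "(\<lambda>n. simple_int (\<lambda>\<rho>. t \<rho> * s n \<rho>) u) \<longlonglongrightarrow> simple_int t w"
    using clinear_bounded_tendsto[OF simple_int_linear[OF t] K(2) s(3)] by (simp add: simple_int_mult s t)
  ultimately show ?thesis
    unfolding has_spectral_integral_iff using s(1) t(1)
    by (intro conjI exI[of _ "\<lambda>n \<rho>. t \<rho> * s n \<rho>"]) auto
qed

lemma has_spectral_integral_uminus:
  assumes "has_spectral_integral E g u w"
  shows "has_spectral_integral E (\<lambda>\<rho>. - g \<rho>) u (- w)"
  using has_spectral_integral_simple_mult[OF _ assms, of "\<lambda>_. - 1"]
  by (simp add: simple_int_def E_UNIV)

lemma has_spectral_integral_diff:
  assumes "has_spectral_integral E g u w" "has_spectral_integral E h u z"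
  shows "has_spectral_integral E (\<lambda>\<rho>. g \<rho> - h \<rho>) u (w - z)"
  using has_spectral_integral_add[OF assms(1) has_spectral_integral_uminus[OF assms(2)]] by simp

text \<open>The difference of two values is an integral of 0, and the isometry sends the simple
  integrals of any approximation of 0 to 0.\<close>

lemma has_spectral_integral_unique:
  assumes "has_spectral_integral E g u w" "has_spectral_integral E g u z"
  shows "w = z"
proof -
  have "has_spectral_integral E (\<lambda>\<rho>. 0) u (w - z)"
    using has_spectral_integral_diff[OF assms] by simp
  then obtain s where s: "\<And>n. simple_function borel (s n)" "(\<lambda>n. nn2 (s n) u) \<longlonglongrightarrow> 0"
      "(\<lambda>n. simple_int (s n) u) \<longlonglongrightarrow> w - z"
    unfolding has_spectral_integral_iff by auto
  have "(\<lambda>n. (norm (simple_int (s n) u))\<^sup>2) \<longlonglongrightarrow> 0"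
    using s(2) unfolding nn2_simple[OF s(1)] by (subst (asm) ennreal_tendsto_0_iff) auto
  moreover have "(\<lambda>n. (norm (simple_int (s n) u))\<^sup>2) \<longlonglongrightarrow> (norm (w - z))\<^sup>2"
    by (intro tendsto_intros s(3))
  ultimately have "(norm (w - z))\<^sup>2 = 0"
    using LIMSEQ_unique by blast
  then show ?thesis
    by simp
qed

lemma has_spectral_integral_finite:
  assumes "has_spectral_integral E g u w"
  shows "nn2 g u < \<infinity>"
proof -
  from assms obtain s where
    g [measurable]: "g \<in> borel_measurable borel"
    and s: "\<And>n. simple_function borel (s n)" "(\<lambda>n. nn2 (\<lambda>\<rho>. s n \<rho> - g \<rho>) u) \<longlonglongrightarrow> 0"
    unfolding has_spectral_integral_iff by blast
  note [measurable] = borel_measurable_simple_function[OF s(1)]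
  obtain n where n: "nn2 (\<lambda>\<rho>. s n \<rho> - g \<rho>) u < 1"
    using order_tendstoD(2)[OF s(2), of 1] eventually_happens'[OF sequentially_bot] by fastforce
  have "nn2 g u \<le> 2 * nn2 (s n) u + 2 * nn2 (\<lambda>\<rho>. g \<rho> - s n \<rho>) u"
    using nn2_add_le[of "s n" "\<lambda>\<rho>. g \<rho> - s n \<rho>" u] by simp
  also have "\<dots> < \<infinity>"
    using n unfolding nn2_simple[OF s(1)] nn2_minus_commute[of g]
    by (simp add: ennreal_mult_less_top top.not_eq_extremum) (meson less_trans ennreal_one_less_top)
  finally show ?thesis .
qed

text \<open>The definition of the integral provides a sequence for each u separately. Here one
  sequence serves all u at once, so that identities between different vectors, such as linearity and
  symmetry, can pass to the limit.\<close>

lemma simple_approximation: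
  assumes g [measurable]: "g \<in> borel_measurable borel"
  obtains s where "\<And>n. simple_function borel (s n)"
    and "\<And>u. nn2 g u < \<infinity> \<Longrightarrow> (\<lambda>n. nn2 (\<lambda>\<rho>. s n \<rho> - g \<rho>) u) \<longlonglongrightarrow> 0"
    and "\<And>u. nn2 g u < \<infinity> \<Longrightarrow> (\<lambda>n. nn2 (s n) u) \<longlonglongrightarrow> nn2 g u"
proof -
  obtain s where s: "\<And>n. simple_function borel (s n)" "\<And>\<rho>. (\<lambda>n. s n \<rho>) \<longlonglongrightarrow> g \<rho>"
      "\<And>n \<rho>. cmod (s n \<rho>) \<le> 2 * cmod (g \<rho>)"
    using borel_measurable_implies_sequence_metric[OF g, of 0] by (auto simp: dist_norm)
  note [measurable] = borel_measurable_simple_function[OF s(1)]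
  \<comment> \<open>From |s| \<le> 2|g| follows |s - g| \<le> 3|g|, so 9|g|^2 dominates both
    sequences of integrands.\<close>
  have dom: "(\<integral>\<^sup>+ \<rho>. ennreal (9 * (cmod (g \<rho>))\<^sup>2) \<partial>spectral_measure E u) < \<infinity>" if "nn2 g u < \<infinity>" for u
    using that by (simp add: ennreal_mult nn_integral_cmult nn2_def[symmetric] ennreal_mult_less_top)
  have lim1: "(\<lambda>n. nn2 (\<lambda>\<rho>. s n \<rho> - g \<rho>) u) \<longlonglongrightarrow> (\<integral>\<^sup>+ \<rho>. 0 \<partial>spectral_measure E u)" if "nn2 g u < \<infinity>" for u
    unfolding nn2_def
  proof (rule nn_integral_dominated_convergence[OF _ _ _ _ dom[OF that]])
    show "AE \<rho> in spectral_measure E u. ennreal ((cmod (s n \<rho> - g \<rho>))\<^sup>2) \<le> ennreal (9 * (cmod (g \<rho>))\<^sup>2)" for n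
    proof (intro AE_I2 ennreal_leI)
      fix \<rho>
      have "cmod (s n \<rho> - g \<rho>) \<le> 3 * cmod (g \<rho>)"
        using norm_triangle_ineq4[of "s n \<rho>" "g \<rho>"] s(3)[of n \<rho>] by linarith
      then have "(cmod (s n \<rho> - g \<rho>))\<^sup>2 \<le> (3 * cmod (g \<rho>))\<^sup>2"
        by (intro power_mono) auto
      then show "(cmod (s n \<rho> - g \<rho>))\<^sup>2 \<le> 9 * (cmod (g \<rho>))\<^sup>2"
        by (simp add: power_mult_distrib)
    qed
    have "(\<lambda>n. ennreal ((cmod (s n \<rho> - g \<rho>))\<^sup>2)) \<longlonglongrightarrow> ennreal ((cmod (g \<rho> - g \<rho>))\<^sup>2)" for \<rho>
      by (intro tendsto_intros s(2))
    then show "AE \<rho> in spectral_measure E u. (\<lambda>n. ennreal ((cmod (s n \<rho> - g \<rho>))\<^sup>2)) \<longlonglongrightarrow> 0"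
      by simp
  qed simp_all
  have lim2: "(\<lambda>n. nn2 (s n) u) \<longlonglongrightarrow> nn2 g u" if "nn2 g u < \<infinity>" for u
    unfolding nn2_def
  proof (rule nn_integral_dominated_convergence[OF _ _ _ _ dom[OF that]])
    show "AE \<rho> in spectral_measure E u. ennreal ((cmod (s n \<rho>))\<^sup>2) \<le> ennreal (9 * (cmod (g \<rho>))\<^sup>2)" for n
    proof (intro AE_I2 ennreal_leI)
      fix \<rho>
      have "(cmod (s n \<rho>))\<^sup>2 \<le> (3 * cmod (g \<rho>))\<^sup>2"
        using s(3)[of n \<rho>] norm_ge_zero[of "g \<rho>"] by (intro power_mono) (linarith | simp)+
      then show "(cmod (s n \<rho>))\<^sup>2 \<le> 9 * (cmod (g \<rho>))\<^sup>2"
        by (simp add: power_mult_distrib)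
    qed
    have "(\<lambda>n. ennreal ((cmod (s n \<rho>))\<^sup>2)) \<longlonglongrightarrow> ennreal ((cmod (g \<rho>))\<^sup>2)" for \<rho>
      by (intro tendsto_intros s(2))
    then show "AE \<rho> in spectral_measure E u. (\<lambda>n. ennreal ((cmod (s n \<rho>))\<^sup>2)) \<longlonglongrightarrow> ennreal ((cmod (g \<rho>))\<^sup>2)"
      by simp
  qed simp_all
  show thesis
    using lim1 by (intro that[OF s(1) _ lim2]) simp_all
qed

lemma convergent_simple_int:
  assumes s: "\<And>n. simple_function borel (s n)" and g [measurable]: "g \<in> borel_measurable borel"
    and lim: "(\<lambda>n. nn2 (\<lambda>\<rho>. s n \<rho> - g \<rho>) u) \<longlonglongrightarrow> 0"
  shows "convergent (\<lambda>n. simple_int (s n) u)"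
proof -
  note [measurable] = borel_measurable_simple_function[OF s]
  have "Cauchy (\<lambda>n. simple_int (s n) u)"
  proof (rule metric_CauchyI)
    fix e :: real
    assume "0 < e"
    \<comment> \<open>Two errors, each doubled by \<open>nn2_diff_le\<close>, add up to e^2/2,
      strictly below e^2.\<close>
    then have "0 < ennreal (e\<^sup>2 / 8)"
      by simp
    then obtain n0 where n0: "\<And>n. n \<ge> n0 \<Longrightarrow> nn2 (\<lambda>\<rho>. s n \<rho> - g \<rho>) u < ennreal (e\<^sup>2 / 8)"
      using order_tendstoD(2)[OF lim] unfolding eventually_sequentially by blast
    have "dist (simple_int (s p) u) (simple_int (s q) u) < e" if "p \<ge> n0" "q \<ge> n0" for p q
    proof -
      have "ennreal ((norm (simple_int (s p) u - simple_int (s q) u))\<^sup>2) = nn2 (\<lambda>\<rho>. s p \<rho> - s q \<rho>) u"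
        using s by (simp add: simple_int_diff nn2_simple)
      also have "\<dots> \<le> 2 * nn2 (\<lambda>\<rho>. s p \<rho> - g \<rho>) u + 2 * nn2 (\<lambda>\<rho>. s q \<rho> - g \<rho>) u"
        by (intro nn2_diff_le) measurable
      also have "\<dots> \<le> 2 * ennreal (e\<^sup>2 / 8) + 2 * ennreal (e\<^sup>2 / 8)"
        using n0 that by (intro add_mono mult_left_mono less_imp_le) auto
      also have "\<dots> = ennreal (e\<^sup>2 / 2)"
        by (simp flip: ennreal_plus ennreal_mult' ennreal_numeral)
      finally have "(norm (simple_int (s p) u - simple_int (s q) u))\<^sup>2 \<le> e\<^sup>2 / 2"
        by simp
      also have "\<dots> < e\<^sup>2"
        using \<open>0 < e\<close> by simp
      finally show ?thesis
        using \<open>0 < e\<close> by (auto simp: dist_norm intro: power_less_imp_less_base)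
    qed
    then show "\<exists>M. \<forall>m\<ge>M. \<forall>n\<ge>M. dist (simple_int (s m) u) (simple_int (s n) u) < e"
      by blast
  qed
  then show ?thesis
    using Cauchy_convergent_iff by blast
qed

lemma has_spectral_integral_exists:
  assumes "g \<in> borel_measurable borel" "nn2 g u < \<infinity>"
  obtains w where "has_spectral_integral E g u w"
proof -
  obtain s where s: "\<And>n. simple_function borel (s n)" "(\<lambda>n. nn2 (\<lambda>\<rho>. s n \<rho> - g \<rho>) u) \<longlonglongrightarrow> 0"
    using simple_approximation[OF assms(1)] assms(2) by metis
  obtain w where "(\<lambda>n. simple_int (s n) u) \<longlonglongrightarrow> w"
    using convergent_simple_int[OF s(1) assms(1) s(2)] convergentD by blast
  with s assms(1) show thesis
    by (intro that) (auto simp: has_spectral_integral_iff)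
qed

lemma has_spectral_integral_approximation:
  assumes g: "g \<in> borel_measurable borel"
  obtains s where "\<And>n. simple_function borel (s n)"
    and "\<And>u. nn2 g u < \<infinity> \<Longrightarrow> (\<lambda>n. nn2 (\<lambda>\<rho>. s n \<rho> - g \<rho>) u) \<longlonglongrightarrow> 0"
    and "\<And>u w. has_spectral_integral E g u w \<Longrightarrow> (\<lambda>n. simple_int (s n) u) \<longlonglongrightarrow> w"
    and "\<And>u. nn2 g u < \<infinity> \<Longrightarrow> (\<lambda>n. nn2 (s n) u) \<longlonglongrightarrow> nn2 g u"
proof -
  obtain s where s: "\<And>n. simple_function borel (s n)"
    "\<And>u. nn2 g u < \<infinity> \<Longrightarrow> (\<lambda>n. nn2 (\<lambda>\<rho>. s n \<rho> - g \<rho>) u) \<longlonglongrightarrow> 0"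
    "\<And>u. nn2 g u < \<infinity> \<Longrightarrow> (\<lambda>n. nn2 (s n) u) \<longlonglongrightarrow> nn2 g u"
    using simple_approximation[OF g] by blast
  have "(\<lambda>n. simple_int (s n) u) \<longlonglongrightarrow> w" if w: "has_spectral_integral E g u w" for u w
  proof -
    have lim: "(\<lambda>n. nn2 (\<lambda>\<rho>. s n \<rho> - g \<rho>) u) \<longlonglongrightarrow> 0"
      using s(2) has_spectral_integral_finite[OF w] by blast
    obtain z where z: "(\<lambda>n. simple_int (s n) u) \<longlonglongrightarrow> z"
      using convergent_simple_int[OF s(1) g lim] convergentD by blast
    then have "has_spectral_integral E g u z"
      using g s(1) lim by (auto simp: has_spectral_integral_iff)
    then show ?thesis
      using has_spectral_integral_unique[OF w] z by blast
  qed
  with s show thesis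
    using that by blast
qed

lemma has_spectral_integral_norm:
  assumes w: "has_spectral_integral E g u w"
  shows "nn2 g u = ennreal ((norm w)\<^sup>2)"
proof -
  obtain s where s: "\<And>n. simple_function borel (s n)"
    "(\<lambda>n. simple_int (s n) u) \<longlonglongrightarrow> w" "(\<lambda>n. nn2 (s n) u) \<longlonglongrightarrow> nn2 g u"
    using has_spectral_integral_approximation[OF has_spectral_integral_measurable[OF w]]
      w has_spectral_integral_finite[OF w] by metis
  have "(\<lambda>n. nn2 (s n) u) \<longlonglongrightarrow> ennreal ((norm w)\<^sup>2)"
    unfolding nn2_simple[OF s(1)] by (intro tendsto_intros s(2))
  then show ?thesis
    using s(3) LIMSEQ_unique by blast
qed

section \<open>Change of spectral measure and composition of integrals\<close>

text \<open>\<open>E A w\<close> is the integral of g cut off to A, so by the isometry its squared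
  norm is the integral of |g|^2 over A. Composition of integrals thereby becomes multiplication of
  densities.\<close>

lemma spectral_measure_eq_density:
  assumes w: "has_spectral_integral E g u w"
  shows "spectral_measure E w = density (spectral_measure E u) (\<lambda>\<rho>. ennreal ((cmod (g \<rho>))\<^sup>2))"
proof (rule measure_eqI)
  note [measurable] = has_spectral_integral_measurable[OF w]
  show "sets (spectral_measure E w) = sets (density (spectral_measure E u) (\<lambda>\<rho>. ennreal ((cmod (g \<rho>))\<^sup>2)))"
    by simp
  fix A
  assume "A \<in> sets (spectral_measure E w)"
  then have A [measurable]: "A \<in> sets borel"
    by simp
  have t: "simple_function borel (indicator A :: real \<Rightarrow> complex)"
    by simp
  have "nn2 (indicator A) w = nn2 (\<lambda>\<rho>. indicator A \<rho> * g \<rho>) u"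
    using has_spectral_integral_norm[OF has_spectral_integral_simple_mult[OF t w]] nn2_simple[OF t]
    by simp
  moreover have "nn2 (indicator A) w = emeasure (spectral_measure E w) A"
  proof -
    have "ennreal ((cmod (indicator A \<rho>))\<^sup>2) = indicator A \<rho>" for \<rho> :: real
      by (simp add: indicator_def)
    then show ?thesis
      unfolding nn2_def by simp
  qed
  moreover have "nn2 (\<lambda>\<rho>. indicator A \<rho> * g \<rho>) u
      = emeasure (density (spectral_measure E u) (\<lambda>\<rho>. ennreal ((cmod (g \<rho>))\<^sup>2))) A"
    unfolding nn2_def by (subst emeasure_density) (auto intro!: nn_integral_cong simp: indicator_def)
  ultimately show "emeasure (spectral_measure E w) A
      = emeasure (density (spectral_measure E u) (\<lambda>\<rho>. ennreal ((cmod (g \<rho>))\<^sup>2))) A"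
    by simp
qed

lemma nn2_spectral_integral:
  assumes w: "has_spectral_integral E g u w" and [measurable]: "h \<in> borel_measurable borel"
  shows "nn2 h w = nn2 (\<lambda>\<rho>. h \<rho> * g \<rho>) u"
proof -
  note [measurable] = has_spectral_integral_measurable[OF w]
  show ?thesis
    unfolding nn2_def spectral_measure_eq_density[OF w]
    by (subst nn_integral_density)
      (auto simp: norm_mult power_mult_distrib ennreal_mult mult.commute)
qed

text \<open>Closedness in the integrand for fixed u: g has some integral z, and the distance from
  \<open>wn n\<close> to z is the L2 distance of the integrands.\<close>

lemma has_spectral_integral_limit:
  assumes g: "g \<in> borel_measurable borel" "nn2 g u < \<infinity>"
    and gn: "\<And>n. has_spectral_integral E (gn n) u (wn n)"
    and lim: "(\<lambda>n. nn2 (\<lambda>\<rho>. gn n \<rho> - g \<rho>) u) \<longlonglongrightarrow> 0" "wn \<longlonglongrightarrow> w"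
  shows "has_spectral_integral E g u w"
proof -
  obtain z where z: "has_spectral_integral E g u z"
    using has_spectral_integral_exists[OF g] .
  have "nn2 (\<lambda>\<rho>. gn n \<rho> - g \<rho>) u = ennreal ((norm (wn n - z))\<^sup>2)" for n
    using has_spectral_integral_norm[OF has_spectral_integral_diff[OF gn z]] .
  then have "(\<lambda>n. (norm (wn n - z))\<^sup>2) \<longlonglongrightarrow> 0"
    using lim(1) by (simp add: ennreal_tendsto_0_iff)
  moreover have "(\<lambda>n. (norm (wn n - z))\<^sup>2) \<longlonglongrightarrow> (norm (w - z))\<^sup>2"
    by (intro tendsto_intros lim(2))
  ultimately have "(norm (w - z))\<^sup>2 = 0"
    using LIMSEQ_unique by blast
  then show ?thesis
    using z by simp
qed

text \<open>Only the outer factor h is approximated by simple functions. The error in L2 for w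
  equals the error after multiplication by g in L2 for u.\<close>

lemma has_spectral_integral_mult:
  assumes w: "has_spectral_integral E g u w" and z: "has_spectral_integral E h w z"
  shows "has_spectral_integral E (\<lambda>\<rho>. h \<rho> * g \<rho>) u z"
proof -
  have g [measurable]: "g \<in> borel_measurable borel" and h [measurable]: "h \<in> borel_measurable borel"
    using w z has_spectral_integral_measurable by blast+
  obtain s where s: "\<And>n. simple_function borel (s n)"
    "(\<lambda>n. nn2 (\<lambda>\<rho>. s n \<rho> - h \<rho>) w) \<longlonglongrightarrow> 0" "(\<lambda>n. simple_int (s n) w) \<longlonglongrightarrow> z"
    using z unfolding has_spectral_integral_iff by blast
  note [measurable] = borel_measurable_simple_function[OF s(1)]
  show ?thesis
  proof (rule has_spectral_integral_limit)
    show "has_spectral_integral E (\<lambda>\<rho>. s n \<rho> * g \<rho>) u (simple_int (s n) w)" for n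
      by (rule has_spectral_integral_simple_mult[OF s(1) w])
    show "nn2 (\<lambda>\<rho>. h \<rho> * g \<rho>) u < \<infinity>"
      using has_spectral_integral_finite[OF z] by (simp add: nn2_spectral_integral[OF w])
    have "nn2 (\<lambda>\<rho>. s n \<rho> * g \<rho> - h \<rho> * g \<rho>) u = nn2 (\<lambda>\<rho>. s n \<rho> - h \<rho>) w" for n
      by (subst nn2_spectral_integral[OF w]) (auto simp: left_diff_distrib)
    then show "(\<lambda>n. nn2 (\<lambda>\<rho>. s n \<rho> * g \<rho> - h \<rho> * g \<rho>) u) \<longlonglongrightarrow> 0"
      using s(2) by simp
  qed (use s in auto)
qed

text \<open>The converse of the product rule, including the question of domains: h may be unbounded,
  and w is in its domain because h * g is square integrable for u.\<close>

lemma has_spectral_integral_divide: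
  assumes w: "has_spectral_integral E g u w" and h: "h \<in> borel_measurable borel"
    and z: "has_spectral_integral E (\<lambda>\<rho>. h \<rho> * g \<rho>) u z"
  shows "has_spectral_integral E h w z"
proof -
  have "nn2 h w < \<infinity>"
    using has_spectral_integral_finite[OF z] by (simp add: nn2_spectral_integral[OF w h])
  then obtain y where y: "has_spectral_integral E h w y"
    using has_spectral_integral_exists[OF h] by blast
  then have "y = z"
    using has_spectral_integral_mult[OF w y] z has_spectral_integral_unique by blast
  with y show ?thesis
    by simp
qed

subsection \<open>Bounded functional calculus and \<open>(1 + P)\<^bsup>-1/2\<^esup>\<close>\<close>

definition fc :: "(real \<Rightarrow> real) \<Rightarrow> 'h \<Rightarrow> 'h" where
  "fc f = fcalc E (\<lambda>x. complex_of_real (f x))"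

text \<open>The bound is required on the half-line only, because a symbol enters through its values
  at \<rho>^2; this admits negative powers of 1 + x.\<close>

definition symbol :: "(real \<Rightarrow> real) \<Rightarrow> bool" where
  "symbol f \<longleftrightarrow> f \<in> borel_measurable borel \<and> (\<exists>K. \<forall>x\<ge>0. \<bar>f x\<bar> \<le> K)"

lemma fcalc_eqI: "has_spectral_integral E (\<lambda>\<rho>. f (\<rho>\<^sup>2)) u w \<Longrightarrow> fcalc E f u = w"
  unfolding fcalc_def by (rule the_equality) (auto intro: has_spectral_integral_unique)

lemma fcalc_dom_integral:
  "u \<in> fcalc_dom E f \<Longrightarrow> has_spectral_integral E (\<lambda>\<rho>. f (\<rho>\<^sup>2)) u (fcalc E f u)"
  unfolding fcalc_dom_def using fcalc_eqI by blast

lemma fc_eqI: "has_spectral_integral E (\<lambda>\<rho>. complex_of_real (f (\<rho>\<^sup>2))) u w \<Longrightarrow> fc f u = w"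
  unfolding fc_def by (rule fcalc_eqI)

lemma fc_cong: "(\<And>x. 0 \<le> x \<Longrightarrow> f x = g x) \<Longrightarrow> fc f = fc g"
  by (simp add: fc_def fcalc_def fun_eq_iff)

lemma symbol_measurable:
  assumes "symbol f"
  shows "(\<lambda>\<rho>. complex_of_real (f (\<rho>\<^sup>2))) \<in> borel_measurable borel"
proof -
  have [measurable]: "f \<in> borel_measurable borel"
    using assms by (simp add: symbol_def)
  show ?thesis
    by measurable
qed

lemma nn2_symbol:
  assumes "symbol f"
  shows "nn2 (\<lambda>\<rho>. complex_of_real (f (\<rho>\<^sup>2))) u < \<infinity>"
proof -
  obtain K where "\<And>x. 0 \<le> x \<Longrightarrow> \<bar>f x\<bar> \<le> K"
    using assms unfolding symbol_def by blast
  then show ?thesis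
    by (intro nn2_bounded[where K = K]) simp
qed

lemma fc_integral:
  assumes "symbol f"
  shows "has_spectral_integral E (\<lambda>\<rho>. complex_of_real (f (\<rho>\<^sup>2))) u (fc f u)"
proof -
  obtain w where "has_spectral_integral E (\<lambda>\<rho>. complex_of_real (f (\<rho>\<^sup>2))) u w"
    using has_spectral_integral_exists[OF symbol_measurable[OF assms] nn2_symbol[OF assms]] .
  then show ?thesis
    using fc_eqI by metis
qed

lemma symbol_one [intro]: "symbol (\<lambda>x. 1)"
  unfolding symbol_def by auto

lemma symbol_const_mult [intro]: "symbol f \<Longrightarrow> symbol (\<lambda>x. c * f x)"
  unfolding symbol_def abs_mult by (auto intro!: mult_left_mono exI[of _ "\<bar>c\<bar> * _"])

lemma symbol_mult [intro]:
  assumes "symbol f" "symbol g"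
  shows "symbol (\<lambda>x. f x * g x)"
proof -
  obtain K L where "\<And>x. 0 \<le> x \<Longrightarrow> \<bar>f x\<bar> \<le> K" "\<And>x. 0 \<le> x \<Longrightarrow> \<bar>g x\<bar> \<le> L"
    using assms unfolding symbol_def by blast
  then have "\<bar>f x * g x\<bar> \<le> K * L" if "0 \<le> x" for x
    using that unfolding abs_mult by (intro mult_mono) (auto intro: order_trans[OF abs_ge_zero])
  then show ?thesis
    using assms unfolding symbol_def by auto
qed

lemma symbol_indicator [intro]: "A \<in> sets borel \<Longrightarrow> symbol (indicator A)"
  unfolding symbol_def by (auto intro!: exI[of _ 1] simp: indicator_def)

lemma powr_one_plus_le_one: "0 \<le> (x::real) \<Longrightarrow> s \<le> 0 \<Longrightarrow> (1 + x) powr s \<le> 1"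
  using powr_mono[of s 0 "1 + x"] by simp

lemma symbol_powr [intro]: "s \<le> 0 \<Longrightarrow> symbol (\<lambda>x. (1 + x) powr s)"
  unfolding symbol_def by (auto intro!: exI[of _ 1] simp: powr_one_plus_le_one)

lemma fc_one: "fc (\<lambda>x. 1) u = u"
proof (rule fc_eqI)
  have "simple_int (\<lambda>\<rho>. 1) u = u"
    by (simp add: simple_int_def E_UNIV)
  then show "has_spectral_integral E (\<lambda>\<rho>. complex_of_real 1) u u"
    unfolding has_spectral_integral_iff by (auto intro!: exI[of _ "\<lambda>_ _. 1"] simp: nn2_const)
qed

lemma fc_mult: "symbol f \<Longrightarrow> symbol g \<Longrightarrow> fc f (fc g u) = fc (\<lambda>x. f x * g x) u"
  using has_spectral_integral_mult[OF fc_integral fc_integral, of g f u] by (intro fc_eqI[symmetric]) simp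

lemma fc_diff: "symbol f \<Longrightarrow> symbol g \<Longrightarrow> fc (\<lambda>x. f x - g x) u = fc f u - fc g u"
  using has_spectral_integral_diff[OF fc_integral fc_integral] by (intro fc_eqI) simp

lemma fc_add: "symbol f \<Longrightarrow> symbol g \<Longrightarrow> fc (\<lambda>x. f x + g x) u = fc f u + fc g u"
  using has_spectral_integral_add[OF fc_integral fc_integral] by (intro fc_eqI) simp

lemma fc_const_mult: "symbol f \<Longrightarrow> fc (\<lambda>x. c * f x) u = c *\<^sub>R fc f u"
  using has_spectral_integral_simple_mult[OF _ fc_integral, of "\<lambda>_. complex_of_real c" f u]
  by (intro fc_eqI) (simp add: simple_int_def E_UNIV scaleR_scaleC)

lemma fc_linear:
  assumes f: "symbol f"
  shows "clinear_on UNIV (fc f)"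
proof -
  obtain s where s: "simple_function borel (s n)"
    "has_spectral_integral E (\<lambda>\<rho>. complex_of_real (f (\<rho>\<^sup>2))) u w \<Longrightarrow> (\<lambda>n. simple_int (s n) u) \<longlonglongrightarrow> w" for n u w
    by (rule has_spectral_integral_approximation[OF symbol_measurable[OF f]]) (rule that)
  have lim: "(\<lambda>n. simple_int (s n) u) \<longlonglongrightarrow> fc f u" for u
    using s(2)[OF fc_integral[OF f]] .
  have lin: "simple_int (s n) (u + v) = simple_int (s n) u + simple_int (s n) v"
    "simple_int (s n) (c *\<^sub>C u) = c *\<^sub>C simple_int (s n) u" for n u v c
    using simple_int_linear[OF s(1)] by (auto simp: clinear_on_UNIV_iff)
  have "fc f (u + v) = fc f u + fc f v" for u v
    using lim[of "u + v"] tendsto_add[OF lim lim] unfolding lin by (rule LIMSEQ_unique)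
  moreover have "fc f (c *\<^sub>C u) = c *\<^sub>C fc f u" for c u
    using lim[of "c *\<^sub>C u"] tendsto_scaleC[OF lim] unfolding lin by (rule LIMSEQ_unique)
  ultimately show ?thesis
    by (simp add: clinear_on_UNIV_iff)
qed

lemma fc_adjoint:
  assumes f: "symbol f"
  shows "cinner (fc f u) v = cinner u (fc f v)"
proof -
  let ?g = "\<lambda>\<rho>. complex_of_real (f (\<rho>\<^sup>2))"
  obtain s where s: "simple_function borel (s n)"
    "nn2 ?g u < \<infinity> \<Longrightarrow> (\<lambda>n. nn2 (\<lambda>\<rho>. s n \<rho> - ?g \<rho>) u) \<longlonglongrightarrow> 0"
    "has_spectral_integral E ?g u w \<Longrightarrow> (\<lambda>n. simple_int (s n) u) \<longlonglongrightarrow> w" for n u w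
    by (rule has_spectral_integral_approximation[OF symbol_measurable[OF f]]) (rule that)
  \<comment> \<open>The symbol is real, so the conjugates of its approximations approximate it as
    well; the adjoint of a simple integral is the conjugate one.\<close>
  have cs: "simple_function borel (\<lambda>\<rho>. cnj (s n \<rho>))" for n
    using simple_function_compose1[OF s(1)] .
  have eq: "nn2 (\<lambda>\<rho>. cnj (s n \<rho>) - ?g \<rho>) v = nn2 (\<lambda>\<rho>. s n \<rho> - ?g \<rho>) v" for n
  proof -
    have "cmod (cnj (s n \<rho>) - ?g \<rho>) = cmod (s n \<rho> - ?g \<rho>)" for \<rho>
      by (metis complex_cnj_complex_of_real complex_cnj_diff complex_mod_cnj)
    then show ?thesis
      by (simp add: nn2_def)
  qed
  have lim: "(\<lambda>n. nn2 (\<lambda>\<rho>. cnj (s n \<rho>) - ?g \<rho>) v) \<longlonglongrightarrow> 0"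
    unfolding eq using s(2)[OF nn2_symbol[OF f]] .
  obtain w where w: "(\<lambda>n. simple_int (\<lambda>\<rho>. cnj (s n \<rho>)) v) \<longlonglongrightarrow> w"
    using convergent_simple_int[OF cs symbol_measurable[OF f] lim] convergentD by blast
  then have "has_spectral_integral E ?g v w"
    unfolding has_spectral_integral_iff using cs lim symbol_measurable[OF f]
    by (intro conjI exI[of _ "\<lambda>n \<rho>. cnj (s n \<rho>)"]) auto
  then have "w = fc f v"
    using fc_eqI by blast
  with w have "(\<lambda>n. cinner u (simple_int (\<lambda>\<rho>. cnj (s n \<rho>)) v)) \<longlonglongrightarrow> cinner u (fc f v)"
    by (auto intro: tendsto_intros)
  moreover have "(\<lambda>n. cinner (simple_int (s n) u) v) \<longlonglongrightarrow> cinner (fc f u) v"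
    using s(3)[OF fc_integral[OF f]] by (intro tendsto_intros)
  ultimately show ?thesis
    unfolding simple_int_adjoint[OF s(1)] using LIMSEQ_unique by blast
qed

text \<open>Here g may be unbounded as long as its integral at u exists. This allows a spectral
  cut-off to be compared with the function \<psi> of the ellipticity condition.\<close>

lemma fc_norm_le_integral:
  assumes f: "symbol f" and w: "has_spectral_integral E (\<lambda>\<rho>. complex_of_real (g (\<rho>\<^sup>2))) u w"
    and le: "\<And>x. 0 \<le> x \<Longrightarrow> \<bar>f x\<bar> \<le> K * \<bar>g x\<bar>" and "0 \<le> K"
  shows "norm (fc f u) \<le> K * norm w"
proof -
  have "ennreal ((norm (fc f u))\<^sup>2) = nn2 (\<lambda>\<rho>. complex_of_real (f (\<rho>\<^sup>2))) u"
    using has_spectral_integral_norm[OF fc_integral[OF f]] ..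
  also have "\<dots> \<le> nn2 (\<lambda>\<rho>. of_real K * complex_of_real (g (\<rho>\<^sup>2))) u"
    using le \<open>0 \<le> K\<close> by (intro nn2_mono) (simp add: norm_mult)
  also have "\<dots> = ennreal ((K * norm w)\<^sup>2)"
    by (simp add: nn2_cmult[OF has_spectral_integral_measurable[OF w]] has_spectral_integral_norm[OF w]
        power_mult_distrib flip: ennreal_mult')
  finally show ?thesis
    using \<open>0 \<le> K\<close> by (simp add: power2_le_iff_abs_le)
qed

lemma fc_norm_mono:
  assumes "symbol f" "symbol g" "\<And>x. 0 \<le> x \<Longrightarrow> \<bar>f x\<bar> \<le> K * \<bar>g x\<bar>" "0 \<le> K"
  shows "norm (fc f u) \<le> K * norm (fc g u)"
  using fc_norm_le_integral[OF assms(1) fc_integral[OF assms(2)] assms(3,4)] .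

lemma fc_norm_le:
  assumes "symbol f" "\<And>x. 0 \<le> x \<Longrightarrow> \<bar>f x\<bar> \<le> K" "0 \<le> K"
  shows "norm (fc f u) \<le> K * norm u"
  using fc_norm_mono[of f "\<lambda>x. 1" K u] assms by (auto simp: fc_one)

section \<open>The operator S and the form of P on its range\<close>

definition S :: "'h \<Rightarrow> 'h" where
  "S = Lam E (- (1/2))"

abbreviation \<sigma> :: "real \<Rightarrow> real" where
  "\<sigma> \<equiv> \<lambda>x. (1 + x) powr (- (1/2))"

lemma Lam_eq_fc: "Lam E s = fc (\<lambda>x. (1 + x) powr s)"
  by (simp add: Lam_def fc_def)

lemma S_eq_fc: "S = fc \<sigma>"
  unfolding S_def Lam_eq_fc ..

lemma Hs_half: "Hs E (1/2) = range S"
  unfolding Hs_def S_def ..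

lemma S_linear: "clinear_on UNIV S"
  unfolding S_eq_fc by (intro fc_linear symbol_powr) simp

lemma S_adjoint: "cinner (S u) v = cinner u (S v)"
  unfolding S_eq_fc by (intro fc_adjoint symbol_powr) simp

lemma norm_S_le: "norm (S u) \<le> norm u"
  unfolding S_eq_fc using fc_norm_le[OF symbol_powr, of "- (1/2)" 1 u] by (simp add: powr_one_plus_le_one)

lemma sigma_square: "0 \<le> x \<Longrightarrow> \<sigma> x * \<sigma> x = 1 / (1 + x)"
  by (simp add: powr_minus_divide flip: powr_add)

text \<open>On the range of S an unbounded f acts as the bounded symbol f * \<sigma>, provided half
  a power of 1 + x suffices to tame it.\<close>

lemma fc_S:
  assumes f: "f \<in> borel_measurable borel" and h: "symbol (\<lambda>x. f x * \<sigma> x)"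
  shows "fc f (S x) = fc (\<lambda>x. f x * \<sigma> x) x"
proof -
  have "symbol \<sigma>"
    by auto
  from has_spectral_integral_divide[OF fc_integral[OF this], of "\<lambda>\<rho>. complex_of_real (f (\<rho>\<^sup>2))" x]
  show ?thesis
    unfolding S_eq_fc using f fc_integral[OF h, of x] by (intro fc_eqI) simp
qed

lemma Lam_half_S: "Lam E (1/2) (S x) = x"
proof -
  have eq: "(1 + t) powr (1/2) * \<sigma> t = 1" if "0 \<le> t" for t :: real
    using that by (simp add: powr_minus field_simps)
  have "symbol (\<lambda>x. (1 + x) powr (1/2) * \<sigma> x)"
    using eq unfolding symbol_def by (auto intro!: exI[of _ 1])
  then have "Lam E (1/2) (S x) = fc (\<lambda>x. (1 + x) powr (1/2) * \<sigma> x) x"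
    unfolding Lam_eq_fc by (intro fc_S) auto
  also have "\<dots> = x"
    using eq fc_cong[of "\<lambda>x. (1 + x) powr (1/2) * \<sigma> x" "\<lambda>x. 1"] by (simp add: fc_one)
  finally show ?thesis .
qed

lemma S_eq_iff [simp]: "S x = S y \<longleftrightarrow> x = y"
  by (metis Lam_half_S)

lemma Hs_norm_S: "Hs_norm E (1/2) (S x) = norm x"
  by (simp add: Hs_norm_def Lam_half_S)

text \<open>Both square roots of P become the bounded symbol sqrt x * \<sigma> x, whose square is x
  / (1 + x) = 1 - 1 / (1 + x).\<close>

lemma P_ext_S: "P_ext E (S x) (S y) = cinner x y - cinner (S x) (S y)"
proof -
  let ?h = "\<lambda>x. sqrt x * \<sigma> x"
  have sq: "?h t * ?h t = 1 - \<sigma> t * \<sigma> t" if "0 \<le> t" for t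
  proof -
    have "?h t * ?h t = t * (\<sigma> t * \<sigma> t)"
      using that by (simp add: mult.assoc mult.left_commute)
    then show ?thesis
      unfolding sigma_square[OF that] using that by (simp add: field_simps)
  qed
  have h: "symbol ?h"
    unfolding symbol_def
  proof (intro conjI exI allI impI)
    fix x :: real
    assume "0 \<le> x"
    have "(?h x)\<^sup>2 \<le> 1"
      unfolding power2_eq_square sq[OF \<open>0 \<le> x\<close>] by simp
    then show "\<bar>?h x\<bar> \<le> 1"
      using abs_square_le_1 by blast
  qed auto
  have \<sigma>: "symbol \<sigma>"
    by auto
  have "P_ext E (S x) (S y) = cinner (fc ?h x) (fc ?h y)"
    unfolding P_ext_def fc_def[symmetric] by (simp only: fc_S[OF borel_measurable_sqrt h])
  also have "\<dots> = cinner x (fc (\<lambda>t. ?h t * ?h t) y)"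
    by (simp only: fc_adjoint[OF h] fc_mult[OF h h])
  also have "fc (\<lambda>t. ?h t * ?h t) = fc (\<lambda>t. 1 - \<sigma> t * \<sigma> t)"
    by (rule fc_cong) (rule sq)
  also have "fc (\<lambda>t. 1 - \<sigma> t * \<sigma> t) y = y - S (S y)"
    unfolding S_eq_fc fc_mult[OF \<sigma> \<sigma>] fc_diff[OF symbol_one symbol_mult[OF \<sigma> \<sigma>]] fc_one ..
  finally show ?thesis
    by (simp only: cinner_diff_right S_adjoint)
qed

end


section \<open>The a priori estimate\<close>

text \<open>The variable x is a value of P, hence the square of \<rho>; the window has relative
  width \<delta> around \<tau>^2.\<close>

definition near :: "real \<Rightarrow> real \<Rightarrow> real set" where
  "near \<delta> \<tau> = {x. \<bar>x - \<tau>\<^sup>2\<bar> \<le> \<delta> * \<tau>\<^sup>2}"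

lemma near_borel [measurable]: "near \<delta> \<tau> \<in> sets borel"
  unfolding near_def by measurable

text \<open>Off the window \<tau>^2 is at most |x - \<tau>^2| / \<delta>, so x + \<tau>^2 \<le> |x -
  \<tau>^2| + 2\<tau>^2 is at most 1 + 2/\<delta> times |x - \<tau>^2|. The condition k \<le> 2s
  raises the exponent 1/2 - s to (1 - k)/2, and k \<le> 1 keeps the latter nonnegative, so that 1 +
  x may be replaced by x + \<tau>^2. A negative power of x + \<tau>^2 remains, which is largest at x
  = 0.\<close>

lemma far_bounds:
  assumes x: "x \<notin> near \<delta> \<tau>" "0 \<le> x" and \<tau>: "1 \<le> \<bar>\<tau>\<bar>" and \<delta>: "0 < \<delta>"
    and k: "0 \<le> k" "k \<le> 1" "k \<le> 2 * s"
  shows "(1 + x) powr (1/2 - s) / \<bar>x - \<tau>\<^sup>2\<bar> \<le> (1 + 2 / \<delta>) * \<bar>\<tau>\<bar> powr (- 1 - k)"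
    and "1 / \<bar>x - \<tau>\<^sup>2\<bar> \<le> (1 + 2 / \<delta>) / \<tau>\<^sup>2"
proof -
  have \<tau>2: "1 \<le> \<tau>\<^sup>2"
    using \<tau> by (metis one_le_power power2_abs)
  have far: "\<delta> * \<tau>\<^sup>2 < \<bar>x - \<tau>\<^sup>2\<bar>"
    using x by (simp add: near_def)
  moreover have "0 < \<delta> * \<tau>\<^sup>2"
    using \<delta> \<tau>2 by (intro mult_pos_pos) auto
  ultimately have pos: "0 < \<bar>x - \<tau>\<^sup>2\<bar>"
    by linarith
  have "2 * \<tau>\<^sup>2 \<le> (2 / \<delta>) * \<bar>x - \<tau>\<^sup>2\<bar>"
    using far \<delta> by (simp add: field_simps)
  then have "\<bar>x - \<tau>\<^sup>2\<bar> + 2 * \<tau>\<^sup>2 \<le> (1 + 2 / \<delta>) * \<bar>x - \<tau>\<^sup>2\<bar>"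
    by (simp add: distrib_right)
  then have sum: "x + \<tau>\<^sup>2 \<le> (1 + 2 / \<delta>) * \<bar>x - \<tau>\<^sup>2\<bar>"
    by linarith
  have inv: "1 / \<bar>x - \<tau>\<^sup>2\<bar> \<le> (1 + 2 / \<delta>) / (x + \<tau>\<^sup>2)"
    using sum pos x(2) \<tau>2 by (simp add: field_simps)
  also have "\<dots> \<le> (1 + 2 / \<delta>) / \<tau>\<^sup>2"
  proof (rule divide_left_mono)
    have "0 < \<tau>\<^sup>2" "0 < x + \<tau>\<^sup>2"
      using x(2) \<tau>2 by linarith+
    then show "0 < (x + \<tau>\<^sup>2) * \<tau>\<^sup>2"
      by (rule mult_pos_pos[rotated])
  qed (use x(2) \<delta> in auto)
  finally show "1 / \<bar>x - \<tau>\<^sup>2\<bar> \<le> (1 + 2 / \<delta>) / \<tau>\<^sup>2" .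
  have "(1 + x) powr (1/2 - s) \<le> (1 + x) powr ((1 - k) / 2)"
    using x(2) k by (intro powr_mono) auto
  also have "\<dots> \<le> (x + \<tau>\<^sup>2) powr ((1 - k) / 2)"
    using x(2) \<tau>2 k by (intro powr_mono2) auto
  finally have "(1 + x) powr (1/2 - s) / \<bar>x - \<tau>\<^sup>2\<bar>
      \<le> (x + \<tau>\<^sup>2) powr ((1 - k) / 2) * ((1 + 2 / \<delta>) / (x + \<tau>\<^sup>2))"
    using inv by (subst divide_inverse, intro mult_mono) (auto simp: inverse_eq_divide)
  also have "\<dots> = (1 + 2 / \<delta>) * (x + \<tau>\<^sup>2) powr ((- 1 - k) / 2)"
  proof -
    have "(x + \<tau>\<^sup>2) powr ((- 1 - k) / 2) = (x + \<tau>\<^sup>2) powr ((1 - k) / 2 - 1)"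
      by (simp add: field_simps)
    also have "\<dots> = (x + \<tau>\<^sup>2) powr ((1 - k) / 2) / (x + \<tau>\<^sup>2)"
      using x(2) \<tau>2 by (simp add: powr_diff)
    finally show ?thesis
      by simp
  qed
  also have "\<dots> \<le> (1 + 2 / \<delta>) * (\<tau>\<^sup>2) powr ((- 1 - k) / 2)"
    using x(2) \<tau>2 k \<delta> by (intro mult_left_mono powr_mono2') auto
  also have "(\<tau>\<^sup>2) powr ((- 1 - k) / 2) = \<bar>\<tau>\<bar> powr (- 1 - k)"
  proof -
    have "\<tau>\<^sup>2 = \<bar>\<tau>\<bar> powr 2"
      using \<tau> by (simp add: powr_numeral)
    then show ?thesis
      by (simp only: powr_powr) (simp add: diff_divide_distrib)
  qed
  finally show "(1 + x) powr (1/2 - s) / \<bar>x - \<tau>\<^sup>2\<bar> \<le> (1 + 2 / \<delta>) * \<bar>\<tau>\<bar> powr (- 1 - k)" .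
qed

text \<open>A window of relative width at most 1/2 stays above \<tau>^2 / 2; this produces the
  factor 2^N.\<close>

lemma near_bound:
  assumes x: "x \<in> near \<delta> \<tau>" "0 \<le> x" and \<tau>: "1 \<le> \<bar>\<tau>\<bar>" and \<delta>: "\<delta> \<le> 1/2" and N: "0 \<le> N"
  shows "(1 + x) powr (- N) \<le> 2 powr N * \<bar>\<tau>\<bar> powr (- 2 * N)"
proof -
  have \<tau>2: "\<tau>\<^sup>2 = \<bar>\<tau>\<bar> powr 2"
    using \<tau> by (simp add: powr_numeral)
  have "\<delta> * \<tau>\<^sup>2 \<le> 1/2 * \<tau>\<^sup>2"
    using \<delta> by (intro mult_right_mono) auto
  then have "\<tau>\<^sup>2 / 2 \<le> 1 + x"
    using x(1) unfolding near_def mem_Collect_eq by linarith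
  moreover have "0 < \<tau>\<^sup>2 / 2"
    using \<tau> by auto
  ultimately have "(1 + x) powr (- N) \<le> (\<tau>\<^sup>2 / 2) powr (- N)"
    using N by (intro powr_mono2') auto
  also have "\<dots> = (\<tau>\<^sup>2) powr (- N) / 2 powr (- N)"
    by (rule powr_divide)
  also have "(\<tau>\<^sup>2) powr (- N) = \<bar>\<tau>\<bar> powr (- 2 * N)"
    unfolding \<tau>2 powr_powr by simp
  also have "\<bar>\<tau>\<bar> powr (- 2 * N) / 2 powr (- N) = 2 powr N * \<bar>\<tau>\<bar> powr (- 2 * N)"
    by (simp add: powr_minus_divide)
  finally show ?thesis .
qed

text \<open>Here \<open>p\<close> and \<open>A0\<close> are the norms of the parts of \<open>v\<close> near and away from \<open>P \<approx> \<tau>\<^sup>2\<close>, \<open>a\<close> is the norm of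
  \<open>\<Lambda>\<^bsup>-N\<^esup>v\<close>, \<open>A\<close> that of its part away from \<open>\<tau>\<^sup>2\<close>, and \<open>\<Gamma> = \<parallel>Qv\<parallel>\<close>.\<close>

lemma absorption:
  fixes m e p a A v A0 R \<Gamma> b c C D K \<kappa> \<tau> :: real
  defines "M \<equiv> max (1 / m) 1" and "W \<equiv> \<Gamma>\<^sup>2 + R\<^sup>2"
  assumes pos: "0 < m" "0 < c" "0 < C" "0 \<le> e" "0 \<le> b" "0 \<le> D" "0 \<le> K"
    and nonneg: "0 \<le> a" "0 \<le> A" "0 \<le> A0" "0 \<le> p" "0 \<le> v" "0 \<le> \<Gamma>" "0 \<le> R"
    and ell: "m * (c * p)\<^sup>2 \<le> C * \<Gamma>\<^sup>2 + e * a\<^sup>2"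
    and a: "a \<le> b * p + A" and eb: "4 * (e * b\<^sup>2) \<le> m * c\<^sup>2"
    and A: "A \<le> D * (R / \<tau> + K * \<kappa> * \<Gamma>)" and e\<tau>: "e / \<tau>\<^sup>2 \<le> 1" and e\<kappa>: "e * \<kappa>\<^sup>2 \<le> 1 + m"
    and A0: "A0 \<le> D * (R + K * \<Gamma>)" and v: "v \<le> p + A0"
  shows "v\<^sup>2 \<le> (4 / c\<^sup>2 * (C + 4 * D\<^sup>2 + 8 * D\<^sup>2 * K\<^sup>2) + 4 * D\<^sup>2 * (1 + K\<^sup>2)) * M * W"
proof -
  have sq: "z\<^sup>2 \<le> 2 * x\<^sup>2 + 2 * y\<^sup>2" if "z \<le> x + y" "0 \<le> z" for x y z :: real
  proof -
    have "z\<^sup>2 \<le> (x + y)\<^sup>2"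
      using that by (intro power_mono)
    then show ?thesis
      using sum_squares_bound[of x y] by (simp add: power2_sum)
  qed
  \<comment> \<open>Errors of size 1 and of size m can both be charged to m M, and the factor m
    cancels against the one in front of p^2.\<close>
  have M: "1 \<le> M" "1 \<le> m * M" "m \<le> m * M"
    using pos(1) by (simp_all add: M_def field_simps max_def)
  have W: "\<Gamma>\<^sup>2 \<le> W" "R\<^sup>2 \<le> W" "0 \<le> W"
    by (simp_all add: W_def)
  have "A\<^sup>2 \<le> D\<^sup>2 * (2 * (R / \<tau>)\<^sup>2 + 2 * (K * \<kappa> * \<Gamma>)\<^sup>2)"
  proof -
    have "A\<^sup>2 \<le> (D * (R / \<tau> + K * \<kappa> * \<Gamma>))\<^sup>2"
      using A nonneg(2) by (rule power_mono)
    also have "\<dots> = D\<^sup>2 * (R / \<tau> + K * \<kappa> * \<Gamma>)\<^sup>2"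
      by (rule power_mult_distrib)
    also have "\<dots> \<le> D\<^sup>2 * (2 * (R / \<tau>)\<^sup>2 + 2 * (K * \<kappa> * \<Gamma>)\<^sup>2)"
      using sum_squares_bound[of "R / \<tau>" "K * \<kappa> * \<Gamma>"] by (intro mult_left_mono) (simp_all only: power2_sum, simp_all)
    finally show ?thesis .
  qed
  then have "e * A\<^sup>2 \<le> e * (D\<^sup>2 * (2 * (R / \<tau>)\<^sup>2 + 2 * (K * \<kappa> * \<Gamma>)\<^sup>2))"
    using pos(4) by (rule mult_left_mono)
  also have "\<dots> = 2 * D\<^sup>2 * (e / \<tau>\<^sup>2 * R\<^sup>2 + e * \<kappa>\<^sup>2 * (K\<^sup>2 * \<Gamma>\<^sup>2))"
    by (simp add: power_divide power_mult_distrib algebra_simps)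
  also have "\<dots> \<le> 2 * D\<^sup>2 * (1 * R\<^sup>2 + (1 + m) * (K\<^sup>2 * \<Gamma>\<^sup>2))"
    using e\<tau> e\<kappa> by (intro mult_left_mono add_mono mult_right_mono) auto
  also have "\<dots> \<le> 2 * D\<^sup>2 * (m * M * W + 2 * (m * M) * (K\<^sup>2 * W))"
  proof -
    have "1 * R\<^sup>2 \<le> m * M * W"
      using M W by (intro mult_mono) auto
    moreover have "(1 + m) * (K\<^sup>2 * \<Gamma>\<^sup>2) \<le> 2 * (m * M) * (K\<^sup>2 * W)"
    proof (rule mult_mono)
      show "1 + m \<le> 2 * (m * M)"
        using M(2,3) by linarith
      then show "0 \<le> 2 * (m * M)"
        using pos(1) by linarith
    qed (use W in \<open>auto intro: mult_left_mono\<close>)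
    ultimately show ?thesis
      by (intro mult_left_mono add_mono) auto
  qed
  finally have eA: "e * A\<^sup>2 \<le> (2 * D\<^sup>2 + 4 * D\<^sup>2 * K\<^sup>2) * (m * M * W)"
    by (simp add: algebra_simps)
  have "e * a\<^sup>2 \<le> e * (2 * (b * p)\<^sup>2 + 2 * A\<^sup>2)"
    using sq[OF a nonneg(1)] pos(4) by (rule mult_left_mono)
  also have "\<dots> = 2 * (e * b\<^sup>2) * p\<^sup>2 + 2 * (e * A\<^sup>2)"
    by (simp add: power_mult_distrib algebra_simps)
  \<comment> \<open>The 4 in \<open>eb\<close> is chosen so that, after the doubling in
    \<open>sq\<close>, the near part of the error uses up exactly half of m c^2 p^2.\<close>
  also have "\<dots> \<le> (m * c\<^sup>2 / 2) * p\<^sup>2 + 2 * ((2 * D\<^sup>2 + 4 * D\<^sup>2 * K\<^sup>2) * (m * M * W))"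
    using eb eA by (intro add_mono mult_right_mono mult_left_mono) auto
  finally have "e * a\<^sup>2 \<le> (m * c\<^sup>2 / 2) * p\<^sup>2 + (4 * D\<^sup>2 + 8 * D\<^sup>2 * K\<^sup>2) * (m * M * W)"
    by (simp add: algebra_simps)
  moreover have "C * \<Gamma>\<^sup>2 \<le> C * (m * M * W)"
  proof -
    have "1 * \<Gamma>\<^sup>2 \<le> m * M * W"
      using M W by (intro mult_mono) auto
    then show ?thesis
      using pos(3) by (intro mult_left_mono) auto
  qed
  ultimately have "(m * c\<^sup>2 / 2) * p\<^sup>2 \<le> (C + 4 * D\<^sup>2 + 8 * D\<^sup>2 * K\<^sup>2) * (m * M * W)"
    using ell by (simp add: power_mult_distrib algebra_simps)
  then have "m * (c\<^sup>2 / 2 * p\<^sup>2) \<le> m * ((C + 4 * D\<^sup>2 + 8 * D\<^sup>2 * K\<^sup>2) * (M * W))"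
    by (simp add: algebra_simps)
  then have "c\<^sup>2 / 2 * p\<^sup>2 \<le> (C + 4 * D\<^sup>2 + 8 * D\<^sup>2 * K\<^sup>2) * (M * W)"
    using pos(1) by (simp only: mult_le_cancel_left_pos)
  then have p: "p\<^sup>2 \<le> 2 / c\<^sup>2 * (C + 4 * D\<^sup>2 + 8 * D\<^sup>2 * K\<^sup>2) * (M * W)"
    using pos(2) by (simp add: field_simps)
  have "A0\<^sup>2 \<le> (D * R + D * (K * \<Gamma>))\<^sup>2"
    using A0 nonneg(3) by (intro power_mono) (simp_all add: algebra_simps)
  also have "\<dots> \<le> 2 * (D * R)\<^sup>2 + 2 * (D * (K * \<Gamma>))\<^sup>2"
    using sum_squares_bound[of "D * R" "D * (K * \<Gamma>)"] by (simp add: power2_sum)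
  also have "\<dots> = 2 * D\<^sup>2 * (R\<^sup>2 + K\<^sup>2 * \<Gamma>\<^sup>2)"
    by (simp add: power_mult_distrib algebra_simps)
  also have "\<dots> \<le> 2 * D\<^sup>2 * (W + K\<^sup>2 * W)"
    using W by (intro mult_left_mono add_mono) auto
  also have "\<dots> = 2 * D\<^sup>2 * (1 + K\<^sup>2) * (1 * W)"
    by (simp add: algebra_simps)
  also have "\<dots> \<le> 2 * D\<^sup>2 * (1 + K\<^sup>2) * (M * W)"
    using M W by (intro mult_left_mono mult_right_mono) auto
  finally have "A0\<^sup>2 \<le> 2 * D\<^sup>2 * (1 + K\<^sup>2) * (M * W)" .
  moreover define t where "t = 2 / c\<^sup>2"
  moreover have "4 / c\<^sup>2 = 2 * t"
    by (simp add: t_def)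
  ultimately show ?thesis
    using p sq[OF v nonneg(5)] by (simp add: algebra_simps flip: t_def)
qed

text \<open>If n exceeded 2 L R, then L R n would be below n^2/2 and, as L \<ge> 1, L R^2 below
  n^2/4. It serves where ||Qv||^2 is bounded by a product of data R and solution n.\<close>

lemma le_of_square_le:
  fixes n R L :: real
  assumes "n\<^sup>2 \<le> L * (R * n + R\<^sup>2)" "0 \<le> n" "0 \<le> R" "1 \<le> L"
  shows "n \<le> 2 * L * R"
proof (rule ccontr)
  assume "\<not> ?thesis"
  then have less: "2 * L * R < n"
    by simp
  then have "0 < n"
    using assms(3,4) mult_nonneg_nonneg[of L R] by linarith
  have "(2 * L * R) * n < n * n"
    using less \<open>0 < n\<close> by simp
  moreover have "(2 * L * R) * R \<le> n * R"
    using less assms(3) by (intro mult_right_mono) auto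
  moreover have "1 * (R * n) \<le> L * (R * n)"
    using assms by (intro mult_right_mono) auto
  moreover have "0 \<le> L * (R * n)"
    using assms by (intro mult_nonneg_nonneg) auto
  ultimately show False
    using assms(1) by (simp add: power2_eq_square algebra_simps)
qed

lemma linear_inverse:
  assumes T: "clinear_on D T" and X: "csubspace X" and maps: "\<And>U. U \<in> D \<Longrightarrow> T U \<in> X"
    and bij: "\<And>F. F \<in> X \<Longrightarrow> \<exists>!U. U \<in> D \<and> T U = F"
  obtains R where "inverse_operator X D T R" "clinear_on X R"
proof -
  define R where "R F = (THE U. U \<in> D \<and> T U = F)" for F
  have R: "R F \<in> D" "T (R F) = F" if "F \<in> X" for F
    using theI'[OF bij[OF that]] by (simp_all add: R_def)
  have eq: "U = R F" if "U \<in> D" "T U = F" "F \<in> X" for U F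
    using bij[OF that(3)] that R[OF that(3)] by blast
  have D: "csubspace D" and add: "\<And>x y. x \<in> D \<Longrightarrow> y \<in> D \<Longrightarrow> T (x + y) = T x + T y"
    and scale: "\<And>c x. x \<in> D \<Longrightarrow> T (c *\<^sub>C x) = c *\<^sub>C T x"
    using T by (auto simp: clinear_on_def)
  have "inverse_operator X D T R"
    using R eq maps by (fastforce simp: inverse_operator_def)
  moreover have "clinear_on X R"
    unfolding clinear_on_def
  proof (intro conjI ballI allI X)
    fix F F'
    assume "F \<in> X" "F' \<in> X"
    then show "R (F + F') = R F + R F'"
      using X D R add by (intro eq[symmetric]) (auto simp: csubspace_iff)
  next
    fix c F
    assume "F \<in> X"
    then show "R (c *\<^sub>C F) = c *\<^sub>C R F"
      using X D R scale by (intro eq[symmetric]) (auto simp: csubspace_iff)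
  qed
  ultimately show thesis
    by (rule that)
qed

locale observed_pvm = pvm E for E :: "real set \<Rightarrow> 'h::complex_hilbert \<Rightarrow> 'h" +
  fixes G :: "'h \<Rightarrow> 'y::complex_hilbert" and K :: real
  assumes G_linear: "clinear_on UNIV G"
    and norm_G_le: "norm (G x) \<le> K * norm x"
    and K_nonneg: "0 \<le> K"
begin

section \<open>Estimates for weak solutions\<close>

text \<open>The weak form of \<open>(P - \<tau>\<^sup>2)v = \<Lambda>\<^bsup>1/2\<^esup>r + i\<tau>Q\<^sup>*Qv + i\<tau>g\<close> for \<open>v = Sy\<close>, with test functions \<open>Sz\<close>.\<close>

definition weak_sol :: "real \<Rightarrow> 'h \<Rightarrow> 'h \<Rightarrow> 'h \<Rightarrow> bool" where
  "weak_sol \<tau> y r g \<longleftrightarrow> (\<forall>z. cinner y z - of_real (1 + \<tau>\<^sup>2) * cinner (S y) (S z)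
     = cinner r z + \<i> * of_real \<tau> * (cinner (G y) (G z) + cinner g (S z)))"

text \<open>Testing with z = y and taking real parts removes the damping, since i\<tau> ||G y||^2 is
  imaginary. What remains bounds the \<open>H_{1/2}\<close> norm of v by |\<tau>| times its norm in
  H.\<close>

lemma norm_le_of_weak_sol:
  assumes "weak_sol \<tau> y r g" and \<tau>: "1 \<le> \<bar>\<tau>\<bar>"
  shows "norm y \<le> 2 * \<bar>\<tau>\<bar> * norm (S y) + 2 * (norm r + norm g)"
proof -
  define b where "b = \<bar>\<tau>\<bar> * norm (S y)"
  define R where "R = norm r + norm g"
  have "cinner y y - of_real (1 + \<tau>\<^sup>2) * cinner (S y) (S y)
     = cinner r y + \<i> * of_real \<tau> * (cinner (G y) (G y) + cinner g (S y))"
    using assms(1) unfolding weak_sol_def by blast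
  then have "(norm y)\<^sup>2 - (1 + \<tau>\<^sup>2) * (norm (S y))\<^sup>2 = Re (cinner r y) - \<tau> * Im (cinner g (S y))"
    by (simp add: cinner_self complex_eq_iff flip: of_real_power)
  moreover have "Re (cinner r y) \<le> R * norm y"
    using Re_cinner_le_norm[of r y] mult_right_mono[of "norm r" R "norm y"] by (simp add: R_def)
  moreover have "- \<tau> * Im (cinner g (S y)) \<le> R * b"
  proof -
    have "- \<tau> * Im (cinner g (S y)) \<le> \<bar>\<tau>\<bar> * \<bar>Im (cinner g (S y))\<bar>"
      by (metis abs_ge_self abs_minus_cancel abs_mult)
    also have "\<dots> \<le> \<bar>\<tau>\<bar> * (norm g * norm (S y))"
      using abs_Im_le_cmod[of "cinner g (S y)"] norm_cinner_le[of g "S y"] by (intro mult_left_mono) auto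
    also have "\<dots> \<le> R * b"
      unfolding b_def R_def by (simp add: algebra_simps)
    finally show ?thesis .
  qed
  moreover have "(1 + \<tau>\<^sup>2) * (norm (S y))\<^sup>2 \<le> 2 * b\<^sup>2"
  proof -
    have "1 \<le> \<tau>\<^sup>2"
      using \<tau> by (metis one_le_power power2_abs)
    then have "(1 + \<tau>\<^sup>2) * (norm (S y))\<^sup>2 \<le> (2 * \<tau>\<^sup>2) * (norm (S y))\<^sup>2"
      by (intro mult_right_mono) auto
    then show ?thesis
      by (simp add: b_def power_mult_distrib)
  qed
  ultimately have ineq: "(norm y)\<^sup>2 \<le> 2 * b\<^sup>2 + R * norm y + R * b"
    by linarith
  have nonneg: "0 \<le> b" "0 \<le> R"
    by (simp_all add: b_def R_def)
  have "norm y \<le> 2 * b + 2 * R"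
  proof (rule ccontr)
    assume "\<not> ?thesis"
    then have less: "2 * b + 2 * R < norm y"
      by simp
    then have "0 < norm y"
      using nonneg by linarith
    then have "(2 * b + 2 * R) * norm y < norm y * norm y"
      using less by simp
    moreover have "(2 * b) * b \<le> norm y * b" "(2 * b) * R \<le> norm y * R"
      using less nonneg by (intro mult_right_mono; linarith)+
    ultimately show False
      using ineq nonneg \<open>0 < norm y\<close> mult_nonneg_nonneg[OF nonneg(1) norm_ge_zero[of y]]
        mult_nonneg_nonneg[OF nonneg(2) norm_ge_zero[of y]]
      by (simp add: power2_eq_square algebra_simps)
  qed
  then show ?thesis
    by (simp add: b_def R_def)
qed

text \<open>Testing with z = \<phi>(P) y makes the left side the square of ||q(P) y||. By the bounds
  with \<alpha> and \<beta> the right side contains the same norm once, and one factor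
  cancels.\<close>

lemma weak_sol_test:
  assumes sol: "weak_sol \<tau> y r g" and \<phi>: "symbol \<phi>" and q: "symbol q"
    and eq: "\<And>x. 0 \<le> x \<Longrightarrow> \<phi> x - (1 + \<tau>\<^sup>2) * (\<sigma> x * (\<sigma> x * \<phi> x)) = q x * q x"
    and \<alpha>: "\<And>x. 0 \<le> x \<Longrightarrow> \<bar>\<phi> x\<bar> \<le> \<alpha> * \<bar>q x\<bar>" "0 \<le> \<alpha>"
    and \<beta>: "\<And>x. 0 \<le> x \<Longrightarrow> \<bar>\<sigma> x * \<phi> x\<bar> \<le> \<beta> * \<bar>q x\<bar>" "0 \<le> \<beta>"
  shows "norm (fc q y) \<le> \<alpha> * norm r + \<bar>\<tau>\<bar> * (K * \<alpha> * norm (G y) + \<beta> * norm g)"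
proof -
  define A where "A = norm (fc q y)"
  define z where "z = fc \<phi> y"
  have \<sigma>: "symbol \<sigma>"
    by (rule symbol_powr) simp
  note \<sigma>\<phi> = symbol_mult[OF \<sigma> \<phi>]
  note \<sigma>\<sigma>\<phi> = symbol_mult[OF \<sigma> \<sigma>\<phi>]
  have Sz: "S z = fc (\<lambda>x. \<sigma> x * \<phi> x) y"
    unfolding S_eq_fc z_def fc_mult[OF \<sigma> \<phi>] ..
  have SSz: "S (S z) = fc (\<lambda>x. \<sigma> x * (\<sigma> x * \<phi> x)) y"
    unfolding Sz unfolding S_eq_fc fc_mult[OF \<sigma> \<sigma>\<phi>] ..
  have "cinner y z - of_real (1 + \<tau>\<^sup>2) * cinner (S y) (S z)
      = cinner y (fc (\<lambda>x. \<phi> x - (1 + \<tau>\<^sup>2) * (\<sigma> x * (\<sigma> x * \<phi> x))) y)"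
    unfolding fc_diff[OF \<phi> symbol_const_mult[OF \<sigma>\<sigma>\<phi>]] fc_const_mult[OF \<sigma>\<sigma>\<phi>] S_adjoint SSz
      cinner_diff_right cinner_scaleR_right unfolding z_def ..
  also have "\<dots> = cinner y (fc (\<lambda>x. q x * q x) y)"
    using fc_cong[OF eq] by simp
  also have "\<dots> = of_real (A\<^sup>2)"
    by (simp only: fc_mult[OF q q, symmetric] fc_adjoint[OF q, symmetric] cinner_self A_def)
  finally have A: "of_real (A\<^sup>2) = cinner r z + \<i> * of_real \<tau> * (cinner (G y) (G z) + cinner g (S z))"
    using sol unfolding weak_sol_def by metis
  have z: "norm z \<le> \<alpha> * A"
    unfolding z_def A_def by (rule fc_norm_mono[OF \<phi> q \<alpha>])
  have Sz': "norm (S z) \<le> \<beta> * A"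
    unfolding Sz A_def by (rule fc_norm_mono[OF \<sigma>\<phi> q \<beta>])
  have "A\<^sup>2 = cmod (of_real (A\<^sup>2))"
    unfolding norm_of_real by simp
  also have "\<dots> \<le> cmod (cinner r z) + cmod (\<i> * of_real \<tau> * (cinner (G y) (G z) + cinner g (S z)))"
    unfolding A by (rule norm_triangle_ineq)
  also have "\<dots> = cmod (cinner r z) + \<bar>\<tau>\<bar> * cmod (cinner (G y) (G z) + cinner g (S z))"
    by (simp add: norm_mult)
  also have "\<dots> \<le> cmod (cinner r z) + \<bar>\<tau>\<bar> * (cmod (cinner (G y) (G z)) + cmod (cinner g (S z)))"
    by (intro add_left_mono mult_left_mono norm_triangle_ineq) simp
  also have "\<dots> \<le> norm r * (\<alpha> * A) + \<bar>\<tau>\<bar> * (norm (G y) * (K * (\<alpha> * A)) + norm g * (\<beta> * A))"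
  proof -
    have "norm (G z) \<le> K * (\<alpha> * A)"
      using norm_G_le[of z] mult_left_mono[OF z K_nonneg] by linarith
    then show ?thesis
      using z Sz' by (intro add_mono mult_left_mono order_trans[OF norm_cinner_le]) auto
  qed
  also have "\<dots> = (\<alpha> * norm r + \<bar>\<tau>\<bar> * (K * \<alpha> * norm (G y) + \<beta> * norm g)) * A"
    by (simp add: algebra_simps)
  finally have le: "A * A \<le> (\<alpha> * norm r + \<bar>\<tau>\<bar> * (K * \<alpha> * norm (G y) + \<beta> * norm g)) * A"
    by (simp add: power2_eq_square)
  show ?thesis
  proof (cases "A = 0")
    case True
    then show ?thesis
      using \<alpha>(2) \<beta>(2) K_nonneg by (simp add: A_def)
  next
    case False
    then have "0 < A"
      by (simp add: A_def)
    with le show ?thesis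
      by (simp add: A_def)
  qed
qed

lemma weak_sol_far:
  assumes sol: "weak_sol \<tau> y r g" and \<tau>: "1 \<le> \<bar>\<tau>\<bar>" and \<delta>: "0 < \<delta>"
    and k: "0 \<le> k" "k \<le> 1" "k \<le> 2 * s"
  shows "norm (fc (\<lambda>x. indicator (- near \<delta> \<tau>) x * (1 + x) powr (- s)) (S y))
    \<le> (1 + 2 / \<delta>) * ((norm r + norm g) / \<bar>\<tau>\<bar> + K * \<bar>\<tau>\<bar> powr (- k) * norm (G y))"
proof -
  define D where "D = 1 + 2 / \<delta>"
  have "0 < D"
    using \<delta> by (simp add: D_def add_pos_pos)
  \<comment> \<open>As y is tested through S, the factor \<sigma> in q turns ||q(P) y|| into the far
    part of ||(1 + P)^(-s) v||. In \<phi>, division by x - \<tau>^2 undoes 1 - (1 + \<tau>^2)/(1 +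
    x) = (x - \<tau>^2)/(1 + x), and the cut-off keeps it bounded.\<close>
  define q where "q x = indicator (- near \<delta> \<tau>) x * (1 + x) powr (- s) * \<sigma> x" for x
  define \<phi> where "\<phi> x = indicator (- near \<delta> \<tau>) x * ((1 + x) powr (- 2 * s) / (x - \<tau>\<^sup>2))" for x
  have \<tau>2: "1 \<le> \<tau>\<^sup>2"
    using \<tau> by (metis one_le_power power2_abs)
  have \<sigma>: "symbol \<sigma>"
    by (rule symbol_powr) simp
  have far: "- near \<delta> \<tau> \<in> sets borel"
    by (intro borel_comp near_borel)
  have f: "symbol (\<lambda>x. indicator (- near \<delta> \<tau>) x * (1 + x) powr (- s))"
    using k far by (intro symbol_mult symbol_indicator symbol_powr) auto
  have q: "symbol q"
    unfolding q_def using symbol_mult[OF f \<sigma>] .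
  have \<phi>: "symbol \<phi>"
    unfolding symbol_def
  proof (intro conjI exI allI impI)
    show "\<phi> \<in> borel_measurable borel"
      unfolding \<phi>_def using far by measurable
    fix x :: real
    assume x: "0 \<le> x"
    show "\<bar>\<phi> x\<bar> \<le> D / \<tau>\<^sup>2"
    proof (cases "x \<in> near \<delta> \<tau>")
      case True
      then show ?thesis
        using \<open>0 < D\<close> by (simp add: \<phi>_def)
    next
      case False
      have "\<bar>\<phi> x\<bar> = (1 + x) powr (- 2 * s) * (1 / \<bar>x - \<tau>\<^sup>2\<bar>)"
        using False by (simp add: \<phi>_def abs_mult)
      also have "\<dots> \<le> 1 * (D / \<tau>\<^sup>2)"
        using far_bounds(2)[OF False x \<tau> \<delta> k] powr_one_plus_le_one[of x "- 2 * s"] x k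
        by (intro mult_mono) (auto simp: D_def)
      finally show ?thesis
        by simp
    qed
  qed
  have "norm (fc q y) \<le> (D * \<bar>\<tau>\<bar> powr (- 1 - k)) * norm r
      + \<bar>\<tau>\<bar> * (K * (D * \<bar>\<tau>\<bar> powr (- 1 - k)) * norm (G y) + (D / \<tau>\<^sup>2) * norm g)"
  proof (rule weak_sol_test[OF sol \<phi> q])
    fix x :: real
    assume x: "0 \<le> x"
    have pos: "0 < 1 + x"
      using x by linarith
    \<comment> \<open>The terms r and G y are paired with z and see this quotient, with its extra
      half power of 1 + x. The term g lies in H and is paired with S z, where \<sigma> removes the
      half power and the full gain \<tau>^(-2) is available.\<close>
    have split: "\<phi> x = q x * ((1 + x) powr (1/2 - s) / (x - \<tau>\<^sup>2))"
    proof -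
      have "(1 + x) powr (- s) * \<sigma> x * (1 + x) powr (1/2 - s) = (1 + x) powr (- 2 * s)"
        by (simp flip: powr_add)
      from this[symmetric] show ?thesis
        unfolding \<phi>_def q_def by (simp only: times_divide_eq_right mult.assoc)
    qed
    show "\<phi> x - (1 + \<tau>\<^sup>2) * (\<sigma> x * (\<sigma> x * \<phi> x)) = q x * q x"
    proof (cases "x \<in> near \<delta> \<tau>")
      case False
      then have ne: "x - \<tau>\<^sup>2 \<noteq> 0"
        using \<delta> \<tau>2 by (auto simp: near_def)
      have "q x * q x = ((1 + x) powr (- s) * (1 + x) powr (- s)) * (\<sigma> x * \<sigma> x)"
        using False by (simp add: q_def)
      also have "(1 + x) powr (- s) * (1 + x) powr (- s) = (1 + x) powr (- 2 * s)"
        by (simp flip: powr_add)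
      finally have "q x * q x = (1 + x) powr (- 2 * s) * (1 / (1 + x))"
        unfolding sigma_square[OF x] .
      moreover have "\<phi> x = (1 + x) powr (- 2 * s) / (x - \<tau>\<^sup>2)"
        using False by (simp add: \<phi>_def)
      moreover have "\<sigma> x * (\<sigma> x * \<phi> x) = 1 / (1 + x) * \<phi> x"
        using sigma_square[OF x] by (simp add: mult.assoc[symmetric])
      moreover have "P / (x - \<tau>\<^sup>2) - (1 + \<tau>\<^sup>2) * (1 / (1 + x) * (P / (x - \<tau>\<^sup>2))) = P * (1 / (1 + x))" for P
      proof -
        have "P / (x - \<tau>\<^sup>2) - (1 + \<tau>\<^sup>2) * (1 / (1 + x) * (P / (x - \<tau>\<^sup>2)))
            = P / (x - \<tau>\<^sup>2) * (1 - (1 + \<tau>\<^sup>2) / (1 + x))"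
          by (simp add: algebra_simps)
        also have "1 - (1 + \<tau>\<^sup>2) / (1 + x) = (x - \<tau>\<^sup>2) / (1 + x)"
          using pos by (simp add: field_simps)
        finally show ?thesis
          using ne by simp
      qed
      ultimately show ?thesis
        by simp
    qed (simp add: \<phi>_def q_def)
    have bound: "\<bar>q x * w\<bar> \<le> b * \<bar>q x\<bar>" if "x \<notin> near \<delta> \<tau> \<Longrightarrow> \<bar>w\<bar> \<le> b" for w b
    proof (cases "x \<in> near \<delta> \<tau>")
      case False
      then show ?thesis
        using mult_right_mono[OF that, of "\<bar>q x\<bar>"] by (simp add: abs_mult mult.commute)
    qed (simp add: q_def)
    show "\<bar>\<phi> x\<bar> \<le> (D * \<bar>\<tau>\<bar> powr (- 1 - k)) * \<bar>q x\<bar>"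
      unfolding split using far_bounds(1)[OF _ x \<tau> \<delta> k] by (intro bound) (simp add: D_def)
    have "\<bar>\<sigma> x * ((1 + x) powr (1/2 - s) / (x - \<tau>\<^sup>2))\<bar> \<le> D / \<tau>\<^sup>2" if "x \<notin> near \<delta> \<tau>"
    proof -
      have "\<bar>\<sigma> x * ((1 + x) powr (1/2 - s) / (x - \<tau>\<^sup>2))\<bar> = (\<sigma> x * (1 + x) powr (1/2 - s)) * (1 / \<bar>x - \<tau>\<^sup>2\<bar>)"
        by (simp add: abs_mult)
      also have "\<sigma> x * (1 + x) powr (1/2 - s) = (1 + x) powr (- s)"
        by (simp flip: powr_add)
      also have "(1 + x) powr (- s) * (1 / \<bar>x - \<tau>\<^sup>2\<bar>) \<le> 1 * (D / \<tau>\<^sup>2)"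
        using far_bounds(2)[OF that x \<tau> \<delta> k] powr_one_plus_le_one[of x "- s"] x k
        by (intro mult_mono) (auto simp: D_def)
      finally show ?thesis
        by simp
    qed
    moreover have "\<sigma> x * \<phi> x = q x * (\<sigma> x * ((1 + x) powr (1/2 - s) / (x - \<tau>\<^sup>2)))"
      unfolding split by (simp only: mult_ac)
    ultimately show "\<bar>\<sigma> x * \<phi> x\<bar> \<le> (D / \<tau>\<^sup>2) * \<bar>q x\<bar>"
      using bound by metis
  qed (use \<open>0 < D\<close> in auto)
  also have "\<dots> = D * (\<bar>\<tau>\<bar> powr (- 1 - k) * norm r + norm g / \<bar>\<tau>\<bar> + K * \<bar>\<tau>\<bar> powr (- k) * norm (G y))"
  proof -
    have "\<bar>\<tau>\<bar> * \<bar>\<tau>\<bar> powr (- 1 - k) = \<bar>\<tau>\<bar> powr (- k)"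
      using \<tau> by (simp add: powr_diff powr_minus_divide)
    moreover have "\<bar>\<tau>\<bar> / \<tau>\<^sup>2 = 1 / \<bar>\<tau>\<bar>"
      using \<tau> by (simp add: power2_eq_square abs_if)
    moreover have "(D * w) * norm r + \<bar>\<tau>\<bar> * (K * (D * w) * norm (G y) + (D / \<tau>\<^sup>2) * norm g)
        = D * (w * norm r + (\<bar>\<tau>\<bar> / \<tau>\<^sup>2) * norm g + K * (\<bar>\<tau>\<bar> * w) * norm (G y))" for w
      by (simp add: algebra_simps)
    ultimately show ?thesis
      by simp
  qed
  \<comment> \<open>The additional gain k is given up for r; it matters only for the damping
    term.\<close>
  also have "\<dots> \<le> D * (norm r / \<bar>\<tau>\<bar> + norm g / \<bar>\<tau>\<bar> + K * \<bar>\<tau>\<bar> powr (- k) * norm (G y))"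
  proof -
    have "\<bar>\<tau>\<bar> powr (- 1 - k) \<le> \<bar>\<tau>\<bar> powr (- 1)"
      using \<tau> k by (intro powr_mono) auto
    also have "\<dots> = 1 / \<bar>\<tau>\<bar>"
      using \<tau> by (simp add: powr_minus_divide)
    finally have "\<bar>\<tau>\<bar> powr (- 1 - k) * norm r \<le> 1 / \<bar>\<tau>\<bar> * norm r"
      by (intro mult_right_mono) auto
    then show ?thesis
      using \<open>0 < D\<close> by (intro mult_left_mono add_right_mono) auto
  qed
  also have "fc q y = fc (\<lambda>x. indicator (- near \<delta> \<tau>) x * (1 + x) powr (- s)) (S y)"
    unfolding S_eq_fc fc_mult[OF f \<sigma>] q_def ..
  finally show ?thesis
    by (simp add: D_def add_divide_distrib)
qed

lemma weak_sol_elliptic: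
  assumes sol: "weak_sol \<tau> y r g" and \<tau>: "1 \<le> \<bar>\<tau>\<bar>" and \<delta>: "0 < \<delta>" "\<delta> \<le> 1/2"
    and N: "0 < N" and c: "0 < c" and C: "0 < C" and m: "0 < m"
    and ell: "m * (c * norm (fc (indicator (near \<delta> \<tau>)) (S y)))\<^sup>2
        \<le> C * (norm (G y))\<^sup>2 + e * (norm (Lam E (- N) (S y)))\<^sup>2"
    and e: "0 \<le> e" "e \<le> \<epsilon> * (m * \<bar>\<tau>\<bar> powr (4 * N))" "e \<le> \<bar>\<tau>\<bar>"
    and \<epsilon>: "\<epsilon> \<le> 1" "4 * (\<epsilon> * 4 powr N) \<le> c\<^sup>2"
  defines "D \<equiv> 1 + 2 / \<delta>"
  shows "(norm (S y))\<^sup>2 \<le> (4 / c\<^sup>2 * (C + 4 * D\<^sup>2 + 8 * D\<^sup>2 * K\<^sup>2) + 4 * D\<^sup>2 * (1 + K\<^sup>2))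
    * max (1 / m) 1 * ((norm (G y))\<^sup>2 + (norm r + norm g)\<^sup>2)"
proof -
  \<comment> \<open>The largest gain that \<open>far_bounds\<close> allows for s = N.\<close>
  define k where "k = min 1 (2 * N)"
  let ?near = "\<lambda>x. indicator (near \<delta> \<tau>) x :: real" and ?far = "\<lambda>x. indicator (- near \<delta> \<tau>) x :: real"
  let ?f = "\<lambda>x::real. (1 + x) powr (- N)"
  have near: "symbol ?near" and far: "symbol ?far"
    by (auto intro!: symbol_indicator borel_comp near_borel)
  have f: "symbol ?f"
    using N by (intro symbol_powr) auto
  have \<tau>2: "\<tau>\<^sup>2 = \<bar>\<tau>\<bar> powr 2"
    using \<tau> by (simp add: powr_numeral)
  have "\<bar>\<tau>\<bar> \<le> \<tau>\<^sup>2"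
    using \<tau> by (metis power2_abs power2_eq_square mult_left_mono abs_ge_zero mult.right_neutral)
  then have e\<tau>: "e / \<tau>\<^sup>2 \<le> 1"
    using e(3) \<tau> by (simp add: divide_le_eq)
  \<comment> \<open>The two alternatives in the bound on e: for k = 1 use e \<le> |\<tau>|,
    otherwise 2k = 4N matches the bound by m |\<tau>|^(4N).\<close>
  have e\<kappa>: "e * (\<bar>\<tau>\<bar> powr (- k))\<^sup>2 \<le> 1 + m"
  proof -
    have sq: "(\<bar>\<tau>\<bar> powr (- k))\<^sup>2 = \<bar>\<tau>\<bar> powr (- (2 * k))"
      using \<tau> by (simp add: power2_eq_square flip: powr_add)
    show ?thesis
    proof (cases "k = 1")
      case True
      then have "e * (\<bar>\<tau>\<bar> powr (- k))\<^sup>2 = e / \<tau>\<^sup>2"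
        unfolding sq \<tau>2 by (simp add: powr_minus_divide)
      then show ?thesis
        using e\<tau> m by simp
    next
      case False
      then have "2 * k = 4 * N"
        by (auto simp: k_def min_def split: if_splits)
      then have "e * (\<bar>\<tau>\<bar> powr (- k))\<^sup>2 = e / \<bar>\<tau>\<bar> powr (4 * N)"
        unfolding sq by (simp add: powr_minus_divide)
      also have "\<dots> \<le> \<epsilon> * m"
        using e(2) \<tau> by (simp add: divide_le_eq mult.assoc)
      also have "\<dots> \<le> 1 * m"
        using \<epsilon> m by (intro mult_right_mono) auto
      finally show ?thesis
        by simp
    qed
  qed
  show ?thesis
  proof (rule absorption[where p = "norm (fc ?near (S y))" and a = "norm (Lam E (- N) (S y))" and e = e
        and A = "norm (fc (\<lambda>x. ?far x * ?f x) (S y))" and A0 = "norm (fc (\<lambda>x. ?far x * (1 + x) powr (- 0)) (S y))"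
        and b = "2 powr N * \<bar>\<tau>\<bar> powr (- 2 * N)" and \<kappa> = "\<bar>\<tau>\<bar> powr (- k)" and \<tau> = "\<bar>\<tau>\<bar>" and c = c and C = C])
    have "Lam E (- N) (S y) = fc (\<lambda>x. ?near x * ?f x + ?far x * ?f x) (S y)"
      unfolding Lam_eq_fc by (rule arg_cong[where f = "\<lambda>h. fc h (S y)"]) (auto simp: fun_eq_iff indicator_def)
    also have "\<dots> = fc (\<lambda>x. ?near x * ?f x) (S y) + fc (\<lambda>x. ?far x * ?f x) (S y)"
      using near far f by (intro fc_add symbol_mult)
    finally have "norm (Lam E (- N) (S y)) \<le> norm (fc (\<lambda>x. ?near x * ?f x) (S y)) + norm (fc (\<lambda>x. ?far x * ?f x) (S y))"
      by (simp add: norm_triangle_ineq)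
    moreover have "norm (fc (\<lambda>x. ?near x * ?f x) (S y)) \<le> 2 powr N * \<bar>\<tau>\<bar> powr (- 2 * N) * norm (fc ?near (S y))"
    proof (rule fc_norm_mono[OF symbol_mult[OF near f] near])
      show "\<bar>?near x * ?f x\<bar> \<le> 2 powr N * \<bar>\<tau>\<bar> powr (- 2 * N) * \<bar>?near x\<bar>" if "0 \<le> x" for x
        using near_bound[OF _ that \<tau> \<delta>(2), of N] N by (cases "x \<in> near \<delta> \<tau>") auto
    qed simp
    ultimately show "norm (Lam E (- N) (S y)) \<le> 2 powr N * \<bar>\<tau>\<bar> powr (- 2 * N) * norm (fc ?near (S y))
        + norm (fc (\<lambda>x. ?far x * ?f x) (S y))"
      by linarith
    have "S y = fc (\<lambda>x. 1) (S y)"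
      by (simp add: fc_one)
    also have "\<dots> = fc (\<lambda>x. ?near x + ?far x * (1 + x) powr (- 0)) (S y)"
      by (rule arg_cong[where f = "\<lambda>h. h (S y)"], rule fc_cong) (auto simp: indicator_def)
    also have "\<dots> = fc ?near (S y) + fc (\<lambda>x. ?far x * (1 + x) powr (- 0)) (S y)"
      using near far by (intro fc_add symbol_mult symbol_powr) auto
    finally show "norm (S y) \<le> norm (fc ?near (S y)) + norm (fc (\<lambda>x. ?far x * (1 + x) powr (- 0)) (S y))"
      by (metis norm_triangle_ineq)
    show "norm (fc (\<lambda>x. ?far x * ?f x) (S y))
        \<le> D * ((norm r + norm g) / \<bar>\<tau>\<bar> + K * \<bar>\<tau>\<bar> powr (- k) * norm (G y))"
      unfolding D_def using N by (intro weak_sol_far[OF sol \<tau> \<delta>(1)]) (auto simp: k_def)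
    \<comment> \<open>The far estimate with s = 0 and k = 0: no gain is available without a weight,
      and none is required as this part is not multiplied by e.\<close>
    have "norm (fc (\<lambda>x. ?far x * (1 + x) powr (- 0)) (S y))
        \<le> D * ((norm r + norm g) / \<bar>\<tau>\<bar> + K * \<bar>\<tau>\<bar> powr (- 0) * norm (G y))"
      unfolding D_def by (intro weak_sol_far[OF sol \<tau> \<delta>(1)]) auto
    also have "\<dots> \<le> D * ((norm r + norm g) + K * norm (G y))"
    proof -
      have "(norm r + norm g) / \<bar>\<tau>\<bar> \<le> (norm r + norm g) / 1"
        using \<tau> by (intro divide_left_mono) auto
      then show ?thesis
        using \<delta> \<tau> by (intro mult_left_mono add_mono) (auto simp: D_def)
    qed
    finally show "norm (fc (\<lambda>x. ?far x * (1 + x) powr (- 0)) (S y)) \<le> D * ((norm r + norm g) + K * norm (G y))" .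
    have "(2 powr N * \<bar>\<tau>\<bar> powr (- 2 * N))\<^sup>2 = 4 powr N / \<bar>\<tau>\<bar> powr (4 * N)"
    proof -
      have "(2 powr N)\<^sup>2 = (4::real) powr N"
        by (simp add: power2_eq_square flip: powr_mult)
      moreover have "(\<bar>\<tau>\<bar> powr (- 2 * N))\<^sup>2 = \<bar>\<tau>\<bar> powr (- (4 * N))"
        by (simp add: power2_eq_square flip: powr_add)
      ultimately show ?thesis
        by (simp only: power_mult_distrib) (simp add: powr_minus_divide)
    qed
    then have "4 * (e * (2 powr N * \<bar>\<tau>\<bar> powr (- 2 * N))\<^sup>2) = 4 * 4 powr N * (e / \<bar>\<tau>\<bar> powr (4 * N))"
      by simp
    also have "\<dots> \<le> 4 * 4 powr N * (\<epsilon> * m)"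
      using e(2) \<tau> by (intro mult_left_mono) (auto simp: divide_le_eq mult.assoc)
    also have "\<dots> = m * (4 * (\<epsilon> * 4 powr N))"
      by simp
    also have "\<dots> \<le> m * c\<^sup>2"
      using \<epsilon> m by (intro mult_left_mono) auto
    finally show "4 * (e * (2 powr N * \<bar>\<tau>\<bar> powr (- 2 * N))\<^sup>2) \<le> m * c\<^sup>2" .
  qed (use e\<tau> e\<kappa> ell e c C m \<delta> K_nonneg in \<open>auto simp: D_def\<close>)
qed

text \<open>Continuity of \<psi> at 1 replaces \<psi> by a sharp spectral window, and the little-o
  condition is used with one fixed \<epsilon>. As the window and the final bound depend on |\<tau>|
  only, both signs of \<tau> are covered.\<close>

lemma elliptic_estimate:
  assumes m: "\<And>x. 0 < x \<Longrightarrow> 0 < m x" and ell: "m_elliptic E Q m" and G: "\<And>x. G x = Q (S x)"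
  obtains C \<tau>0 where "0 < C" "1 \<le> \<tau>0"
    and "\<And>\<tau> y r g. \<tau>0 \<le> \<bar>\<tau>\<bar> \<Longrightarrow> weak_sol \<tau> y r g \<Longrightarrow>
      (norm (S y))\<^sup>2 \<le> C * max (1 / m \<bar>\<tau>\<bar>) 1 * ((norm (G y))\<^sup>2 + (norm r + norm g)\<^sup>2)"
proof -
  obtain \<psi> :: "real \<Rightarrow> real" and C T0 N and e :: "real \<Rightarrow> real" where
    \<psi>: "continuous_on {0..} \<psi>" "0 < \<psi> 1" and C: "0 < C" and N: "0 < N"
    and e: "\<And>\<tau>. T0 \<le> \<tau> \<Longrightarrow> 0 \<le> e \<tau>" "e \<in> o[at_top](\<lambda>\<tau>. min (m \<tau> * \<tau> powr (4 * N)) \<tau>)"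
    and dom: "\<And>u \<tau>. u \<in> Hs E (1/2) \<Longrightarrow> T0 \<le> \<tau> \<Longrightarrow> u \<in> fcalc_dom E (\<lambda>x. complex_of_real (\<psi> (x / \<tau>\<^sup>2)))"
    and bound: "\<And>u \<tau>. u \<in> Hs E (1/2) \<Longrightarrow> T0 \<le> \<tau> \<Longrightarrow>
      m \<tau> * (norm (fcalc E (\<lambda>x. complex_of_real (\<psi> (x / \<tau>\<^sup>2))) u))\<^sup>2
        \<le> C * (norm (Q u))\<^sup>2 + e \<tau> * (norm (Lam E (- N) u))\<^sup>2"
    using ell unfolding m_elliptic_def by blast
  define c where "c = \<psi> 1 / 2"
  have "0 < c"
    using \<psi>(2) by (simp add: c_def)
  obtain d where d: "0 < d" "\<And>t. 0 \<le> t \<Longrightarrow> \<bar>t - 1\<bar> < d \<Longrightarrow> \<bar>\<psi> t - \<psi> 1\<bar> < c"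
  proof -
    have "\<exists>d>0. \<forall>t\<in>{0..}. dist t 1 < d \<longrightarrow> dist (\<psi> t) (\<psi> 1) < c"
      using \<psi>(1) \<open>0 < c\<close> unfolding continuous_on_iff by simp
    then show thesis
      using that by (auto simp: dist_real_def)
  qed
  \<comment> \<open>At most 1/2 for \<open>near_bound\<close>, and strictly below d so that \<psi>(x
    / \<tau>^2) exceeds c = \<psi>(1)/2 on the closed window.\<close>
  define \<delta> where "\<delta> = min (1/2) (d / 2)"
  have \<delta>: "0 < \<delta>" "\<delta> \<le> 1/2" "\<delta> < d"
    using d(1) by (auto simp: \<delta>_def)
  \<comment> \<open>Small enough to absorb the near part of the error; 4^N is the square of the
    factor 2^N in \<open>near_bound\<close>.\<close>
  define \<epsilon> where "\<epsilon> = min 1 (c\<^sup>2 / (4 * 4 powr N))"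
  have "0 < \<epsilon>"
    using \<open>0 < c\<close> by (simp add: \<epsilon>_def)
  have "\<epsilon> \<le> c\<^sup>2 / (4 * 4 powr N)"
    by (simp add: \<epsilon>_def)
  then have \<epsilon>: "4 * (\<epsilon> * 4 powr N) \<le> c\<^sup>2"
    by (simp add: field_simps)
  have "\<epsilon> \<le> 1"
    by (simp add: \<epsilon>_def)
  obtain T1 where T1: "\<And>\<tau>. T1 \<le> \<tau> \<Longrightarrow> norm (e \<tau>) \<le> \<epsilon> * norm (min (m \<tau> * \<tau> powr (4 * N)) \<tau>)"
    using landau_o.smallD[OF e(2) \<open>0 < \<epsilon>\<close>] unfolding eventually_at_top_linorder by blast
  define D where "D = 1 + 2 / \<delta>"
  define C' where "C' = 4 / c\<^sup>2 * (C + 4 * D\<^sup>2 + 8 * D\<^sup>2 * K\<^sup>2) + 4 * D\<^sup>2 * (1 + K\<^sup>2)"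
  have "0 < C'"
    unfolding C'_def using C \<open>0 < c\<close> by (intro add_pos_nonneg mult_pos_pos add_pos_nonneg) auto
  moreover have "1 \<le> max 1 (max T0 T1)"
    by simp
  moreover have "(norm (S y))\<^sup>2 \<le> C' * max (1 / m \<bar>\<tau>\<bar>) 1 * ((norm (G y))\<^sup>2 + (norm r + norm g)\<^sup>2)"
    if \<tau>: "max 1 (max T0 T1) \<le> \<bar>\<tau>\<bar>" and sol: "weak_sol \<tau> y r g" for \<tau> y r g
  proof -
    have \<tau>: "1 \<le> \<bar>\<tau>\<bar>" "T0 \<le> \<bar>\<tau>\<bar>" "T1 \<le> \<bar>\<tau>\<bar>"
      using \<tau> by simp_all
    then have m\<tau>: "0 < m \<bar>\<tau>\<bar>"
      by (intro m) linarith
    define w where "w = fcalc E (\<lambda>x. complex_of_real (\<psi> (x / \<bar>\<tau>\<bar>\<^sup>2))) (S y)"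
    have Sy: "S y \<in> Hs E (1/2)"
      by (simp add: Hs_half)
    have "norm (fc (indicator (near \<delta> \<tau>)) (S y)) \<le> 1 / c * norm w"
    proof (rule fc_norm_le_integral)
      show "symbol (indicator (near \<delta> \<tau>))"
        by (intro symbol_indicator near_borel)
      show "has_spectral_integral E (\<lambda>\<rho>. complex_of_real (\<psi> (\<rho>\<^sup>2 / \<bar>\<tau>\<bar>\<^sup>2))) (S y) w"
        unfolding w_def using fcalc_dom_integral[OF dom[OF Sy \<tau>(2)]] .
      fix x :: real
      assume x: "0 \<le> x"
      show "\<bar>indicator (near \<delta> \<tau>) x\<bar> \<le> 1 / c * \<bar>\<psi> (x / \<bar>\<tau>\<bar>\<^sup>2)\<bar>"
      proof (cases "x \<in> near \<delta> \<tau>")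
        case True
        have pos: "0 < \<tau>\<^sup>2"
          using \<tau>(1) by auto
        have "x / \<tau>\<^sup>2 - 1 = (x - \<tau>\<^sup>2) / \<tau>\<^sup>2"
          using pos by (simp add: diff_divide_distrib)
        then have "\<bar>x / \<tau>\<^sup>2 - 1\<bar> = \<bar>x - \<tau>\<^sup>2\<bar> / \<tau>\<^sup>2"
          by (simp add: abs_divide)
        also have "\<dots> \<le> \<delta>"
          using True pos by (simp add: near_def divide_le_eq)
        finally have "\<bar>\<psi> (x / \<tau>\<^sup>2) - \<psi> 1\<bar> < c"
          using \<delta>(3) x by (intro d(2)) auto
        then have "c \<le> \<bar>\<psi> (x / \<tau>\<^sup>2)\<bar>"
          by (simp add: c_def abs_if split: if_splits)
        then show ?thesis
          using True \<open>0 < c\<close> by (simp add: field_simps)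
      qed (use \<open>0 < c\<close> in simp)
    qed (use \<open>0 < c\<close> in simp)
    then have "c * norm (fc (indicator (near \<delta> \<tau>)) (S y)) \<le> norm w"
      using \<open>0 < c\<close> by (simp add: field_simps)
    then have "(c * norm (fc (indicator (near \<delta> \<tau>)) (S y)))\<^sup>2 \<le> (norm w)\<^sup>2"
      using \<open>0 < c\<close> by (intro power_mono) auto
    then have "m \<bar>\<tau>\<bar> * (c * norm (fc (indicator (near \<delta> \<tau>)) (S y)))\<^sup>2 \<le> m \<bar>\<tau>\<bar> * (norm w)\<^sup>2"
      using m\<tau> by (intro mult_left_mono) auto
    also have "\<dots> \<le> C * (norm (G y))\<^sup>2 + e \<bar>\<tau>\<bar> * (norm (Lam E (- N) (S y)))\<^sup>2"
      using bound[OF Sy \<tau>(2)] by (simp add: w_def G)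
    finally have near: "m \<bar>\<tau>\<bar> * (c * norm (fc (indicator (near \<delta> \<tau>)) (S y)))\<^sup>2
        \<le> C * (norm (G y))\<^sup>2 + e \<bar>\<tau>\<bar> * (norm (Lam E (- N) (S y)))\<^sup>2" .
    let ?h = "min (m \<bar>\<tau>\<bar> * \<bar>\<tau>\<bar> powr (4 * N)) \<bar>\<tau>\<bar>"
    have "0 < ?h"
      using m\<tau> \<tau>(1) by simp
    then have e\<tau>: "0 \<le> e \<bar>\<tau>\<bar>" "e \<bar>\<tau>\<bar> \<le> \<epsilon> * ?h"
      using T1[OF \<tau>(3)] e(1)[OF \<tau>(2)] by simp_all
    have "\<epsilon> * ?h \<le> \<epsilon> * (m \<bar>\<tau>\<bar> * \<bar>\<tau>\<bar> powr (4 * N))"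
      using \<open>0 < \<epsilon>\<close> by (intro mult_left_mono) auto
    then have "e \<bar>\<tau>\<bar> \<le> \<epsilon> * (m \<bar>\<tau>\<bar> * \<bar>\<tau>\<bar> powr (4 * N))"
      using e\<tau>(2) by (rule order_trans[rotated])
    moreover have "\<epsilon> * ?h \<le> 1 * \<bar>\<tau>\<bar>"
      using \<open>0 < ?h\<close> \<open>\<epsilon> \<le> 1\<close> by (intro mult_mono) auto
    then have "e \<bar>\<tau>\<bar> \<le> \<bar>\<tau>\<bar>"
      using e\<tau>(2) by simp
    ultimately show ?thesis
      unfolding C'_def D_def
      using weak_sol_elliptic[OF sol \<tau>(1) \<delta>(1,2) N \<open>0 < c\<close> C m\<tau> near e\<tau>(1) _ _ \<open>\<epsilon> \<le> 1\<close> \<epsilon>] by blast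
  qed
  ultimately show thesis
    by (rule that)
qed


section \<open>The resolvent of the damped wave generator\<close>

lemma G_add: "G (x + y) = G x + G y" and G_scale: "G (c *\<^sub>C x) = c *\<^sub>C G x"
  and S_add: "S (x + y) = S x + S y" and S_scale: "S (c *\<^sub>C x) = c *\<^sub>C S x"
  using G_linear S_linear by (simp_all add: clinear_on_UNIV_iff)

lemma G_diff: "G (x - y) = G x - G y" and S_diff: "S (x - y) = S x - S y"
  by (rule clinear_on_UNIV_diff[OF G_linear], rule clinear_on_UNIV_diff[OF S_linear])

section \<open>The bounded operator B and its lower bound\<close>

definition G' :: "'y \<Rightarrow> 'h" where
  "G' = (SOME G'. \<forall>x y. cinner (G x) y = cinner x (G' y))"

lemma G'_adjoint: "cinner (G x) y = cinner x (G' y)"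
proof -
  have "\<exists>G'. \<forall>x y. cinner (G x) y = cinner x (G' y)"
    by (rule riesz_adjoint[OF G_linear norm_G_le]) blast
  from someI_ex[OF this, folded G'_def] show ?thesis
    by blast
qed

lemma G'_adjoint': "cinner (G' y) x = cinner y (G x)"
  using cinner_commute[of "G' y" x] cinner_commute[of y "G x"] G'_adjoint[of x y] by simp

definition B :: "real \<Rightarrow> 'h \<Rightarrow> 'h" where
  "B \<tau> x = x - of_real (1 + \<tau>\<^sup>2) *\<^sub>C S (S x) - (\<i> * of_real \<tau>) *\<^sub>C G' (G x)"

lemma cinner_B: "cinner (B \<tau> x) z
    = cinner x z - of_real (1 + \<tau>\<^sup>2) * cinner (S x) (S z) - \<i> * of_real \<tau> * cinner (G x) (G z)"
  by (simp add: B_def cinner_diff_left cinner_scaleC_left S_adjoint G'_adjoint')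

lemma B_adjoint: "cinner (B (- \<tau>) x) y = cinner x (B \<tau> y)"
  unfolding cinner_B
  by (simp add: B_def cinner_diff_right cinner_scaleC_right S_adjoint G'_adjoint)

text \<open>Tested against z, the operator becomes the form in \<open>cinner_B\<close>, where G' has
  turned into G; so linearity of S and G decides.\<close>

lemma B_linear: "clinear_on UNIV (B \<tau>)"
  unfolding clinear_on_UNIV_iff
  by (intro conjI allI; rule eq_if_cinner_eq)
    (simp_all add: cinner_B cinner_add_left cinner_scaleC_left S_add S_scale G_add G_scale algebra_simps)

text \<open>Testing \<open>B \<tau> x\<close> against itself again trades G' for G, whose bound K is
  known; one factor of the norm then cancels.\<close>

lemma B_bounded: "norm (B \<tau> x) \<le> (1 + (1 + \<tau>\<^sup>2) + \<bar>\<tau>\<bar> * (K * K)) * norm x"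
proof (cases "B \<tau> x = 0")
  case False
  let ?z = "B \<tau> x"
  have "norm ?z * norm ?z = cmod (cinner ?z ?z)"
    by (simp add: cinner_self power2_eq_square norm_mult)
  also have "\<dots> \<le> cmod (cinner x ?z) + cmod (of_real (1 + \<tau>\<^sup>2) * cinner (S x) (S ?z))
      + cmod (\<i> * of_real \<tau> * cinner (G x) (G ?z))"
    unfolding cinner_B[of \<tau> x] by (smt (verit) norm_triangle_ineq4)
  also have "\<dots> = cmod (cinner x ?z) + (1 + \<tau>\<^sup>2) * cmod (cinner (S x) (S ?z)) + \<bar>\<tau>\<bar> * cmod (cinner (G x) (G ?z))"
    unfolding norm_mult norm_of_real by simp
  also have "\<dots> \<le> norm x * norm ?z + (1 + \<tau>\<^sup>2) * (norm x * norm ?z) + \<bar>\<tau>\<bar> * ((K * norm x) * (K * norm ?z))"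
    by (intro add_mono mult_left_mono order_trans[OF norm_cinner_le] mult_mono norm_S_le norm_G_le)
      (use K_nonneg in auto)
  also have "\<dots> = (1 + (1 + \<tau>\<^sup>2) + \<bar>\<tau>\<bar> * (K * K)) * norm x * norm ?z"
    by (simp add: algebra_simps)
  finally show ?thesis
    using False by simp
qed (use K_nonneg in simp)

text \<open>Every x is a weak solution for its own residual, so the a priori estimate for weak
  solutions becomes a lower bound for B.\<close>

lemma weak_sol_B: "weak_sol \<tau> x (B \<tau> x) 0"
  by (simp add: weak_sol_def cinner_B)

text \<open>The imaginary part of <B x, x> controls ||G x||^2, then \<open>est\<close> controls ||S
  x||, and \<open>norm_le_of_weak_sol\<close> controls ||x||. The constant may depend on \<tau>: it
  is for bijectivity, not for the resolvent bound.\<close>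

lemma B_bounded_below:
  assumes \<tau>: "1 \<le> \<bar>\<tau>\<bar>" and "0 \<le> L"
    and est: "\<And>y r g. weak_sol \<tau> y r g \<Longrightarrow> (norm (S y))\<^sup>2 \<le> L * ((norm (G y))\<^sup>2 + (norm r + norm g)\<^sup>2)"
  obtains c where "0 < c" "\<And>x. c * norm x \<le> norm (B \<tau> x)"
proof -
  \<comment> \<open>From squaring ||x|| \<le> 2|\<tau>| ||S x|| + 2||B x|| with the doubling of
    squares; L enters through the bound on ||S x||^2.\<close>
  define L' where "L' = 8 * \<tau>\<^sup>2 * L + 8"
  have L': "1 \<le> L'"
    using \<open>0 \<le> L\<close> by (simp add: L'_def)
  have "norm x \<le> 2 * L' * norm (B \<tau> x)" for x
  proof (rule le_of_square_le)
    let ?r = "B \<tau> x"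
    have "Im (cinner ?r x) = - \<tau> * (norm (G x))\<^sup>2"
      unfolding cinner_B[of \<tau> x x] by (simp add: cinner_self flip: of_real_power)
    then have "\<bar>\<tau>\<bar> * (norm (G x))\<^sup>2 = \<bar>Im (cinner ?r x)\<bar>"
      by (simp add: abs_mult)
    also have "\<dots> \<le> norm ?r * norm x"
      using abs_Im_le_cmod norm_cinner_le order_trans by blast
    finally have G: "(norm (G x))\<^sup>2 \<le> norm ?r * norm x"
      using mult_right_mono[OF \<tau>, of "(norm (G x))\<^sup>2"] by simp
    have S: "(norm (S x))\<^sup>2 \<le> L * ((norm (G x))\<^sup>2 + (norm ?r)\<^sup>2)"
      using est[OF weak_sol_B, of x] by simp
    also have "\<dots> \<le> L * (norm ?r * norm x + (norm ?r)\<^sup>2)"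
      using G \<open>0 \<le> L\<close> by (intro mult_left_mono add_right_mono) auto
    finally have S: "8 * \<tau>\<^sup>2 * (norm (S x))\<^sup>2 \<le> 8 * \<tau>\<^sup>2 * (L * (norm ?r * norm x + (norm ?r)\<^sup>2))"
      by (rule mult_left_mono) simp
    have "norm x \<le> 2 * \<bar>\<tau>\<bar> * norm (S x) + 2 * norm ?r"
      using norm_le_of_weak_sol[OF weak_sol_B \<tau>, of x] by simp
    then have "(norm x)\<^sup>2 \<le> (2 * \<bar>\<tau>\<bar> * norm (S x) + 2 * norm ?r)\<^sup>2"
      by (intro power_mono) auto
    also have "\<dots> \<le> 2 * (2 * \<bar>\<tau>\<bar> * norm (S x))\<^sup>2 + 2 * (2 * norm ?r)\<^sup>2"
      using sum_squares_bound[of "2 * \<bar>\<tau>\<bar> * norm (S x)" "2 * norm ?r"] by (simp only: power2_sum)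
    also have "\<dots> = 8 * \<tau>\<^sup>2 * (norm (S x))\<^sup>2 + 8 * (norm ?r)\<^sup>2"
      by (simp add: power_mult_distrib)
    also have "\<dots> \<le> 8 * \<tau>\<^sup>2 * (L * (norm ?r * norm x + (norm ?r)\<^sup>2)) + 8 * (norm ?r * norm x + (norm ?r)\<^sup>2)"
      using S by (intro add_mono) auto
    also have "\<dots> = L' * (norm ?r * norm x + (norm ?r)\<^sup>2)"
      by (simp add: L'_def algebra_simps)
    finally show "(norm x)\<^sup>2 \<le> L' * (norm ?r * norm x + (norm ?r)\<^sup>2)" .
  qed (use L' in auto)
  then have "1 / (2 * L') * norm x \<le> norm (B \<tau> x)" for x
    using L' by (simp add: divide_le_eq mult.commute)
  then show thesis
    using L' by (intro that[of "1 / (2 * L')"]) auto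
qed

section \<open>The resolvent equation\<close>

text \<open>\<open>h = Pu + Q\<^sup>*Qv\<close> in \<open>H\<^bsub>-1/2\<^esub>\<close>, where \<open>u = Sx\<close> and \<open>v = Sy\<close>.\<close>

definition rep :: "'h \<Rightarrow> 'h \<Rightarrow> 'h \<Rightarrow> bool" where
  "rep x y h \<longleftrightarrow> (\<forall>z. cinner x z - cinner (S x) (S z) + cinner (G y) (G z) = cinner h (S z))"

text \<open>Symmetry of S moves it from the test vector onto h, and S is injective.\<close>

lemma rep_unique: "rep x y h \<Longrightarrow> rep x y h' \<Longrightarrow> h = h'"
proof -
  assume "rep x y h" "rep x y h'"
  then have "cinner (S h) z = cinner (S h') z" for z
    unfolding rep_def S_adjoint by metis
  then show ?thesis
    using eq_if_cinner_eq S_eq_iff by blast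
qed

text \<open>The two components of the resolvent equation with right-hand side (S a, g) read y = a -
  i\<tau> x and h = i\<tau> S y - g; substituting them leaves one equation for x.\<close>

lemma rep_iff_B:
  "rep x (a - (\<i> * of_real \<tau>) *\<^sub>C x) ((\<i> * of_real \<tau>) *\<^sub>C S (a - (\<i> * of_real \<tau>) *\<^sub>C x) - g)
    \<longleftrightarrow> B \<tau> x = (\<i> * of_real \<tau>) *\<^sub>C S (S a) - G' (G a) - S g"
    (is "?L \<longleftrightarrow> _ = ?r")
proof -
  have "?L \<longleftrightarrow> (\<forall>z. cinner (B \<tau> x) z = cinner ?r z)"
    unfolding rep_def cinner_B
    by (simp add: cinner_add_left cinner_diff_left cinner_scaleC_left S_adjoint G'_adjoint' G_diff G_scale
        S_diff S_scale algebra_simps power2_eq_square)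
  also have "\<dots> \<longleftrightarrow> B \<tau> x = ?r"
    using eq_if_cinner_eq by metis
  finally show ?thesis .
qed

text \<open>Multiply the second component by i\<tau> and replace i\<tau> x by a - y. The square of
  i\<tau> produces -\<tau>^2, and a - S (S a) represents P f for f = S a.\<close>

lemma rep_weak_sol:
  assumes "rep x y h" and y: "y = a - (\<i> * of_real \<tau>) *\<^sub>C x" and h: "h = (\<i> * of_real \<tau>) *\<^sub>C S y - g"
  shows "weak_sol \<tau> y (a - S (S a)) g"
  unfolding weak_sol_def
proof
  fix z
  define t where "t = \<i> * complex_of_real \<tau>"
  have "cinner x z - cinner (S x) (S z) + cinner (G y) (G z) = t * cinner (S y) (S z) - cinner g (S z)"
    using assms(1) unfolding rep_def h by (simp add: cinner_diff_left cinner_scaleC_left t_def)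
  moreover have "t * cinner x z = cinner a z - cinner y z"
    "t * cinner (S x) (S z) = cinner (S a) (S z) - cinner (S y) (S z)"
    unfolding y by (simp_all add: cinner_diff_left cinner_scaleC_left S_diff S_scale t_def)
  ultimately have "cinner y z - cinner (S y) (S z) + t * t * cinner (S y) (S z)
      = cinner a z - cinner (S a) (S z) + t * (cinner (G y) (G z) + cinner g (S z))"
    by algebra
  then show "cinner y z - of_real (1 + \<tau>\<^sup>2) * cinner (S y) (S z)
     = cinner (a - S (S a)) z + \<i> * of_real \<tau> * (cinner (G y) (G z) + cinner g (S z))"
    by (simp add: t_def cinner_diff_left S_adjoint algebra_simps power2_eq_square)
qed

text \<open>The damping identity, from the real part of the equation tested with z = y. Terms with
  i\<tau> drop out, and in the form of P the vector y may be replaced by a. That form is a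
  difference of two inner products, each at most ||x|| ||a||; hence the 2.\<close>

lemma rep_energy:
  assumes "rep x y h" and y: "y = a - (\<i> * of_real \<tau>) *\<^sub>C x" and h: "h = (\<i> * of_real \<tau>) *\<^sub>C S y - g"
  shows "(norm (G y))\<^sup>2 \<le> norm g * norm (S y) + 2 * norm x * norm a"
proof -
  have "cinner x y - cinner (S x) (S y) + cinner (G y) (G y) = \<i> * of_real \<tau> * cinner (S y) (S y) - cinner g (S y)"
    using assms(1) unfolding rep_def h by (simp add: cinner_diff_left cinner_scaleC_left)
  then have "Re (cinner x y) - Re (cinner (S x) (S y)) + (norm (G y))\<^sup>2 = - Re (cinner g (S y))"
    by (simp add: cinner_self complex_eq_iff flip: of_real_power)
  moreover have "Re (cinner x y) = Re (cinner x a)" "Re (cinner (S x) (S y)) = Re (cinner (S x) (S a))"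
    unfolding y by (simp_all add: cinner_diff_right cinner_scaleC_right S_diff S_scale cinner_self flip: of_real_power)
  ultimately have "(norm (G y))\<^sup>2 = Re (cinner (- g) (S y)) + Re (cinner (- x) a) + Re (cinner (S x) (S a))"
    by simp
  also have "\<dots> \<le> norm (- g) * norm (S y) + norm (- x) * norm a + norm (S x) * norm (S a)"
    by (intro add_mono Re_cinner_le_norm)
  also have "norm (S x) * norm (S a) \<le> norm x * norm a"
    by (intro mult_mono norm_S_le) auto
  finally show ?thesis
    by (simp add: mult_ac)
qed

text \<open>With n = ||S y||, the norm of x is at most 2n + 5R because i\<tau> x = a - y and ||y||
  is at most of order |\<tau>| n + R. The damping identity then bounds ||G y||^2 by a multiple of R
  n + R^2, and \<open>est\<close> becomes a quadratic inequality for n alone.\<close>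

lemma rep_bound:
  assumes rep: "rep x y h" and y: "y = a - (\<i> * of_real \<tau>) *\<^sub>C x" and h: "h = (\<i> * of_real \<tau>) *\<^sub>C S y - g"
    and \<tau>: "1 \<le> \<bar>\<tau>\<bar>" and C: "0 < C" and M: "1 \<le> M"
    and est: "\<And>y r g. weak_sol \<tau> y r g \<Longrightarrow> (norm (S y))\<^sup>2 \<le> C * M * ((norm (G y))\<^sup>2 + (norm r + norm g)\<^sup>2)"
  shows "norm x + norm (S y) \<le> (84 * C + 11) * M * (norm a + norm g)"
proof -
  define R where "R = norm a + norm g"
  define n where "n = norm (S y)"
  \<comment> \<open>14 = 10 + 4 adds the R^2 coefficients of ||G y||^2 and of (2R)^2; the summand 1
    ensures L \<ge> 1. In the end 6L + 5M = (84 C + 11) M.\<close>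
  define L where "L = (14 * C + 1) * M"
  have nonneg: "0 \<le> R" "0 \<le> n" and aR: "norm a \<le> R" "norm a + norm a + norm g \<le> 2 * R"
    by (simp_all add: R_def n_def)
  have "1 * 1 \<le> (14 * C + 1) * M"
    using C M by (intro mult_mono) auto
  then have L: "1 \<le> L"
    by (simp add: L_def)
  note sol = rep_weak_sol[OF rep y h]
  have "norm (a - S (S a)) \<le> norm a + norm (S (S a))"
    by (rule norm_triangle_ineq4)
  also have "\<dots> \<le> norm a + norm a"
    by (intro add_left_mono order_trans[OF norm_S_le norm_S_le])
  finally have r: "norm (a - S (S a)) + norm g \<le> 2 * R"
    using aR(2) by linarith
  have ny: "norm y \<le> 2 * \<bar>\<tau>\<bar> * n + 4 * R"
    using norm_le_of_weak_sol[OF sol \<tau>] r by (simp add: n_def)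
  have "\<bar>\<tau>\<bar> * norm x = norm (a - y)"
    unfolding y by (simp add: norm_scaleC norm_mult)
  also have "\<dots> \<le> norm a + norm y"
    by (rule norm_triangle_ineq4)
  also have "\<dots> \<le> 2 * \<bar>\<tau>\<bar> * n + 5 * R"
    using ny aR(1) by linarith
  also have "\<dots> \<le> \<bar>\<tau>\<bar> * (2 * n + 5 * R)"
    using mult_right_mono[OF \<tau>, of "5 * R"] nonneg by (simp add: algebra_simps)
  finally have nx: "norm x \<le> 2 * n + 5 * R"
    using \<tau> by (simp add: mult_le_cancel_left)
  have "(norm (G y))\<^sup>2 \<le> norm g * n + 2 * norm x * norm a"
    using rep_energy[OF rep y h] by (simp add: n_def)
  also have "\<dots> \<le> R * n + 2 * (2 * n + 5 * R) * R"
    using nx nonneg by (intro add_mono mult_mono) (auto simp: R_def)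
  finally have Gy: "(norm (G y))\<^sup>2 \<le> 5 * (R * n) + 10 * R\<^sup>2"
    by (simp add: algebra_simps power2_eq_square)
  have "n\<^sup>2 \<le> C * M * ((norm (G y))\<^sup>2 + (norm (a - S (S a)) + norm g)\<^sup>2)"
    using est[OF sol] by (simp add: n_def)
  also have "\<dots> \<le> C * M * ((5 * (R * n) + 10 * R\<^sup>2) + (2 * R)\<^sup>2)"
    using C M r Gy by (intro mult_left_mono add_mono power_mono) auto
  also have "\<dots> \<le> C * M * (14 * (R * n + R\<^sup>2))"
    using C M nonneg by (intro mult_left_mono) (auto simp: power_mult_distrib)
  also have "\<dots> \<le> L * (R * n + R\<^sup>2)"
    using M nonneg mult_nonneg_nonneg[of M "R * n + R\<^sup>2"] by (simp add: L_def algebra_simps)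
  finally have "n \<le> 2 * L * R"
    using nonneg L by (intro le_of_square_le)
  then have "norm x + n \<le> 6 * (L * R) + 5 * (1 * R)"
    using nx by simp
  also have "\<dots> \<le> 6 * (L * R) + 5 * (M * R)"
    using M nonneg by (intro add_left_mono mult_left_mono mult_right_mono) auto
  finally show ?thesis
    by (simp add: L_def n_def R_def algebra_simps)
qed

text \<open>The estimate is assumed at both \<tau> and -\<tau>: the lower bound for
  \<open>B \<tau>\<close> gives injectivity, the one for its adjoint \<open>B (- \<tau>)\<close>
  gives surjectivity.\<close>

lemma damped_resolvent:
  assumes G_eq: "\<And>x. G x = Q (S x)" and \<tau>: "1 \<le> \<bar>\<tau>\<bar>" and C: "0 < C" and M: "1 \<le> M"
    and est: "\<And>\<tau>' y r g. \<bar>\<tau>'\<bar> = \<bar>\<tau>\<bar> \<Longrightarrow> weak_sol \<tau>' y r g \<Longrightarrow>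
      (norm (S y))\<^sup>2 \<le> C * M * ((norm (G y))\<^sup>2 + (norm r + norm g)\<^sup>2)"
  shows "\<exists>R. inverse_operator (energy_space E) (damped_dom E Q)
           (\<lambda>U. damped_gen E Q U + (\<i> * complex_of_real \<tau>) *\<^sub>C U) R
       \<and> bounded_operator (energy_space E) (energy_norm E) (energy_norm E) R
       \<and> operator_norm (energy_space E) (energy_norm E) (energy_norm E) R \<le> 2 * (84 * C + 11) * M"
proof -
  let ?X = "energy_space E" and ?D = "damped_dom E Q" and ?n = "energy_norm E"
  define t where "t = \<i> * complex_of_real \<tau>"
  define T where "T U = damped_gen E Q U + t *\<^sub>C U" for U
  \<comment> \<open>Test functions in \<open>H_{1/2}\<close> are exactly the vectors S z, so
    representation by h becomes an identity in z over the whole space.\<close>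
  have rep: "represented_by E (\<lambda>w. P_ext E (S x) w + adj_ext Q (Q (S y)) w) = rep x y" for x y
    by (rule ext) (simp add: represented_by_def Hs_half adj_ext_def P_ext_S rep_def G_eq)
  have D: "U \<in> ?D \<longleftrightarrow> (\<exists>x y h. U = (S x, S y) \<and> rep x y h)" for U
    by (cases U) (auto simp: damped_dom_def Hs_half rep)
  have T: "T (S x, S y) = (S y + t *\<^sub>C S x, t *\<^sub>C S y - h)" if "rep x y h" for x y h
  proof -
    have "(THE h. rep x y h) = h"
      using that rep_unique by blast
    then show ?thesis
      by (simp add: T_def damped_gen_def rep scaleC_prod_def)
  qed
  have T_eq: "T (S x, S y) = (S a, g) \<longleftrightarrow> y = a - t *\<^sub>C x \<and> h = t *\<^sub>C S y - g"
    if "rep x y h" for x y h a g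
  proof -
    have "S y + t *\<^sub>C S x = S a \<longleftrightarrow> y + t *\<^sub>C x = a"
      by (simp flip: S_scale S_add)
    also have "\<dots> \<longleftrightarrow> y = a - t *\<^sub>C x"
      by (auto simp: algebra_simps)
    finally show ?thesis
      unfolding T[OF that] by (auto simp: algebra_simps)
  qed
  have rep_zero: "rep 0 0 0"
    using G_scale[of 0 0] S_scale[of 0 0] by (simp add: rep_def)
  have rep_add: "rep (x + x') (y + y') (h + h')" if "rep x y h" "rep x' y' h'" for x x' y y' h h'
    using that unfolding rep_def S_add G_add cinner_add_left by (simp add: algebra_simps)
  have rep_scale: "rep (c *\<^sub>C x) (c *\<^sub>C y) (c *\<^sub>C h)" if "rep x y h" for c x y h
    using that unfolding rep_def S_scale G_scale cinner_scaleC_left by (simp flip: right_diff_distrib distrib_left)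
  have "clinear_on ?D T"
    unfolding clinear_on_def csubspace_iff
  proof (intro conjI ballI allI)
    have "S 0 = 0"
      using S_scale[of 0 0] by simp
    then show "0 \<in> ?D"
      unfolding D using rep_zero by (metis zero_prod_def)
    fix U V c
    assume "U \<in> ?D" "V \<in> ?D"
    then obtain x y h x' y' h' where U: "U = (S x, S y)" "rep x y h" and V: "V = (S x', S y')" "rep x' y' h'"
      unfolding D by blast
    have UV: "U + V = (S (x + x'), S (y + y'))" and cU: "c *\<^sub>C U = (S (c *\<^sub>C x), S (c *\<^sub>C y))"
      by (simp_all add: U V S_add S_scale scaleC_prod_def)
    show "U + V \<in> ?D" "c *\<^sub>C U \<in> ?D"
      unfolding D UV cU using rep_add[OF U(2) V(2)] rep_scale[OF U(2)] by blast+
    show "T (U + V) = T U + T V"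
      unfolding UV T[OF rep_add[OF U(2) V(2)]] unfolding U(1) V(1) T[OF U(2)] T[OF V(2)]
      by (simp add: S_add scaleC_add_right)
    show "T (c *\<^sub>C U) = c *\<^sub>C T U"
      unfolding cU T[OF rep_scale[OF U(2)]] unfolding U(1) T[OF U(2)]
      by (simp add: S_scale scaleC_prod_def scaleC_add_right scaleC_diff_right scaleC_scaleC mult.commute)
  qed
  moreover have X: "csubspace ?X"
    unfolding csubspace_iff energy_space_def Hs_half
  proof (intro conjI ballI allI)
    show "0 \<in> range S \<times> UNIV"
      using S_scale[of 0 0] by (metis UNIV_I mem_Sigma_iff rangeI scaleC_zero_left zero_prod_def)
  qed (auto simp: scaleC_prod_def simp flip: S_add S_scale)
  moreover have "T U \<in> ?X" if "U \<in> ?D" for U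
    using that unfolding D energy_space_def Hs_half by (auto simp: T simp flip: S_add S_scale)
  moreover have "\<exists>!U. U \<in> ?D \<and> T U = F" if FX: "F \<in> ?X" for F
  proof -
    obtain a g where F: "F = (S a, g)"
      using FX by (cases F) (auto simp: energy_space_def Hs_half)
    obtain c where c: "0 < c" "\<And>x. c * norm x \<le> norm (B \<tau> x)"
      using B_bounded_below[OF \<tau>, of "C * M"] est[of \<tau>] C M by auto
    obtain c' where c': "0 < c'" "\<And>x. c' * norm x \<le> norm (B (- \<tau>) x)"
      using B_bounded_below[of "- \<tau>" "C * M"] est[of "- \<tau>"] C M \<tau> by auto
    have "surj (B \<tau>)"
      using surj_if_adjoint_bounded_below[OF B_linear B_bounded B_adjoint c'] .
    then obtain x where x: "B \<tau> x = t *\<^sub>C S (S a) - G' (G a) - S g"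
      by (metis surjD)
    have inj: "x' = x" if "B \<tau> x' = B \<tau> x" for x'
    proof -
      have "c * norm (x' - x) \<le> 0"
        using c(2)[of "x' - x"] that by (simp add: clinear_on_UNIV_diff[OF B_linear])
      then show ?thesis
        using c(1) by (simp add: mult_le_0_iff)
    qed
    define y where "y = a - t *\<^sub>C x"
    have rep_xy: "rep x y (t *\<^sub>C S y - g)"
      using rep_iff_B[of x a \<tau> g] x by (simp add: y_def t_def)
    show ?thesis
    proof (rule ex1I[of _ "(S x, S y)"])
      show "(S x, S y) \<in> ?D \<and> T (S x, S y) = F"
        unfolding F T_eq[OF rep_xy] unfolding D using rep_xy y_def by blast
      fix U
      assume U: "U \<in> ?D \<and> T U = F"
      then obtain x' y' h where U': "U = (S x', S y')" "rep x' y' h"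
        unfolding D by blast
      then have eqs: "y' = a - t *\<^sub>C x'" "h = t *\<^sub>C S y' - g"
        using U T_eq F by auto
      then have "B \<tau> x' = B \<tau> x"
        using rep_iff_B[of x' a \<tau> g] x U'(2) by (simp add: t_def)
      then have "x' = x"
        by (rule inj)
      then show "U = (S x, S y)"
        using U'(1) eqs(1) by (simp add: y_def)
    qed
  qed
  ultimately obtain R where R: "inverse_operator ?X ?D T R" "clinear_on ?X R"
    using linear_inverse by blast
  define L where "L = 2 * (84 * C + 11) * M"
  have "0 \<le> L"
    using C M by (simp add: L_def)
  have bound: "?n (R F) \<le> L * ?n F" if FX: "F \<in> ?X" for F
  proof -
    obtain a g where F: "F = (S a, g)"
      using FX by (cases F) (auto simp: energy_space_def Hs_half)
    have "R F \<in> ?D" "T (R F) = F"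
      using R(1) FX by (auto simp: inverse_operator_def)
    then obtain x y h where U: "R F = (S x, S y)" "rep x y h"
      unfolding D by blast
    then have eqs: "y = a - t *\<^sub>C x" "h = t *\<^sub>C S y - g"
      using \<open>T (R F) = F\<close> T_eq F by auto
    have "?n (R F) \<le> norm x + norm (S y)"
      unfolding U energy_norm_def by (simp add: Hs_norm_S sqrt_sum_squares_le_sum)
    also have "\<dots> \<le> (84 * C + 11) * M * (norm a + norm g)"
      using rep_bound[OF U(2) eqs[unfolded t_def] \<tau> C M est[OF refl]] .
    \<comment> \<open>Each of ||a|| and ||g|| is at most the energy norm of F; this is the origin of
      the factor 2 in the bound.\<close>
    also have "\<dots> \<le> (84 * C + 11) * M * (2 * ?n F)"
    proof -
      have "norm a \<le> ?n F" "norm g \<le> ?n F"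
        unfolding F energy_norm_def by (simp_all add: Hs_norm_S real_le_rsqrt)
      then show ?thesis
        using C M by (intro mult_left_mono) auto
    qed
    finally show ?thesis
      by (simp add: L_def algebra_simps)
  qed
  have "operator_norm ?X ?n ?n R \<le> L"
    unfolding operator_norm_def
  \<comment> \<open>The real supremum is controlled only over a nonempty set, so 0 is exhibited as
    an element of the unit ball.\<close>
  proof (rule cSup_least)
    have "0 \<in> ?X"
      using X by (simp add: csubspace_iff)
    moreover have "?n 0 \<le> 1"
      using S_scale[of 0 0] Hs_norm_S[of 0] by (simp add: energy_norm_def)
    ultimately show "{?n (R F) |F. F \<in> ?X \<and> ?n F \<le> 1} \<noteq> {}"
      by blast
    fix r
    assume "r \<in> {?n (R F) |F. F \<in> ?X \<and> ?n F \<le> 1}"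
    then obtain F where "r = ?n (R F)" "F \<in> ?X" "?n F \<le> 1"
      by blast
    then show "r \<le> L"
      using bound[of F] mult_left_mono[of "?n F" 1 L] \<open>0 \<le> L\<close> by simp
  qed
  then show ?thesis
    using R bound unfolding bounded_operator_def T_def t_def L_def by blast
qed

end

section \<open>The theorem, with G = Q S\<close>

theorem theorem1p6:
  fixes P :: "'h::complex_hilbert \<Rightarrow> 'h"
    and H1 :: "'h set"
    and E :: "real set \<Rightarrow> 'h \<Rightarrow> 'h"
    and Q :: "'h \<Rightarrow> 'y::complex_hilbert"
    and m :: "real \<Rightarrow> real"
  assumes "infinite_dimensional TYPE('h)"
    and "self_adjoint H1 P"
    and "nonneg_operator H1 P"
    and "compact_resolvent H1 P"
    and "spectral_resolution H1 P E"
    and "bounded_operator (Hs E (1/2)) (Hs_norm E (1/2)) norm Q"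
    and "continuous_on {0<..} m"
    and "\<And>x. 0 < x \<Longrightarrow> 0 < m x"
    and "m_elliptic E Q m"
  shows "\<exists>C>0. \<exists>\<tau>0>0. \<forall>\<tau>::real. \<bar>\<tau>\<bar> \<ge> \<tau>0 \<longrightarrow>
    (\<exists>R. inverse_operator (energy_space E) (damped_dom E Q)
           (\<lambda>U. damped_gen E Q U + (\<i> * complex_of_real \<tau>) *\<^sub>C U) R
       \<and> bounded_operator (energy_space E) (energy_norm E) (energy_norm E) R
       \<and> operator_norm (energy_space E) (energy_norm E) (energy_norm E) R
           \<le> C * max (1 / m \<bar>\<tau>\<bar>) 1)"
proof -
  interpret pvm E
    using assms(5) by unfold_locales (simp add: spectral_resolution_def)
  obtain K0 where Q: "clinear_on (Hs E (1/2)) Q" "\<And>u. u \<in> Hs E (1/2) \<Longrightarrow> norm (Q u) \<le> K0 * Hs_norm E (1/2) u"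
    using assms(6) unfolding bounded_operator_def by blast
  \<comment> \<open>The constant in \<open>bounded_operator\<close> may be negative, hence its
    absolute value.\<close>
  interpret observed_pvm E "\<lambda>x. Q (S x)" "\<bar>K0\<bar>"
  proof
    show "clinear_on UNIV (\<lambda>x. Q (S x))"
      using Q(1) S_linear by (simp add: clinear_on_def Hs_half)
    show "norm (Q (S x)) \<le> \<bar>K0\<bar> * norm x" for x
      using Q(2)[of "S x"] mult_right_mono[OF abs_ge_self, of "norm x" K0]
      by (simp add: Hs_half Hs_norm_S)
  qed simp
  obtain C \<tau>0 where C: "0 < C" "1 \<le> \<tau>0"
    and est: "\<And>\<tau> y r g. \<tau>0 \<le> \<bar>\<tau>\<bar> \<Longrightarrow> weak_sol \<tau> y r g \<Longrightarrow>
      (norm (S y))\<^sup>2 \<le> C * max (1 / m \<bar>\<tau>\<bar>) 1 * ((norm (Q (S y)))\<^sup>2 + (norm r + norm g)\<^sup>2)"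
    using elliptic_estimate[OF assms(8,9) refl] by blast
  have "\<exists>R. inverse_operator (energy_space E) (damped_dom E Q)
           (\<lambda>U. damped_gen E Q U + (\<i> * complex_of_real \<tau>) *\<^sub>C U) R
       \<and> bounded_operator (energy_space E) (energy_norm E) (energy_norm E) R
       \<and> operator_norm (energy_space E) (energy_norm E) (energy_norm E) R
           \<le> 2 * (84 * C + 11) * max (1 / m \<bar>\<tau>\<bar>) 1" if \<tau>: "\<tau>0 \<le> \<bar>\<tau>\<bar>" for \<tau>
  proof (rule damped_resolvent[OF refl _ C(1)])
    show "(norm (S y))\<^sup>2 \<le> C * max (1 / m \<bar>\<tau>\<bar>) 1 * ((norm (Q (S y)))\<^sup>2 + (norm r + norm g)\<^sup>2)"
      if "\<bar>\<tau>'\<bar> = \<bar>\<tau>\<bar>" "weak_sol \<tau>' y r g" for \<tau>' y r g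
      using est[of \<tau>' y r g] that \<tau> by simp
  qed (use \<tau> C(2) in auto)
  moreover have "0 < 2 * (84 * C + 11)" "0 < \<tau>0"
    using C by auto
  ultimately show ?thesis
    by blast
qed

end
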